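(* Fix $k$ such that $L^k$ is base point free and $N_k\ge2$. Then for every $0<\rho<1$ the variance term $I_{2,k}(t,\rho)$ of the two-point function of the random Bergman potential with respect to the heat kernel measure $\mu_t$ satisfies $$\lim_{t\to\infty}\partial_\rho I_{2,k}(t,\rho)=-\frac{\log(1-\rho)}{\rho}.$$ Consequently the function $I_{2,k}(\infty,\rho)$, defined by $\partial_\rho I_{2,k}(\infty,\rho)=\lim_{t\to\infty}\partial_\rho I_{2,k}(t,\rho)$ and $I_{2,k}(\infty,0)=0$, is the dilogarithm: $I_{2,k}(\infty,\rho)=\mathrm{Li}_2(\rho)=-\int_0^\rho\frac{\log(1-s)}{s}\,ds$.
   Context: Let $M$ be a compact Kähler manifold of dimension $n$, $L\to M$ an ample line bundle with Hermitian metric $h_0$ such that $\omega_0=-i\partial\bar\partial\log h_0$ is a Kähler form. Put $N=N_k=\dim H^0(M,L^k)$ and let $s=(s_1,\dots,s_N)$ be a basis of $H^0(M,L^k)$ orthonormal in the sense $\frac1V\int_M \bar s_i s_j h_0^k\,\frac{\omega_0^n}{n!}=\delta_{ij}$, $V=\int_M\omega_0^n/n!$. To a positive definite Hermitian $N\times N$ matrix $P$ with $\det P=1$ associate the Bergman potential $\phi_P(z)=\frac1k\log\sum_{i,j}\bar s_i(z)P_{ij}s_j(z)$ (in a local frame of $L$); write $|s(z)|^2=\sum_j|s_j(z)|^2$. The Berezin kernel is $$\rho(z_1,z_2)=\frac{\left|\sum_j s_j(z_1)\overline{s_j(z_2)}\right|^2}{|s(z_1)|^2|s(z_2)|^2}\in[0,1].$$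 Heat kernel measure: identify $SL(N,\mathbb{C})/SU(N)$ with the positive definite Hermitian matrices $P$ of determinant $1$, with the Riemannian metric $ds^2=\mathrm{Tr}(P^{-1}dP)^2$. $\mu_t$ is the probability measure $p(t,I,P)\,dV(P)$, where $p(t,\cdot,\cdot)$ is the kernel of $e^{t\Delta}$, $I$ is the identity matrix and $dV$ the Riemannian volume. Writing $P=U^\dagger e^\Lambda U$ with $U$ unitary and $\Lambda=\mathrm{diag}(\lambda_1,\dots,\lambda_N)$, it is, up to a normalizing constant, $$\delta\Big(\sum_j\lambda_j\Big)\Delta(\lambda)\Delta(e^\lambda)e^{-\frac1{4t}\sum_j\lambda_j^2}\prod_j d\lambda_j\,[dU],$$ where $\Delta(\lambda)=\prod_{i<j}(\lambda_j-\lambda_i)$, $\Delta(e^\lambda)=\prod_{i<j}(e^{\lambda_j}-e^{\lambda_i})$, and $[dU]$ is Haar measure on the unitary group modulo the diagonal torus. Variance term: let $\mathbf{E}_k$ denote expectation with respect to $\mu_t$. The quantity $$\mathbf{E}_k\left[\log\frac{\sum_{i,j}\bar s_i(z_1)P_{ij}s_j(z_1)}{|s(z_1)|^2}\;\log\frac{\sum_{i,j}\bar s_i(z_2)P_{ij}s_j(z_2)}{|s(z_2)|^2}\right]$$ depends on $(z_1,z_2)$ only through $\rho=\rho(z_1,z_2)$, by unitary invariance of $\mu_t$, and is denoted $I_{2,k}(t,\rho)$. For arbitrary $\rho\in[0,1]$, $I_{2,k}(t,\rho)=\mathbf{E}_k[\log(u^\dagger Pu)\log(v^\dagger Pv)]$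 for any unit vectors $u,v\in\mathbb{C}^N$ with $|u^\dagger v|^2=\rho$. *)

theory Defs
  imports "HOL-Analysis.Analysis"
begin

section \<open>Calculus on complex coordinate space\<close>

definition holo_on :: "(complex^'d \<Rightarrow> complex) \<Rightarrow> (complex^'d) set \<Rightarrow> bool" where
  "holo_on f S \<longleftrightarrow>
     (\<forall>z\<in>S. \<exists>D. (f has_derivative D) (at z) \<and> (\<forall>c v. D (c *s v) = c * D v))"

primrec Ck_on :: "nat \<Rightarrow> ('a::euclidean_space \<Rightarrow> real) \<Rightarrow> 'a set \<Rightarrow> bool" where
  "Ck_on 0 f S \<longleftrightarrow> continuous_on S f"
| "Ck_on (Suc k) f S \<longleftrightarrow>
     (\<forall>x\<in>S. f differentiable (at x)) \<and>
     (\<forall>v. Ck_on k (\<lambda>x. frechet_derivative f (at x) v) S)"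

definition smooth_on :: "('a::euclidean_space \<Rightarrow> real) \<Rightarrow> 'a set \<Rightarrow> bool" where
  "smooth_on f S \<longleftrightarrow> (\<forall>k. Ck_on k f S)"

definition d_z :: "'d::finite \<Rightarrow> (complex^'d \<Rightarrow> complex) \<Rightarrow> complex^'d \<Rightarrow> complex" where
  "d_z a f z = (frechet_derivative f (at z) (axis a 1)
                - \<i> * frechet_derivative f (at z) (axis a \<i>)) / 2"

definition d_zbar :: "'d::finite \<Rightarrow> (complex^'d \<Rightarrow> complex) \<Rightarrow> complex^'d \<Rightarrow> complex" where
  "d_zbar a f z = (frechet_derivative f (at z) (axis a 1)
                   + \<i> * frechet_derivative f (at z) (axis a \<i>)) / 2"

type_synonym 'n rvec = "(real, 'n) vec"
type_synonym 'n cvec = "(complex, 'n) vec"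
type_synonym 'n cmat = "((complex, 'n) vec, 'n) vec"

section \<open>Complex manifolds and holomorphic line bundles\<close>

text \<open>
  The manifold is the whole type \<open>'m\<close>, with a holomorphic atlas
  \<open>\<phi> i : U i \<rightarrow> \<complex>^'d\<close>. A line bundle \<open>L\<close> is given by its transition functions
  \<open>g i j\<close> for local frames over the \<open>U i\<close>; every line bundle arises in this way once the
  charts are shrunk so as to trivialize it. Values off the relevant overlaps are irrelevant.
\<close>

definition chart_inv :: "('i \<Rightarrow> 'm set) \<Rightarrow> ('i \<Rightarrow> 'm \<Rightarrow> complex^'d) \<Rightarrow> 'i \<Rightarrow> complex^'d \<Rightarrow> 'm" where
  "chart_inv U \<phi> i = inv_into (U i) (\<phi> i)"

definition holomorphic_atlas ::
    "('i \<Rightarrow> 'm::topological_space set) \<Rightarrow> ('i \<Rightarrow> 'm \<Rightarrow> complex^'d) \<Rightarrow> bool" where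
  "holomorphic_atlas U \<phi> \<longleftrightarrow>
     (\<forall>i. open (U i)) \<and> (\<Union>i. U i) = UNIV \<and>
     (\<forall>i. open (\<phi> i ` U i) \<and> homeomorphism (U i) (\<phi> i ` U i) (\<phi> i) (chart_inv U \<phi> i)) \<and>
     (\<forall>i j b. holo_on (\<lambda>z. \<phi> j (chart_inv U \<phi> i z) $ b) (\<phi> i ` (U i \<inter> U j)))"

definition holomorphic_line_bundle ::
    "('i \<Rightarrow> 'm set) \<Rightarrow> ('i \<Rightarrow> 'm \<Rightarrow> complex^'d) \<Rightarrow> ('i \<Rightarrow> 'i \<Rightarrow> 'm \<Rightarrow> complex) \<Rightarrow> bool" where
  "holomorphic_line_bundle U \<phi> g \<longleftrightarrow>
     (\<forall>i j. holo_on (g i j \<circ> chart_inv U \<phi> i) (\<phi> i ` (U i \<inter> U j))) \<and>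
     (\<forall>i j. \<forall>x\<in>U i \<inter> U j. g i j x \<noteq> 0) \<and>
     (\<forall>i j l. \<forall>x\<in>U i \<inter> U j \<inter> U l. g i j x * g j l x = g i l x)"

text \<open>
  A section is the family of its coordinates in the local frames, set to 0 off \<open>U i\<close>
  so that equality of sections is equality of functions.
\<close>

definition sections ::
    "('i \<Rightarrow> 'm set) \<Rightarrow> ('i \<Rightarrow> 'm \<Rightarrow> complex^'d) \<Rightarrow> ('i \<Rightarrow> 'i \<Rightarrow> 'm \<Rightarrow> complex) \<Rightarrow> nat
      \<Rightarrow> ('i \<Rightarrow> 'm \<Rightarrow> complex) set" where
  "sections U \<phi> g k = {\<sigma>.
     (\<forall>i. holo_on (\<sigma> i \<circ> chart_inv U \<phi> i) (\<phi> i ` U i)) \<and>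
     (\<forall>i j. \<forall>x\<in>U i \<inter> U j. \<sigma> i x = g i j x ^ k * \<sigma> j x) \<and>
     (\<forall>i. \<forall>x. x \<notin> U i \<longrightarrow> \<sigma> i x = 0)}"

definition base_point_free ::
    "('i \<Rightarrow> 'm set) \<Rightarrow> ('i \<Rightarrow> 'm \<Rightarrow> complex^'d) \<Rightarrow> ('i \<Rightarrow> 'i \<Rightarrow> 'm \<Rightarrow> complex) \<Rightarrow> nat \<Rightarrow> bool" where
  "base_point_free U \<phi> g k \<longleftrightarrow> (\<forall>x. \<exists>\<sigma>\<in>sections U \<phi> g k. \<exists>i. x \<in> U i \<and> \<sigma> i x \<noteq> 0)"

text \<open>
  Very ample: the Kodaira map is everywhere defined, injective and immersive
  (hence an embedding, the manifold being compact).
\<close>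

definition very_ample ::
    "('i \<Rightarrow> 'm set) \<Rightarrow> ('i \<Rightarrow> 'm \<Rightarrow> complex^'d) \<Rightarrow> ('i \<Rightarrow> 'i \<Rightarrow> 'm \<Rightarrow> complex) \<Rightarrow> nat \<Rightarrow> bool" where
  "very_ample U \<phi> g m \<longleftrightarrow>
     base_point_free U \<phi> g m \<and>
     (\<forall>x y. x \<noteq> y \<longrightarrow> (\<exists>\<sigma>\<in>sections U \<phi> g m.
        (\<exists>i. x \<in> U i \<and> \<sigma> i x = 0) \<and> (\<exists>j. y \<in> U j \<and> \<sigma> j y \<noteq> 0))) \<and>
     (\<forall>i. \<forall>x\<in>U i. \<forall>v. v \<noteq> 0 \<longrightarrow> (\<exists>\<sigma>\<in>sections U \<phi> g m.
        \<sigma> i x = 0 \<and> frechet_derivative (\<sigma> i \<circ> chart_inv U \<phi> i) (at (\<phi> i x)) v \<noteq> 0))"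

definition ample ::
    "('i \<Rightarrow> 'm set) \<Rightarrow> ('i \<Rightarrow> 'm \<Rightarrow> complex^'d) \<Rightarrow> ('i \<Rightarrow> 'i \<Rightarrow> 'm \<Rightarrow> complex) \<Rightarrow> bool" where
  "ample U \<phi> g \<longleftrightarrow> (\<exists>m>0. very_ample U \<phi> g m)"

section \<open>Hermitian metric, curvature form and volume\<close>

text \<open>\<open>h i\<close> is the squared norm of the local frame over \<open>U i\<close>.\<close>

definition hermitian_metric ::
    "('i \<Rightarrow> 'm set) \<Rightarrow> ('i \<Rightarrow> 'm \<Rightarrow> complex^'d) \<Rightarrow> ('i \<Rightarrow> 'i \<Rightarrow> 'm \<Rightarrow> complex)
      \<Rightarrow> ('i \<Rightarrow> 'm \<Rightarrow> real) \<Rightarrow> bool" where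
  "hermitian_metric U \<phi> g h \<longleftrightarrow>
     (\<forall>i. \<forall>x\<in>U i. h i x > 0) \<and>
     (\<forall>i. smooth_on (h i \<circ> chart_inv U \<phi> i) (\<phi> i ` U i)) \<and>
     (\<forall>i j. \<forall>x\<in>U i \<inter> U j. h j x = (cmod (g i j x))\<^sup>2 * h i x)"

text \<open>
  Coefficients of the curvature form: \<open>\<omega>\<^sub>0 = -\<i> \<partial>\<partial>\<bar> log h = \<i> \<Sum> \<omega>_ab dz_a \<and> d\<bar>z_b\<close> with
  \<open>\<omega>_ab = - \<partial>_a \<partial>\<bar>_b log h\<close>. This form is closed, so it is a Kaehler form iff it is positive.
\<close>

definition curvature_coeff ::
    "('i \<Rightarrow> 'm set) \<Rightarrow> ('i \<Rightarrow> 'm \<Rightarrow> complex^'d) \<Rightarrow> ('i \<Rightarrow> 'm \<Rightarrow> real)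
      \<Rightarrow> 'i \<Rightarrow> complex^'d \<Rightarrow> complex^'d^'d" where
  "curvature_coeff U \<phi> h i z =
     (\<chi> a b. - d_z a (d_zbar b (\<lambda>w. complex_of_real (ln (h i (chart_inv U \<phi> i w))))) z)"

definition kaehler_curvature ::
    "('i \<Rightarrow> 'm set) \<Rightarrow> ('i \<Rightarrow> 'm \<Rightarrow> complex^'d) \<Rightarrow> ('i \<Rightarrow> 'm \<Rightarrow> real) \<Rightarrow> bool" where
  "kaehler_curvature U \<phi> h \<longleftrightarrow>
     (\<forall>i. \<forall>z\<in>\<phi> i ` U i. \<forall>v. v \<noteq> 0 \<longrightarrow>
        0 < Re (\<Sum>a\<in>UNIV. \<Sum>b\<in>UNIV. curvature_coeff U \<phi> h i z $ a $ b * v $ a * cnj (v $ b)))"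

text \<open>
  The measure of \<open>\<omega>\<^sub>0^n / n!\<close>, where \<open>n = CARD('d)\<close>. In a chart,
  \<open>\<omega>\<^sub>0^n / n! = det \<omega>_ab \<Prod> \<i> dz_a \<and> d\<bar>z_a\<close>, and \<open>\<i> dz \<and> d\<bar>z = 2 dx \<and> dy\<close>.
\<close>

definition kaehler_volume ::
    "('i \<Rightarrow> 'm::topological_space set) \<Rightarrow> ('i \<Rightarrow> 'm \<Rightarrow> complex^'d) \<Rightarrow> ('i \<Rightarrow> 'm \<Rightarrow> real)
      \<Rightarrow> 'm measure" where
  "kaehler_volume U \<phi> h = (THE \<nu>. sets \<nu> = sets borel \<and>
     (\<forall>i. \<forall>A\<in>sets borel. A \<subseteq> U i \<longrightarrow>
        emeasure \<nu> A = (\<integral>\<^sup>+z. ennreal (2 ^ CARD('d) * Re (det (curvature_coeff U \<phi> h i z)))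
                           * indicator (\<phi> i ` A) z \<partial>lborel)))"

text \<open>
  The pointwise pairing \<open>\<bar>\<sigma> \<tau> h^k\<close> of sections of \<open>L^k\<close>; it does not depend on the
  frame chosen at \<open>x\<close>.
\<close>

definition pairing ::
    "('i \<Rightarrow> 'm set) \<Rightarrow> ('i \<Rightarrow> 'm \<Rightarrow> real) \<Rightarrow> nat
      \<Rightarrow> ('i \<Rightarrow> 'm \<Rightarrow> complex) \<Rightarrow> ('i \<Rightarrow> 'm \<Rightarrow> complex) \<Rightarrow> 'm \<Rightarrow> complex" where
  "pairing U h k \<sigma> \<tau> x =
     (let i = (SOME i. x \<in> U i) in cnj (\<sigma> i x) * \<tau> i x * complex_of_real (h i x ^ k))"

definition orthonormal_basis ::
    "('i \<Rightarrow> 'm::topological_space set) \<Rightarrow> ('i \<Rightarrow> 'm \<Rightarrow> complex^'d) \<Rightarrow> ('i \<Rightarrow> 'i \<Rightarrow> 'm \<Rightarrow> complex)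
      \<Rightarrow> ('i \<Rightarrow> 'm \<Rightarrow> real) \<Rightarrow> nat \<Rightarrow> ('n::finite \<Rightarrow> 'i \<Rightarrow> 'm \<Rightarrow> complex) \<Rightarrow> bool" where
  "orthonormal_basis U \<phi> g h k s \<longleftrightarrow>
     (\<forall>a. s a \<in> sections U \<phi> g k) \<and>
     (\<forall>\<sigma>\<in>sections U \<phi> g k. \<exists>!c :: 'n cvec. \<sigma> = (\<lambda>i x. \<Sum>a\<in>UNIV. c $ a * s a i x)) \<and>
     (\<forall>a b. (1 / complex_of_real (measure (kaehler_volume U \<phi> h) UNIV))
              * (\<integral>x. pairing U h k (s a) (s b) x \<partial>(kaehler_volume U \<phi> h))
            = (if a = b then 1 else 0))"

definition basis_at :: "('n::finite \<Rightarrow> 'i \<Rightarrow> 'm \<Rightarrow> complex) \<Rightarrow> 'i \<Rightarrow> 'm \<Rightarrow> 'n cvec" where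
  "basis_at s i x = (\<chi> a. s a i x)"

text \<open>The Berezin kernel; the frames \<open>p\<close>, \<open>q\<close> used at the two points do not matter.\<close>

definition berezin ::
    "('n::finite \<Rightarrow> 'i \<Rightarrow> 'm \<Rightarrow> complex) \<Rightarrow> 'i \<Rightarrow> 'i \<Rightarrow> 'm \<Rightarrow> 'm \<Rightarrow> real" where
  "berezin s p q x y =
     (cmod (\<Sum>a\<in>UNIV. s a p x * cnj (s a q y)))\<^sup>2
       / ((\<Sum>a\<in>UNIV. (cmod (s a p x))\<^sup>2) * (\<Sum>a\<in>UNIV. (cmod (s a q y))\<^sup>2))"

section \<open>Heat kernel measure\<close>

definition hadjoint :: "'n::finite cmat \<Rightarrow> 'n cmat" where
  "hadjoint A = (\<chi> i j. cnj (A $ j $ i))"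

definition unitary :: "'n::finite cmat \<Rightarrow> bool" where
  "unitary A \<longleftrightarrow> hadjoint A ** A = mat 1"

definition unitary_haar :: "('n::finite cmat) measure \<Rightarrow> bool" where
  "unitary_haar H \<longleftrightarrow>
     sets H = sets (restrict_space borel {A. unitary A}) \<and>
     emeasure H (space H) = 1 \<and>
     (\<forall>V. unitary V \<longrightarrow> distr H H (\<lambda>A. V ** A) = H \<and> distr H H (\<lambda>A. A ** V) = H)"

text \<open>
  The measure \<open>\<delta>(\<Sum>j. \<lambda>_j) \<Prod> d\<lambda>_j\<close>: the delta function removes the integration over one
  of the coordinates (any one; here the last).
\<close>

definition trace_free :: "('n::{finite,linorder} \<Rightarrow> real) \<Rightarrow> 'n rvec" where
  "trace_free x =
     (\<chi> i. if i = Max UNIV then - (\<Sum>j\<in>UNIV - {Max UNIV}. x j) else x i)"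

definition trace_free_lborel :: "('n::{finite,linorder} rvec) measure" where
  "trace_free_lborel = distr (PiM (UNIV - {Max UNIV}) (\<lambda>_. lborel)) borel trace_free"

definition vandermonde :: "('n::{finite,linorder} \<Rightarrow> real) \<Rightarrow> real" where
  "vandermonde x = (\<Prod>(i, j)\<in>{(i, j). i < j}. x j - x i)"

definition heat_weight :: "real \<Rightarrow> 'n::{finite,linorder} rvec \<Rightarrow> real" where
  "heat_weight t l =
     vandermonde (\<lambda>j. l $ j) * vandermonde (\<lambda>j. exp (l $ j)) * exp (- (1 / (4 * t)) * (\<Sum>j\<in>UNIV. (l $ j)\<^sup>2))"

definition polar :: "'n::finite rvec \<Rightarrow> 'n cmat \<Rightarrow> 'n cmat" where
  "polar l A = hadjoint A ** (\<chi> i j. if i = j then complex_of_real (exp (l $ i)) else 0) ** A"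

text \<open>
  The heat kernel measure \<open>p(t, I, P) dV(P)\<close> on \<open>SL(N, \<complex>) / SU(N)\<close> for the metric
  \<open>Tr (P^-1 dP)^2\<close>, in its explicit form: the law \<open>\<mu>_t\<close> of \<open>P = U\<^sup>\<dagger> e^\<Lambda> U\<close> under the weight
  \<open>\<delta>(\<Sum>\<lambda>) \<Delta>(\<lambda>) \<Delta>(e^\<lambda>) exp(-\<Sum>\<lambda>^2 / 4t)\<close>, normalized to a probability measure. Since \<open>polar\<close> is
  invariant under left translation of \<open>U\<close> by diagonal unitary matrices, Haar measure \<open>H\<close>
  on the whole unitary group gives the same law as the induced measure on the quotient by the
  diagonal torus; similarly the unordered \<open>\<lambda>\<close> just covers each \<open>P\<close> equally often.
\<close>

definition heat_measure_raw ::
    "('n::{finite,linorder} cmat) measure \<Rightarrow> real \<Rightarrow> ('n rvec \<times> 'n cmat) measure" where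
  "heat_measure_raw H t =
     density (trace_free_lborel \<Otimes>\<^sub>M H) (\<lambda>(l, A). ennreal (heat_weight t l))"

definition heat_measure ::
    "('n::{finite,linorder} cmat) measure \<Rightarrow> real \<Rightarrow> ('n cmat) measure" where
  "heat_measure H t =
     distr (scale_measure (inverse (emeasure (heat_measure_raw H t) (space (heat_measure_raw H t))))
              (heat_measure_raw H t))
       borel (\<lambda>(l, A). polar l A)"

section \<open>The variance term\<close>

definition herm_form :: "'n::finite cmat \<Rightarrow> 'n cvec \<Rightarrow> 'n cvec \<Rightarrow> complex" where
  "herm_form P u v = (\<Sum>i\<in>UNIV. \<Sum>j\<in>UNIV. cnj (u $ i) * P $ i $ j * v $ j)"

definition cinner :: "'n::finite cvec \<Rightarrow> 'n cvec \<Rightarrow> complex" where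
  "cinner u v = (\<Sum>i\<in>UNIV. cnj (u $ i) * v $ i)"

text \<open>The logarithms are of positive reals: under \<open>\<mu>_t\<close> the matrix \<open>P\<close> is positive definite.\<close>

definition two_point ::
    "('n::{finite,linorder} cmat) measure \<Rightarrow> real \<Rightarrow> 'n cvec \<Rightarrow> 'n cvec \<Rightarrow> real" where
  "two_point H t u v =
     (\<integral>P. ln (Re (herm_form P u u) / (norm u)\<^sup>2) * ln (Re (herm_form P v v) / (norm v)\<^sup>2)
        \<partial>(heat_measure H t))"

definition I2 :: "('n::{finite,linorder} cmat) measure \<Rightarrow> real \<Rightarrow> real \<Rightarrow> real" where
  "I2 H t \<rho> = (THE c. \<forall>u v. norm u = 1 \<and> norm v = 1 \<and> (cmod (cinner u v))\<^sup>2 = \<rho> \<longrightarrow>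
                 (\<integral>P. ln (Re (herm_form P u u)) * ln (Re (herm_form P v v)) \<partial>(heat_measure H t)) = c)"

text \<open>
  The defining conditions of \<open>I\<^sub>2(\<infinity>, \<cdot>)\<close> on an interval \<open>S\<close> starting at 0; continuity on \<open>S\<close>
  ties the prescribed values of the derivative inside \<open>(0, 1)\<close> to the end points.
\<close>

definition is_I2_infinity ::
    "('n::{finite,linorder} cmat) measure \<Rightarrow> real set \<Rightarrow> (real \<Rightarrow> real) \<Rightarrow> bool" where
  "is_I2_infinity H S J \<longleftrightarrow>
     continuous_on S J \<and> J 0 = 0 \<and>
     (\<forall>\<rho>\<in>{0<..<1}. (J has_real_derivative Lim at_top (\<lambda>t. deriv (I2 H t) \<rho>)) (at \<rho>))"

definition dilog :: "real \<Rightarrow> real" where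
  "dilog \<rho> = - integral {0..\<rho>} (\<lambda>s. ln (1 - s) / s)"

end

theory Submission
  imports Defs "HOL-Probability.Probability"
begin

text \<open>
  For \<open>u = e_a\<close> and \<open>v = sqrt \<rho> e_a + sqrt (1 - \<rho>) e_b\<close>, average \<open>ln (v\<^sup>\<dagger> P v)\<close> first over the relative
  phase of the columns \<open>a\<close> and \<open>b\<close> of the unitary matrix \<open>A\<close>. By Jensen's formula the average is explicit,
  and its \<open>\<rho>\<close>-derivative is \<open>(1 - 2\<rho> + \<kappa>) / (2\<rho>(1 - \<rho>))\<close> with \<open>|\<kappa>| \<le> 1\<close>. This uniform bound allows
  differentiation under the integral for every \<open>t\<close>, and passage to the limit.

  When the largest eigenvalue \<open>exp \<lambda>_j\<close> of \<open>P\<close> dominates, \<open>u\<^sup>\<dagger> P u exp (-\<lambda>_j)\<close> tends to \<open>X = |A_ja|^2\<close>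
  and \<open>\<kappa>\<close> to the sign of \<open>\<rho> X - (1 - \<rho>) Y\<close>, \<open>Y = |A_jb|^2\<close>. Invariance of Haar measure under the unitary group of
  the plane spanned by \<open>e_a\<close>, \<open>e_b\<close> says that \<open>\<kappa>\<close> has mean \<open>2\<rho> - 1\<close> against any function of \<open>X + Y\<close>.
  Hence \<open>B = X / (X + Y)\<close> is uniform on \<open>[0, 1]\<close>, the factor \<open>ln (X + Y)\<close> of \<open>ln X\<close> drops out, and the limit
  is an integral of \<open>ln B\<close>, equal to \<open>- ln (1 - \<rho>) / \<rho>\<close>.

  As \<open>t \<rightarrow> \<infinity>\<close> the eigenvalue gaps are indeed large: completing the square in the weight, the exponents
  \<open>\<lambda>\<close> concentrate within \<open>O(sqrt t)\<close> of the permutations of \<open>2t\<close> times the Weyl vector.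
\<close>

section \<open>Unitary matrices\<close>

text \<open>The obstacle is uniformity in the eigenvalues. Before any averaging, the
  \<open>\<rho>\<close>-derivative of the logarithm of the form at \<open>v\<close> is large
  wherever that form is nearly degenerate at \<open>v\<close>, with no bound independent of the
  spectrum; the average over a phase replaces it by a bounded quantity. The other factor, the
  logarithm of the form at \<open>e_a\<close>, still grows with the exponents. For each fixed
  spectrum, however, \<open>1 - 2 * \<rho> + \<kappa>\<close> has mean 0 over the unitary group, so
  the largest exponent can be subtracted from that logarithm, and what remains is dominated by
  \<open>\<bar>ln X\<bar>\<close>. Hence \<open>ln X\<close> has to be integrable. No density of
  Haar measure is used for this. A reflection in the plane of \<open>e_a\<close> and
  \<open>e_b\<close> carries \<open>e_a\<close> to \<open>v\<close>, so the Haar average of the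
  logarithm at \<open>v\<close> does not depend on \<open>\<rho>\<close>. Comparison with the phase
  average, taken at \<open>\<rho> = 1/2\<close> and also differentiated in \<open>\<rho>\<close>,
  yields the integrability of \<open>ln X\<close> and the mean of \<open>\<kappa>\<close>. The rank
  one form given by a single row is reached as a limit of positive definite forms.\<close>

abbreviation entry_mass :: "'n::finite cmat \<Rightarrow> 'n \<Rightarrow> 'n \<Rightarrow> real" where
  "entry_mass A j a \<equiv> (cmod (A $ j $ a))\<^sup>2"

abbreviation one_norm :: "'n::finite rvec \<Rightarrow> real" where
  "one_norm l \<equiv> \<Sum>j\<in>UNIV. \<bar>l $ j\<bar>"

lemma cinner_self: "cinner u u = complex_of_real ((norm u)\<^sup>2)"
proof -
  have "cnj z * z = complex_of_real ((cmod z)\<^sup>2)" for z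
    by (subst complex_norm_square) (simp add: mult.commute)
  then have "cinner u u = complex_of_real (\<Sum>i\<in>UNIV. (cmod (u $ i))\<^sup>2)"
    by (simp add: cinner_def)
  also have "(\<Sum>i\<in>UNIV. (cmod (u $ i))\<^sup>2) = (norm u)\<^sup>2"
    by (simp add: norm_vec_def L2_set_def sum_nonneg)
  finally show ?thesis .
qed

lemma cinner_add_right: "cinner u (v + w) = cinner u v + cinner u w"
  by (simp add: cinner_def algebra_simps sum.distrib)

lemma cinner_diff_right: "cinner u (v - w) = cinner u v - cinner u w"
  by (simp add: cinner_def algebra_simps sum_subtractf)

lemma cinner_diff_left: "cinner (v - w) u = cinner v u - cinner w u"
  by (simp add: cinner_def algebra_simps sum_subtractf)

lemma cinner_add_left: "cinner (v + w) u = cinner v u + cinner w u"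
  by (simp add: cinner_def algebra_simps sum.distrib)

lemma cinner_scale_right: "cinner u (c *s v) = c * cinner u v"
  by (simp add: cinner_def algebra_simps sum_distrib_left)

lemma cinner_scale_left: "cinner (c *s u) v = cnj c * cinner u v"
  by (simp add: cinner_def algebra_simps sum_distrib_left)

lemma cinner_commute: "cinner v u = cnj (cinner u v)"
  by (simp add: cinner_def mult.commute)

lemma cinner_axis_left: "cinner (axis i 1) v = v $ i"
proof -
  have "cnj (axis i 1 $ j) * v $ j = (if j = i then v $ i else 0)" for j
    by (simp add: axis_def)
  then show ?thesis by (simp add: cinner_def)
qed

lemma cinner_axis_axis: "cinner (axis i 1) (axis j 1) = (if i = j then 1 else 0)"
  by (simp add: cinner_axis_left) (simp add: axis_def)

lemma norm_scale_unimodular: "cmod c = 1 \<Longrightarrow> norm (c *s u) = norm (u::'n::finite cvec)"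
  by (simp add: norm_vec_def norm_mult)

lemma mult_axis_nth: "((A::'n::finite cmat) *v axis j 1) $ i = A $ i $ j"
proof -
  have "A $ i $ k * axis j 1 $ k = (if k = j then A $ i $ j else 0)" for k
    by (simp add: axis_def)
  then show ?thesis by (simp add: matrix_vector_mult_def)
qed

lemma hadjoint_mult_entry: "(hadjoint A ** (B::'n::finite cmat)) $ i $ j = cinner (A *v axis i 1) (B *v axis j 1)"
  by (simp add: hadjoint_def matrix_matrix_mult_def cinner_def mult_axis_nth)

lemma cinner_hadjoint: "cinner (A *v y) z = cinner y (hadjoint A *v z)"
proof -
  have "cinner (A *v y) z = (\<Sum>i\<in>UNIV. \<Sum>j\<in>UNIV. cnj (A $ i $ j) * cnj (y $ j) * z $ i)"
    by (simp add: cinner_def matrix_vector_mult_def sum_distrib_right)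
  also have "\<dots> = (\<Sum>j\<in>UNIV. \<Sum>i\<in>UNIV. cnj (A $ i $ j) * cnj (y $ j) * z $ i)"
    by (rule sum.swap)
  also have "\<dots> = cinner y (hadjoint A *v z)"
    by (simp add: cinner_def matrix_vector_mult_def hadjoint_def sum_distrib_left algebra_simps)
  finally show ?thesis .
qed

lemma unitary_iff_cinner: "unitary A \<longleftrightarrow> (\<forall>y z. cinner (A *v y) (A *v z) = cinner y z)"
proof
  assume "unitary A"
  then show "\<forall>y z. cinner (A *v y) (A *v z) = cinner y z"
    by (simp add: cinner_hadjoint matrix_vector_mul_assoc unitary_def)
next
  assume "\<forall>y z. cinner (A *v y) (A *v z) = cinner y z"
  then show "unitary A"
    by (simp add: unitary_def vec_eq_iff hadjoint_mult_entry cinner_axis_axis) (simp add: mat_def)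
qed

lemma unitary_mult: "unitary A \<Longrightarrow> unitary B \<Longrightarrow> unitary (A ** B)"
  by (simp add: unitary_iff_cinner matrix_vector_mul_assoc[symmetric])

lemma unitary_one: "unitary (mat 1)"
  by (simp add: unitary_iff_cinner)

lemma unitary_norm: "unitary A \<Longrightarrow> norm (A *v u) = norm u"
proof -
  assume "unitary A"
  then have "complex_of_real ((norm (A *v u))\<^sup>2) = complex_of_real ((norm u)\<^sup>2)"
    by (metis cinner_self unitary_iff_cinner)
  then show ?thesis
    by (metis norm_ge_zero of_real_eq_iff power2_eq_iff_nonneg)
qed

lemma unitary_hadjoint: "unitary A \<Longrightarrow> A ** hadjoint A = mat 1"
  by (simp add: unitary_def matrix_left_right_inverse)

lemma unitary_row_norm: assumes "unitary A" shows "(\<Sum>i\<in>UNIV. entry_mass A j i) = 1"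
proof -
  have "(A ** hadjoint A) $ j $ j = 1" using unitary_hadjoint[OF assms] by (simp add: mat_def)
  then have "(\<Sum>i\<in>UNIV. A $ j $ i * cnj (A $ j $ i)) = 1"
    by (simp add: matrix_matrix_mult_def hadjoint_def)
  then have "complex_of_real (\<Sum>i\<in>UNIV. entry_mass A j i) = 1"
    by (simp only: complex_norm_square[symmetric] of_real_sum)
  then show ?thesis by (simp only: of_real_eq_1_iff)
qed

lemma norm_vec_square: "(norm (u::'n::finite cvec))\<^sup>2 = (\<Sum>i\<in>UNIV. (cmod (u $ i))\<^sup>2)"
  by (simp add: norm_vec_def L2_set_def sum_nonneg)

text \<open>
  A Householder reflection with adjusted phase: dividing by \<open>cinner x u\<close> instead of \<open>|x|^2 / 2\<close> keeps it
  unitary when \<open>cinner u u'\<close> is not real.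
\<close>

lemma unitary_reflection:
  fixes u u' :: "'n::finite cvec"
  assumes "norm u = norm u'"
  obtains R where "unitary R" "R *v u = u'" "\<And>y. cinner (u - u') y = 0 \<Longrightarrow> R *v y = y"
proof (cases "u = u'")
  case True
  then show ?thesis using that[of "mat 1"] by (simp add: unitary_one)
next
  case False
  define x where "x = u - u'"
  define \<tau> where "\<tau> = cinner x u"
  define R :: "'n cmat" where "R = (\<chi> i j. (if i = j then 1 else 0) - x $ i * cnj (x $ j) / \<tau>)"
  have xx: "cinner x x = \<tau> + cnj \<tau>"
  proof -
    have "cinner x x = cinner x u - cinner x u'" by (simp add: x_def cinner_diff_right)
    moreover have "cinner x u' = - cnj \<tau>"
      using assms unfolding \<tau>_def x_def
      by (simp add: cinner_diff_left cinner_self complex_cnj_diff) (metis cinner_commute)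
    ultimately show ?thesis by (simp add: \<tau>_def)
  qed
  have "\<tau> \<noteq> 0"
  proof
    assume "\<tau> = 0"
    then have "norm x = 0" using xx by (simp add: cinner_self)
    then show False using False by (simp add: x_def)
  qed
  have Ry: "R *v y = y - (cinner x y / \<tau>) *s x" for y
  proof -
    have "(R *v y) $ i = y $ i - (cinner x y / \<tau>) * x $ i" for i
    proof -
      have "(R *v y) $ i = (\<Sum>j\<in>UNIV. (if i = j then y $ j else 0) - x $ i / \<tau> * (cnj (x $ j) * y $ j))"
        unfolding R_def matrix_vector_mult_def by (auto intro!: sum.cong simp: algebra_simps)
      also have "\<dots> = y $ i - x $ i / \<tau> * cinner x y"
        by (simp add: sum_subtractf cinner_def sum_distrib_left)
      finally show ?thesis by simp
    qed
    then show ?thesis by (simp add: vec_eq_iff)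
  qed
  have "cinner (R *v y) (R *v z) = cinner y z" for y z
  proof -
    have "cinner (R *v y) (R *v z) = cinner y z - cinner x z / \<tau> * cinner y x
        - cnj (cinner x y / \<tau>) * cinner x z + cnj (cinner x y / \<tau>) * (cinner x z / \<tau>) * cinner x x"
      unfolding Ry by (simp add: cinner_diff_left cinner_diff_right cinner_scale_left cinner_scale_right
          algebra_simps)
    also have "\<dots> = cinner y z"
      unfolding xx using \<open>\<tau> \<noteq> 0\<close> by (subst cinner_commute[of y x]) (simp add: field_simps)
    finally show ?thesis .
  qed
  then have "unitary R" by (simp add: unitary_iff_cinner)
  moreover have "R *v u = u'"
    unfolding Ry using \<open>\<tau> \<noteq> 0\<close> by (simp add: \<tau>_def[symmetric]) (simp add: x_def)
  moreover have "\<And>y. cinner (u - u') y = 0 \<Longrightarrow> R *v y = y"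
    unfolding Ry by (simp add: x_def)
  ultimately show ?thesis using that by blast
qed

text \<open>Two reflections suffice. The first carries \<open>u\<close> to \<open>u'\<close>; the
  second moves the image of \<open>v\<close> along a vector orthogonal to \<open>u'\<close>, hence
  fixes \<open>u'\<close>. The phase \<open>\<omega>\<close> appears because only the modulus of the
  inner product is prescribed. This homogeneity is what makes \<open>I2\<close> a function of
  \<open>\<rho>\<close> alone.\<close>

lemma unitary_pair_transitive:
  fixes u v u' v' :: "'n::finite cvec"
  assumes "norm u = norm u'" "norm v = norm v'"
    and "cmod (cinner u v) = cmod (cinner u' v')"
  obtains V \<omega> where "unitary V" "cmod \<omega> = 1" "V *v u = u'" "V *v v = \<omega> *s v'"
proof -
  obtain \<omega> where \<omega>: "cmod \<omega> = 1" "cinner u v = \<omega> * cinner u' v'"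
  proof (cases "cinner u' v' = 0")
    case True
    then show ?thesis using that[of 1] assms by simp
  next
    case False
    show ?thesis
      by (rule that[of "cinner u v / cinner u' v'"]) (use False assms in \<open>simp_all add: norm_divide\<close>)
  qed
  obtain R where R: "unitary R" "R *v u = u'" using unitary_reflection[OF assms(1)] by blast
  have "norm (R *v v) = norm (\<omega> *s v')"
    by (simp add: R unitary_norm norm_scale_unimodular \<omega> assms)
  then obtain T where T: "unitary T" "T *v (R *v v) = \<omega> *s v'"
      "\<And>y. cinner (R *v v - \<omega> *s v') y = 0 \<Longrightarrow> T *v y = y"
    using unitary_reflection by blast
  have "cinner u' (R *v v) = cinner u v" using R by (metis unitary_iff_cinner)
  then have "cinner u' (R *v v - \<omega> *s v') = 0"
    by (simp add: cinner_diff_right cinner_scale_right \<omega>)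
  then have "cinner (R *v v - \<omega> *s v') u' = 0" by (subst cinner_commute) simp
  then have "T *v u' = u'" by (rule T(3))
  then show ?thesis
    using that[of "T ** R" \<omega>] T R \<omega> by (simp add: unitary_mult matrix_vector_mul_assoc[symmetric])
qed

section \<open>The Hermitian form of \<open>polar l A\<close> in eigencoordinates, with crude
  bounds\<close>

definition qform :: "'n::finite rvec \<Rightarrow> 'n cmat \<Rightarrow> 'n cvec \<Rightarrow> real" where
  "qform l A u = (\<Sum>i\<in>UNIV. exp (l $ i) * (cmod ((A *v u) $ i))\<^sup>2)"

lemma herm_form_cinner: "herm_form P u v = cinner u (P *v v)"
  by (simp add: herm_form_def cinner_def matrix_vector_mult_def sum_distrib_left mult.assoc)

lemma herm_form_polar:
  fixes A :: "'n::finite cmat"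
  shows "herm_form (polar l A) u u = complex_of_real (qform l A u)"
proof -
  define D :: "'n cmat" where "D = (\<chi> i j. if i = j then complex_of_real (exp (l $ i)) else 0)"
  have D: "(D *v y) $ i = complex_of_real (exp (l $ i)) * y $ i" for y i
    unfolding D_def matrix_vector_mult_def by (simp add: if_distrib[where f="\<lambda>x. x * _"] cong: if_cong)
  have "herm_form (polar l A) u u = cinner u (hadjoint A *v (D *v (A *v u)))"
    by (simp add: herm_form_cinner polar_def D_def matrix_vector_mul_assoc matrix_mul_assoc)
  also have "\<dots> = cinner (A *v u) (D *v (A *v u))"
    by (simp add: cinner_hadjoint)
  also have "\<dots> = complex_of_real (qform l A u)"
    unfolding cinner_def D qform_def of_real_sum of_real_mult complex_norm_square
    by (simp add: algebra_simps)
  finally show ?thesis .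
qed

lemma qform_mult: "qform l (A ** V) u = qform l A (V *v u)"
  by (simp add: qform_def matrix_vector_mul_assoc)

lemma qform_scale: "qform l A (c *s u) = (cmod c)\<^sup>2 * qform l A u"
  by (simp add: qform_def vec.scale norm_mult power_mult_distrib sum_distrib_left algebra_simps)

lemma qform_bounds:
  assumes "unitary A" "norm u = 1"
  shows "exp (- one_norm l) \<le> qform l A u" "qform l A u \<le> exp (one_norm l)"
proof -
  let ?s = "\<Sum>i\<in>UNIV. \<bar>l $ i\<bar>"
  have b: "\<bar>l $ i\<bar> \<le> ?s" for i by (rule member_le_sum) auto
  have one: "(\<Sum>i\<in>UNIV. (cmod ((A *v u) $ i))\<^sup>2) = 1"
    using unitary_norm[OF assms(1), of u] assms(2) norm_vec_square[of "A *v u"] by simp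
  have "exp (- ?s) = (\<Sum>i\<in>UNIV. exp (- ?s) * (cmod ((A *v u) $ i))\<^sup>2)"
    by (simp add: sum_distrib_left[symmetric] one)
  also have "\<dots> \<le> qform l A u" unfolding qform_def
    by (intro sum_mono mult_right_mono) (use b in \<open>auto simp: abs_le_iff minus_le_iff\<close>)
  finally show "exp (- ?s) \<le> qform l A u" .
  have "qform l A u \<le> (\<Sum>i\<in>UNIV. exp ?s * (cmod ((A *v u) $ i))\<^sup>2)" unfolding qform_def
    by (intro sum_mono mult_right_mono) (use b in \<open>auto simp: abs_le_iff\<close>)
  also have "\<dots> = exp ?s" by (simp add: sum_distrib_left[symmetric] one)
  finally show "qform l A u \<le> exp ?s" .
qed

text \<open>All eigenvalues of \<open>polar l A\<close> lie between the exponentials of minus and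
  plus \<open>one_norm l\<close>. Linear growth of the logarithm is harmless: the Gaussian factor of
  the heat weight absorbs any \<open>exp (K * one_norm l)\<close>.\<close>

lemma abs_ln_qform:
  assumes "unitary A" "norm u = 1"
  shows "\<bar>ln (qform l A u)\<bar> \<le> one_norm l"
proof -
  have "ln (exp (- one_norm l)) \<le> ln (qform l A u)"
    "ln (qform l A u) \<le> ln (exp (one_norm l))"
    using qform_bounds[OF assms, of l]
    by (meson exp_gt_zero less_le_trans ln_le_cancel_iff)+
  then show ?thesis by (simp add: abs_le_iff)
qed

section \<open>Averages over a phase\<close>

text \<open>Dominated convergence for difference quotients along sequences: the mean value
  inequality turns the bound on the derivative into a bound on the quotients. The interval from
  \<open>a\<close> to \<open>b\<close> keeps the domination local, since the factor
  \<open>1 / (\<rho> * (1 - \<rho>))\<close> of the later applications blows up at 0 and 1.\<close>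

lemma has_derivative_integral_dominated:
  fixes F F' :: "real \<Rightarrow> 'a \<Rightarrow> real"
  assumes x: "a < x" "x < b"
    and int: "\<And>y. a < y \<Longrightarrow> y < b \<Longrightarrow> integrable M (F y)"
    and F'm: "F' x \<in> borel_measurable M"
    and der: "\<And>y \<omega>. a < y \<Longrightarrow> y < b \<Longrightarrow> \<omega> \<in> space M \<Longrightarrow> ((\<lambda>y. F y \<omega>) has_real_derivative F' y \<omega>) (at y)"
    and bd: "\<And>y \<omega>. a < y \<Longrightarrow> y < b \<Longrightarrow> \<omega> \<in> space M \<Longrightarrow> \<bar>F' y \<omega>\<bar> \<le> G \<omega>"
    and G: "integrable M G"
  shows "((\<lambda>y. \<integral>\<omega>. F y \<omega> \<partial>M) has_real_derivative (\<integral>\<omega>. F' x \<omega> \<partial>M)) (at x)"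
proof -
  have "((\<lambda>y. ((\<integral>\<omega>. F y \<omega> \<partial>M) - (\<integral>\<omega>. F x \<omega> \<partial>M)) / (y - x)) \<longlongrightarrow> (\<integral>\<omega>. F' x \<omega> \<partial>M)) (at x within {a<..<b})"
    unfolding tendsto_at_iff_sequentially comp_def
  proof (intro allI impI)
    fix Y :: "nat \<Rightarrow> real"
    assume Y: "\<forall>i. Y i \<in> {a<..<b} - {x}" and lim: "Y \<longlonglongrightarrow> x"
    have eq: "((\<integral>\<omega>. F (Y n) \<omega> \<partial>M) - (\<integral>\<omega>. F x \<omega> \<partial>M)) / (Y n - x) = (\<integral>\<omega>. (F (Y n) \<omega> - F x \<omega>) / (Y n - x) \<partial>M)" for n
      using Y[rule_format, of n] x by (simp add: int)
    show "(\<lambda>n. ((\<integral>\<omega>. F (Y n) \<omega> \<partial>M) - (\<integral>\<omega>. F x \<omega> \<partial>M)) / (Y n - x)) \<longlonglongrightarrow> (\<integral>\<omega>. F' x \<omega> \<partial>M)"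
      unfolding eq
    proof (rule integral_dominated_convergence[where w=G])
      show "(\<lambda>\<omega>. (F (Y n) \<omega> - F x \<omega>) / (Y n - x)) \<in> borel_measurable M" for n
        using Y[rule_format, of n] x int[of "Y n"] int[of x]
        by (intro borel_measurable_divide borel_measurable_diff) auto
      show "AE \<omega> in M. (\<lambda>n. (F (Y n) \<omega> - F x \<omega>) / (Y n - x)) \<longlonglongrightarrow> F' x \<omega>"
      proof (intro AE_I2)
        fix \<omega> assume "\<omega> \<in> space M"
        then have "((\<lambda>y. F y \<omega>) has_real_derivative F' x \<omega>) (at x)" using der x by blast
        then have "((\<lambda>y. (F y \<omega> - F x \<omega>) / (y - x)) \<longlongrightarrow> F' x \<omega>) (at x)"
          by (simp add: has_field_derivative_iff)
        then show "(\<lambda>n. (F (Y n) \<omega> - F x \<omega>) / (Y n - x)) \<longlonglongrightarrow> F' x \<omega>"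
          using Y lim unfolding tendsto_at_iff_sequentially comp_def by auto
      qed
      show "AE \<omega> in M. norm ((F (Y n) \<omega> - F x \<omega>) / (Y n - x)) \<le> G \<omega>" for n
      proof (intro AE_I2)
        fix \<omega> assume w: "\<omega> \<in> space M"
        have yn: "a < Y n" "Y n < b" "Y n \<noteq> x" using Y[rule_format, of n] by auto
        have "\<bar>F (Y n) \<omega> - F x \<omega>\<bar> \<le> G \<omega> * \<bar>Y n - x\<bar>"
          using field_differentiable_bound[of "{a<..<b}" "\<lambda>y. F y \<omega>" "\<lambda>y. F' y \<omega>" "G \<omega>" "Y n" x]
            der w bd yn x by (auto intro: has_field_derivative_at_within)
        then show "norm ((F (Y n) \<omega> - F x \<omega>) / (Y n - x)) \<le> G \<omega>"
          using yn by (simp add: abs_divide divide_le_eq)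
      qed
    qed (use F'm G in auto)
  qed
  then show ?thesis
    using x by (simp add: has_field_derivative_iff at_within_open[of x "{a<..<b}"])
qed

section \<open>Haar measure: measurability and translation invariance\<close>

locale haar_measure =
  fixes H :: "('n::finite cmat) measure"
  assumes haar: "unitary_haar H"
begin

lemma sets_H: "sets H = sets (restrict_space borel {A. unitary A})"
  using haar by (simp add: unitary_haar_def)

lemma space_H: "space H = {A. unitary A}"
  using sets_eq_imp_space_eq[OF sets_H] by (simp add: space_restrict_space)

sublocale prob_space H
  by standard (use haar in \<open>simp add: unitary_haar_def\<close>)

lemma ident_measurable [measurable]: "(\<lambda>A. A) \<in> borel_measurable H"
  unfolding measurable_cong_sets[OF sets_H refl] by (rule measurable_restrict_space1) simp

lemma entry_measurable [measurable]: "(\<lambda>A. A $ i $ j) \<in> borel_measurable H"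
  by (rule measurable_compose[OF ident_measurable], rule borel_measurable_continuous_onI)
     (intro continuous_intros)

lemma mult_right_measurable:
  assumes "unitary V" shows "(\<lambda>A. A ** V) \<in> measurable H H"
proof -
  have c: "continuous_on UNIV (\<lambda>A :: 'n cmat. A ** V)"
    unfolding matrix_matrix_mult_def by (intro continuous_intros)
  have "(\<lambda>A. A ** V) \<in> borel_measurable H"
    by (rule measurable_compose[OF ident_measurable borel_measurable_continuous_onI[OF c]])
  then show ?thesis
    unfolding measurable_cong_sets[OF refl sets_H]
    by (rule measurable_restrict_space2[rotated]) (auto simp: space_H unitary_mult assms)
qed

lemma integral_translate:
  fixes f :: "'n cmat \<Rightarrow> real"
  assumes "unitary V" "f \<in> borel_measurable H"
  shows "(\<integral>A. f (A ** V) \<partial>H) = (\<integral>A. f A \<partial>H)"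
proof -
  have "(\<integral>A. f A \<partial>H) = (\<integral>A. f A \<partial>(distr H H (\<lambda>A. A ** V)))"
    using haar assms by (simp add: unitary_haar_def)
  also have "\<dots> = (\<integral>A. f (A ** V) \<partial>H)"
    by (rule integral_distr[OF mult_right_measurable[OF assms(1)] assms(2)])
  finally show ?thesis ..
qed

end

text \<open>Right multiplication by this matrix rotates column \<open>b\<close> against all other
  columns. It is the device by which Haar invariance yields an average over a relative
  phase.\<close>

definition phase_mat :: "'n::finite \<Rightarrow> complex \<Rightarrow> 'n cmat" where
  "phase_mat b \<omega> = (\<chi> i j. if i = j then if i = b then \<omega> else 1 else 0)"

lemma mult_phase_mat: "(A ** phase_mat b \<omega>) $ i $ j = A $ i $ j * (if j = b then \<omega> else 1)"
proof -
  have "A $ i $ k * phase_mat b \<omega> $ k $ j = (if k = j then A $ i $ j * (if j = b then \<omega> else 1) else 0)" for k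
    by (simp add: phase_mat_def)
  then show ?thesis by (simp add: matrix_matrix_mult_def)
qed

lemma phase_mat_vec: "(phase_mat b \<omega> *v u) $ i = (if i = b then \<omega> else 1) * u $ i"
proof -
  have "phase_mat b \<omega> $ i $ k * u $ k = (if k = i then (if i = b then \<omega> else 1) * u $ i else 0)" for k
    by (simp add: phase_mat_def)
  then show ?thesis by (simp add: matrix_vector_mult_def)
qed

lemma unitary_phase_mat: assumes "cmod \<omega> = 1" shows "unitary (phase_mat b \<omega>)"
proof -
  have *: "\<omega> * cnj \<omega> = 1" using assms by (metis complex_norm_square of_real_1 power_one)
  have "cnj ((phase_mat b \<omega> *v y) $ i) * (phase_mat b \<omega> *v z) $ i = cnj (y $ i) * z $ i" for i y z
    using * unfolding phase_mat_vec by (auto simp: algebra_simps)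
  then show ?thesis by (simp add: unitary_iff_cinner cinner_def)
qed

lemma phase_mat_axis: "i \<noteq> b \<Longrightarrow> phase_mat b \<omega> *v axis i 1 = axis i 1"
  unfolding vec_eq_iff phase_mat_vec by (simp add: axis_def)

context haar_measure
begin

text \<open>
  Rotating \<open>z\<close> by a \<open>2^m\<close>-th root of \<open>-1\<close> replaces \<open>ln |1 - z^(2^m)|\<close> by the average of
  \<open>ln |1 \<mp> z^(2^m)|\<close>, which is half of \<open>ln |1 - z^(2^(m+1))|\<close>.
\<close>

lemma phase_average_zero:
  fixes f :: "'n cmat \<Rightarrow> real" and z :: "'n cmat \<Rightarrow> complex"
  assumes f: "integrable H f"
    and f_inv: "\<And>A \<omega>. unitary A \<Longrightarrow> cmod \<omega> = 1 \<Longrightarrow> f (A ** phase_mat b \<omega>) = f A"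
    and z[measurable]: "z \<in> borel_measurable H"
    and z_rot: "\<And>A \<omega>. unitary A \<Longrightarrow> cmod \<omega> = 1 \<Longrightarrow> z (A ** phase_mat b \<omega>) = \<omega> * z A"
    and z_le: "\<And>A. unitary A \<Longrightarrow> cmod (z A) \<le> 1 - \<delta>" and \<delta>: "0 < \<delta>"
  shows "integrable H (\<lambda>A. f A * ln (cmod (1 - z A)))" "(\<integral>A. f A * ln (cmod (1 - z A)) \<partial>H) = 0"
proof -
  have [measurable]: "f \<in> borel_measurable H" using f by simp
  \<comment> \<open>The modulus of \<open>1 - w * z A ^ (2 ^ m)\<close> stays between
    \<open>\<delta>\<close> and 2, so its logarithm has a bound that does not depend on
    \<open>m\<close>.\<close>
  define C where "C = \<bar>ln \<delta>\<bar> + ln 2"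
  have low: "\<delta> \<le> cmod (1 - w * z A ^ (2 ^ m))" "cmod (1 - w * z A ^ (2 ^ m)) \<le> 2"
    if "unitary A" "cmod w = 1" for A m w
  proof -
    have "cmod (z A) \<le> 1" using z_le[OF that(1)] \<delta> by simp
    then have "cmod (z A ^ (2 ^ m)) \<le> cmod (z A)"
      using power_decreasing[of 1 "2 ^ m" "cmod (z A)"] by (simp add: norm_power)
    then have c: "cmod (w * z A ^ (2 ^ m)) \<le> 1 - \<delta>" using z_le[OF that(1)] that(2) by (simp add: norm_mult)
    show "\<delta> \<le> cmod (1 - w * z A ^ (2 ^ m))"
      using norm_triangle_ineq2[of 1 "w * z A ^ (2 ^ m)"] c by simp
    show "cmod (1 - w * z A ^ (2 ^ m)) \<le> 2"
      using norm_triangle_ineq4[of 1 "w * z A ^ (2 ^ m)"] c \<delta> by simp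
  qed
  have bnd: "\<bar>ln (cmod (1 - w * z A ^ (2 ^ m)))\<bar> \<le> C" if "unitary A" "cmod w = 1" for A m w
  proof -
    have "ln \<delta> \<le> ln (cmod (1 - w * z A ^ (2 ^ m)))" "ln (cmod (1 - w * z A ^ (2 ^ m))) \<le> ln 2"
      using low[OF that, of m] \<delta> by (meson less_le_trans ln_le_cancel_iff zero_less_numeral)+
    moreover have "0 < ln (2::real)" by simp
    ultimately show ?thesis unfolding C_def by linarith
  qed
  have intw: "integrable H (\<lambda>A. f A * ln (cmod (1 - w * z A ^ (2 ^ m))))" if "cmod w = 1" for m w
  proof (rule Bochner_Integration.integrable_bound)
    show "integrable H (\<lambda>A. C * f A)" using f by simp
    show "AE A in H. norm (f A * ln (cmod (1 - w * z A ^ (2 ^ m)))) \<le> norm (C * f A)"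
    proof (intro AE_I2)
      fix A assume "A \<in> space H"
      then have A: "unitary A" by (simp add: space_H)
      have "0 \<le> C" using bnd[OF A that] abs_ge_zero order_trans by blast
      then show "norm (f A * ln (cmod (1 - w * z A ^ (2 ^ m)))) \<le> norm (C * f A)"
        using mult_left_mono[OF bnd[OF A that, of m], of "\<bar>f A\<bar>"] by (simp add: abs_mult mult.commute)
    qed
  qed measurable
  note int = intw[of 1, simplified] and int' = intw[of "-1", simplified]
  define J where "J m = (\<integral>A. f A * ln (cmod (1 - z A ^ (2 ^ m))) \<partial>H)" for m
  have step: "J m = J (Suc m) / 2" for m
  proof -
    define \<omega> where "\<omega> = cis (pi / 2 ^ m)"
    have "\<omega> ^ (2 ^ m) = cis (real (2 ^ m) * (pi / 2 ^ m))"
      unfolding \<omega>_def by (rule Complex.DeMoivre)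
    also have "real (2 ^ m) * (pi / 2 ^ m) = pi" by simp
    finally have \<omega>: "cmod \<omega> = 1" "\<omega> ^ (2 ^ m) = -1"
      by (simp_all add: \<omega>_def)
    have "J m = (\<integral>A. f (A ** phase_mat b \<omega>) * ln (cmod (1 - z (A ** phase_mat b \<omega>) ^ (2 ^ m))) \<partial>H)"
      unfolding J_def by (rule integral_translate[symmetric]) (auto intro: unitary_phase_mat \<omega>)
    also have "\<dots> = (\<integral>A. f A * ln (cmod (1 + z A ^ (2 ^ m))) \<partial>H)"
      by (rule Bochner_Integration.integral_cong)
         (auto simp: space_H f_inv z_rot \<omega> power_mult_distrib)
    finally have "J m + J m = (\<integral>A. f A * ln (cmod (1 - z A ^ (2 ^ m))) + f A * ln (cmod (1 + z A ^ (2 ^ m))) \<partial>H)"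
      by (simp add: J_def int int')
    also have "\<dots> = J (Suc m)"
      unfolding J_def
    proof (rule Bochner_Integration.integral_cong[OF refl])
      fix A assume "A \<in> space H"
      then have A: "unitary A" by (simp add: space_H)
      have "0 < cmod (1 - z A ^ (2 ^ m))" "0 < cmod (1 + z A ^ (2 ^ m))"
        using low(1)[OF A, of 1 m] low(1)[OF A, of "-1" m] \<delta> by auto
      then have "ln (cmod (1 - z A ^ (2 ^ m))) + ln (cmod (1 + z A ^ (2 ^ m)))
         = ln (cmod ((1 - z A ^ (2 ^ m)) * (1 + z A ^ (2 ^ m))))"
        by (simp add: norm_mult ln_mult)
      also have "(1 - z A ^ (2 ^ m)) * (1 + z A ^ (2 ^ m)) = 1 - z A ^ (2 ^ m) * z A ^ (2 ^ m)"
        by (simp add: ring_distribs)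
      also have "z A ^ (2 ^ m) * z A ^ (2 ^ m) = z A ^ (2 ^ Suc m)"
        by (simp add: mult_2 power_add)
      finally show "f A * ln (cmod (1 - z A ^ (2 ^ m))) + f A * ln (cmod (1 + z A ^ (2 ^ m)))
         = f A * ln (cmod (1 - z A ^ (2 ^ Suc m)))" by (metis distrib_left)
    qed
    finally show ?thesis by simp
  qed
  \<comment> \<open>Each doubling of the power contributes a factor 1/2 while \<open>J m\<close>
    stays bounded, so \<open>J 0\<close> must vanish.\<close>
  have "J 0 = J m / 2 ^ m" for m
  proof (induction m)
    case (Suc m)
    then show ?case using step[of m] by simp
  qed simp
  moreover have "\<bar>J m\<bar> \<le> (\<integral>A. \<bar>f A\<bar> * C \<partial>H)" for m
  proof -
    have "\<bar>J m\<bar> \<le> (\<integral>A. \<bar>f A * ln (cmod (1 - z A ^ (2 ^ m)))\<bar> \<partial>H)"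
      unfolding J_def by (rule integral_abs_bound)
    also have "\<dots> \<le> (\<integral>A. \<bar>f A\<bar> * C \<partial>H)"
      using bnd[of _ 1] f integrable_abs[OF int[of m]]
      by (intro integral_mono) (auto simp: space_H abs_mult intro!: mult_left_mono)
    finally show ?thesis .
  qed
  moreover have "\<bar>J m / 2 ^ m\<bar> = \<bar>J m\<bar> * (1/2) ^ m" for m
    by (simp add: abs_divide power_one_over)
  ultimately have le: "\<bar>J 0\<bar> \<le> (\<integral>A. \<bar>f A\<bar> * C \<partial>H) * (1/2) ^ m" for m
    using mult_right_mono[of "\<bar>J m\<bar>" _ "(1/2) ^ m"] by (metis zero_le_divide_1_iff zero_le_numeral zero_le_power)
  have "(\<lambda>m. (\<integral>A. \<bar>f A\<bar> * C \<partial>H) * (1/2) ^ m) \<longlonglongrightarrow> (\<integral>A. \<bar>f A\<bar> * C \<partial>H) * 0"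
    by (intro tendsto_intros LIMSEQ_realpow_zero) auto
  then have "\<bar>J 0\<bar> \<le> 0" using le by (intro LIMSEQ_le_const) auto
  then show "(\<integral>A. f A * ln (cmod (1 - z A)) \<partial>H) = 0" by (simp add: J_def)
  show "integrable H (\<lambda>A. f A * ln (cmod (1 - z A)))" using int[of 0] by simp
qed

end

text \<open>
  \<open>circle_log p q r \<rho>\<close> is the mean of \<open>ln (\<rho> p + (1 - \<rho>) q + 2 sqrt (\<rho> (1 - \<rho>) r) cos \<alpha>)\<close> over \<open>\<alpha>\<close>.
\<close>

definition circle_disc :: "real \<Rightarrow> real \<Rightarrow> real \<Rightarrow> real \<Rightarrow> real" where
  "circle_disc p q r \<rho> = (\<rho> * p + (1 - \<rho>) * q)\<^sup>2 - 4 * \<rho> * (1 - \<rho>) * r"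

definition circle_log :: "real \<Rightarrow> real \<Rightarrow> real \<Rightarrow> real \<Rightarrow> real" where
  "circle_log p q r \<rho> = ln ((\<rho> * p + (1 - \<rho>) * q + sqrt (circle_disc p q r \<rho>)) / 2)"

text \<open>The quantity \<open>\<kappa>\<close> of the overview: the only part of the derivative of
  \<open>circle_log\<close> in which \<open>p\<close>, \<open>q\<close> and \<open>r\<close>
  occur.\<close>

definition circle_slope :: "real \<Rightarrow> real \<Rightarrow> real \<Rightarrow> real \<Rightarrow> real" where
  "circle_slope p q r \<rho> = (\<rho> * p - (1 - \<rho>) * q) / sqrt (circle_disc p q r \<rho>)"

text \<open>For \<open>\<bar>d\<bar> \<le> x\<close> the mean of
  \<open>ln (x + d * cos \<alpha>)\<close> is \<open>ln ((x + sqrt (x^2 - d^2)) / 2)\<close>, and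
  \<open>circle_disc\<close> is that \<open>x^2 - d^2\<close>. As a sum of two terms that are
  nonnegative for \<open>r \<le> p * q\<close>, it displays both its positivity and the reason why
  the slope is at most 1 in modulus.\<close>

lemma circle_disc_eq: "circle_disc p q r \<rho> = (\<rho> * p - (1 - \<rho>) * q)\<^sup>2 + 4 * \<rho> * (1 - \<rho>) * (p * q - r)"
  by (simp add: circle_disc_def power2_eq_square algebra_simps)

lemma circle_disc_pos:
  assumes "0 < \<rho>" "\<rho> < 1" "r < p * q" shows "0 < circle_disc p q r \<rho>"
  unfolding circle_disc_eq using assms by (intro add_nonneg_pos mult_pos_pos) auto

lemma abs_circle_slope_le:
  assumes "0 < \<rho>" "\<rho> < 1" "r \<le> p * q" shows "\<bar>circle_slope p q r \<rho>\<bar> \<le> 1"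
proof -
  have "\<bar>\<rho> * p - (1 - \<rho>) * q\<bar> = sqrt ((\<rho> * p - (1 - \<rho>) * q)\<^sup>2)" by simp
  also have "\<dots> \<le> sqrt (circle_disc p q r \<rho>)"
    unfolding circle_disc_eq using assms by (intro real_sqrt_le_mono) simp
  finally show ?thesis
    by (auto simp: circle_slope_def abs_divide divide_le_eq)
qed

lemma circle_log_deriv:
  assumes \<rho>: "0 < \<rho>" "\<rho> < 1" and pq: "0 < p" "0 < q" and r: "r < p * q"
  shows "(circle_log p q r has_real_derivative (1 - 2 * \<rho> + circle_slope p q r \<rho>) / (2 * \<rho> * (1 - \<rho>))) (at \<rho>)"
proof -
  define s where "s = sqrt (circle_disc p q r \<rho>)"
  define u w where "u = \<rho> * p" and "w = (1 - \<rho>) * q"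
  have s: "0 < s" "s\<^sup>2 = circle_disc p q r \<rho>"
    using circle_disc_pos[OF \<rho> r] by (auto simp: s_def)
  have uw: "0 < u" "0 < w" using \<rho> pq by (auto simp: u_def w_def)
  define m' where "m' = 2 * (\<rho> * p + (1 - \<rho>) * q) * (p - q) - 4 * (1 - 2 * \<rho>) * r"
  have dx: "((\<lambda>y. y * p + (1 - y) * q) has_real_derivative p - q) (at \<rho>)"
    by (auto intro!: derivative_eq_intros)
  have "(circle_disc p q r has_real_derivative
      2 * (\<rho> * p + (1 - \<rho>) * q) * (p - q) - (4 * (1 - \<rho>) - 4 * \<rho>) * r) (at \<rho>)"
    unfolding circle_disc_def[abs_def]
    by (rule derivative_eq_intros dx refl)+ simp
  then have "(circle_disc p q r has_real_derivative m') (at \<rho>)"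
    unfolding m'_def by (rule DERIV_cong) (simp add: algebra_simps)
  from DERIV_chain2[OF DERIV_real_sqrt[OF circle_disc_pos[OF \<rho> r]] this]
  have ds: "((\<lambda>y. sqrt (circle_disc p q r y)) has_real_derivative inverse s / 2 * m') (at \<rho>)"
    unfolding s_def .
  define h where "h = (\<lambda>y. (y * p + (1 - y) * q + sqrt (circle_disc p q r y)) / 2)"
  have dh: "(h has_real_derivative ((p - q) + inverse s / 2 * m') / 2) (at \<rho>)"
    unfolding h_def by (rule DERIV_cdivide[OF DERIV_add[OF dx ds]])
  have h: "h \<rho> = (u + w + s) / 2" by (simp add: h_def u_def w_def s_def)
  have "0 < h \<rho>" unfolding h using s uw by simp
  from DERIV_chain2[OF DERIV_ln[OF this] dh]
  have "((\<lambda>y. ln (h y)) has_real_derivative inverse ((u + w + s) / 2) * (((p - q) + inverse s / 2 * m') / 2)) (at \<rho>)"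
    by (simp only: h)
  moreover have "inverse ((u + w + s) / 2) * (((p - q) + inverse s / 2 * m') / 2) = ((p - q + m' / (2 * s)) / 2) / ((u + w + s) / 2)"
    by (simp add: inverse_eq_divide mult.commute)
  moreover have "(\<lambda>y. ln (h y)) = circle_log p q r" by (simp add: h_def circle_log_def[abs_def])
  ultimately have "(circle_log p q r has_real_derivative ((p - q + m' / (2 * s)) / 2) / ((u + w + s) / 2)) (at \<rho>)"
    by simp
  moreover have "((p - q + m' / (2 * s)) / 2) / ((u + w + s) / 2) = (1 - 2 * \<rho> + circle_slope p q r \<rho>) / (2 * \<rho> * (1 - \<rho>))"
  proof -
    have 1: "\<rho> * (1 - \<rho>) * m' = 2 * (u - w) * ((1 - \<rho>) * u + \<rho> * w) + (1 - 2 * \<rho>) * (s\<^sup>2 - (u - w)\<^sup>2)"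
      unfolding s(2) circle_disc_def m'_def u_def w_def by (simp add: algebra_simps power2_eq_square)
    have 2: "\<rho> * (1 - \<rho>) * (p - q) = (1 - \<rho>) * u - \<rho> * w"
      unfolding u_def w_def by (simp add: algebra_simps)
    \<comment> \<open>The denominator \<open>u + w + s\<close> of the logarithmic derivative
      reappears as a factor of the numerator. The cancellation leaves only \<open>s\<close> and
      \<open>\<rho> * (1 - \<rho>)\<close> below the fraction bar.\<close>
    have "2 * s * (\<rho> * (1 - \<rho>) * (p - q)) + \<rho> * (1 - \<rho>) * m' = (u + w + s) * ((1 - 2 * \<rho>) * s + (u - w))"
      unfolding 1 2 by (simp add: algebra_simps power2_eq_square)
    then have 3: "\<rho> * (1 - \<rho>) * (2 * s * (p - q) + m') = (u + w + s) * ((1 - 2 * \<rho>) * s + (u - w))"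
      by (simp only: distrib_left mult.assoc mult.left_commute mult.commute)
    have 4: "p - q + m' / (2 * s) = (2 * s * (p - q) + m') / (2 * s)" using s by (simp add: add_divide_distrib)
    have 5: "circle_slope p q r \<rho> = (u - w) / s" by (simp add: circle_slope_def s_def u_def w_def)
    have 6: "1 - 2 * \<rho> + (u - w) / s = ((1 - 2 * \<rho>) * s + (u - w)) / s" using s by (simp add: add_divide_distrib)
    have "2 * s * (p - q) + m' = (u + w + s) * ((1 - 2 * \<rho>) * s + (u - w)) / (\<rho> * (1 - \<rho>))"
      using \<rho> by (simp add: 3[symmetric])
    then have "((p - q + m' / (2 * s)) / 2) / ((u + w + s) / 2)
      = ((u + w + s) * ((1 - 2 * \<rho>) * s + (u - w)) / (\<rho> * (1 - \<rho>)) / (2 * s)) / (u + w + s)"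
      unfolding 4 by simp
    also have "\<dots> = ((1 - 2 * \<rho>) * s + (u - w)) / (\<rho> * (1 - \<rho>)) / (2 * s)"
      using s uw by (simp add: divide_divide_eq_left mult.commute)
    also have "\<dots> = (1 - 2 * \<rho> + circle_slope p q r \<rho>) / (2 * \<rho> * (1 - \<rho>))"
      unfolding 5 6 by (simp add: divide_divide_eq_left ac_simps)
    finally show ?thesis .
  qed
  ultimately show ?thesis by simp
qed

lemma circle_log_bounds:
  assumes "0 < \<rho>" "\<rho> < 1" "0 \<le> r" "r < p * q" "0 < p" "0 < q"
  shows "ln ((\<rho> * p + (1 - \<rho>) * q) / 2) \<le> circle_log p q r \<rho>" "circle_log p q r \<rho> \<le> ln (\<rho> * p + (1 - \<rho>) * q)"
proof -
  let ?x = "\<rho> * p + (1 - \<rho>) * q"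
  have x: "0 < ?x" using assms by (intro add_pos_pos mult_pos_pos) auto
  have s: "0 \<le> sqrt (circle_disc p q r \<rho>)" using circle_disc_pos[of \<rho> r p q] assms by simp
  have aux: "ln ((x + t) / 2) \<le> ln x" if "0 < x" "0 \<le> t" "t \<le> x" for x t :: real
    using that by (intro ln_mono) auto
  show "ln (?x / 2) \<le> circle_log p q r \<rho>"
    unfolding circle_log_def using x s by (intro ln_mono) (auto intro: add_pos_nonneg)
  have "sqrt (circle_disc p q r \<rho>) \<le> sqrt (?x\<^sup>2)"
    unfolding circle_disc_def using assms by (intro real_sqrt_le_mono) simp
  then have "sqrt (circle_disc p q r \<rho>) \<le> ?x" using x by simp
  then show "circle_log p q r \<rho> \<le> ln ?x"
    unfolding circle_log_def using aux x s by blast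
qed

section \<open>Matrix entries of \<open>P\<close> in the plane of \<open>e_a\<close> and
  \<open>e_b\<close>, and the phase average\<close>

definition diag_form :: "'n::finite rvec \<Rightarrow> 'n cmat \<Rightarrow> 'n \<Rightarrow> real" where
  "diag_form l A a = (\<Sum>i\<in>UNIV. exp (l $ i) * entry_mass A i a)"

text \<open>Together with \<open>diag_form\<close> this lists the entries of the compression of
  \<open>P = polar l A\<close> to the plane of \<open>e_a\<close> and \<open>e_b\<close>: the
  diagonal ones \<open>P_aa\<close>, \<open>P_bb\<close> and the off-diagonal one
  \<open>P_ab\<close>.\<close>

definition off_form :: "'n::finite rvec \<Rightarrow> 'n cmat \<Rightarrow> 'n \<Rightarrow> 'n \<Rightarrow> complex" where
  "off_form l A a b = (\<Sum>i\<in>UNIV. complex_of_real (exp (l $ i)) * cnj (A $ i $ a) * A $ i $ b)"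

definition mix_vec :: "'n::finite \<Rightarrow> 'n \<Rightarrow> real \<Rightarrow> complex \<Rightarrow> 'n cvec" where
  "mix_vec a b \<rho> \<omega> = complex_of_real (sqrt \<rho>) *s axis a 1 + (\<omega> * complex_of_real (sqrt (1 - \<rho>))) *s axis b 1"

lemma mult_mix_vec:
  fixes A :: "'n::finite cmat"
  shows "(A *v mix_vec a b \<rho> \<omega>) $ i = complex_of_real (sqrt \<rho>) * A $ i $ a + \<omega> * complex_of_real (sqrt (1 - \<rho>)) * A $ i $ b"
  by (simp add: mix_vec_def matrix_vector_right_distrib vec.scale mult_axis_nth)

lemma diag_form_qform: "diag_form l A a = qform l A (axis a 1)"
  by (simp add: diag_form_def qform_def mult_axis_nth)

lemma cinner_mix_vec:
  assumes "a \<noteq> b" "0 \<le> \<rho>" "\<rho> \<le> 1"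
  shows "cinner (axis a 1) (mix_vec a b \<rho> \<omega>) = complex_of_real (sqrt \<rho>)"
    "cmod \<omega> = 1 \<Longrightarrow> norm (mix_vec a b \<rho> \<omega>) = 1"
proof -
  show "cinner (axis a 1) (mix_vec a b \<rho> \<omega>) = complex_of_real (sqrt \<rho>)"
    using assms unfolding cinner_axis_left by (simp add: mix_vec_def) (simp add: axis_def)
  assume w: "cmod \<omega> = 1"
  have "cnj \<omega> * \<omega> = 1" using w by (metis complex_norm_square of_real_1 power_one mult.commute)
  moreover have "cnj \<omega> * (y * (\<omega> * y)) = (cnj \<omega> * \<omega>) * (y * y)" for y by (simp only: ac_simps)
  ultimately have *: "cnj \<omega> * (complex_of_real (sqrt (1 - \<rho>)) * (\<omega> * complex_of_real (sqrt (1 - \<rho>)))) = complex_of_real (sqrt (1 - \<rho>) * sqrt (1 - \<rho>))"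
    by (simp only: of_real_mult) simp
  have "cinner (mix_vec a b \<rho> \<omega>) (mix_vec a b \<rho> \<omega>) = complex_of_real (sqrt \<rho> * sqrt \<rho>) + complex_of_real (sqrt (1 - \<rho>) * sqrt (1 - \<rho>))"
    using assms(1) * unfolding mix_vec_def
    by (simp only: cinner_add_left cinner_add_right cinner_scale_left cinner_scale_right cinner_axis_axis)
       (simp add: ac_simps del: real_sqrt_mult_self)
  also have "\<dots> = 1" using assms by (simp del: of_real_mult)
  finally have "(norm (mix_vec a b \<rho> \<omega>))\<^sup>2 = 1" unfolding cinner_self by (simp only: of_real_eq_1_iff)
  then show "norm (mix_vec a b \<rho> \<omega>) = 1" by (simp add: power2_eq_1_iff) (metis norm_ge_zero not_one_le_zero neg_0_le_iff_le)
qed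

lemma Re_of_real_mult_left:
  "c * Re (\<omega> * (complex_of_real k * (x * y))) = Re (\<omega> * (complex_of_real k * (complex_of_real c * x * y)))"
  by (simp add: algebra_simps)

lemma qform_mix_vec:
  assumes "0 \<le> \<rho>" "\<rho> \<le> 1" "cmod \<omega> = 1"
  shows "qform l A (mix_vec a b \<rho> \<omega>) = \<rho> * diag_form l A a + (1 - \<rho>) * diag_form l A b
           + Re (\<omega> * (2 * sqrt (\<rho> * (1 - \<rho>)) * off_form l A a b))"
proof -
  have e: "(cmod (complex_of_real (sqrt \<rho>) * x + \<omega> * complex_of_real (sqrt (1 - \<rho>)) * y))\<^sup>2
     = \<rho> * (cmod x)\<^sup>2 + (1 - \<rho>) * (cmod y)\<^sup>2 + Re (\<omega> * (2 * sqrt (\<rho> * (1 - \<rho>)) * (cnj x * y)))" for x y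
  proof -
    have "(cmod (v + w))\<^sup>2 = (cmod v)\<^sup>2 + (cmod w)\<^sup>2 + 2 * Re (cnj v * w)" for v w
      unfolding cmod_power2 by (simp add: power2_eq_square algebra_simps)
    then have "(cmod (complex_of_real (sqrt \<rho>) * x + \<omega> * complex_of_real (sqrt (1 - \<rho>)) * y))\<^sup>2
      = (sqrt \<rho> * cmod x)\<^sup>2 + (sqrt (1 - \<rho>) * cmod y)\<^sup>2
        + 2 * Re (cnj (complex_of_real (sqrt \<rho>) * x) * (\<omega> * complex_of_real (sqrt (1 - \<rho>)) * y))"
      using assms by (simp add: norm_mult)
    also have "cnj (complex_of_real (sqrt \<rho>) * x) * (\<omega> * complex_of_real (sqrt (1 - \<rho>)) * y)
      = complex_of_real (sqrt (\<rho> * (1 - \<rho>))) * (\<omega> * (cnj x * y))"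
      by (simp add: real_sqrt_mult)
    also have "2 * Re \<dots> = Re (\<omega> * (2 * sqrt (\<rho> * (1 - \<rho>)) * (cnj x * y)))"
      by (simp add: algebra_simps)
    finally show ?thesis using assms by (simp add: power_mult_distrib)
  qed
  show ?thesis
    unfolding qform_def mult_mix_vec e diag_form_def off_form_def sum_distrib_left sum_distrib_right Re_sum sum.distrib[symmetric]
    by (intro sum.cong refl) (simp only: distrib_left Re_of_real_mult_left, simp only: mult.left_commute)
qed

lemma cnj_mult_self: "cnj z * z = complex_of_real (cmod z) * complex_of_real (cmod z)"
proof -
  have "cnj z * z = complex_of_real ((cmod z)\<^sup>2)"
    by (subst complex_norm_square) (simp add: mult.commute)
  then show ?thesis by (simp add: power2_eq_square)
qed

text \<open>Minimizing the form at \<open>mix_vec a b \<rho> \<omega>\<close> over the phase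
  \<open>\<omega>\<close> leaves the difference in the fourth claim, so the lower bound
  \<open>m\<close> for the eigenvalues applies to it. The fifth claim is strict Cauchy-Schwarz for
  columns \<open>a\<close> and \<open>b\<close> in the inner product with weights
  \<open>exp (l $ i)\<close>.\<close>

lemma form_bounds:
  fixes l :: "'n::finite rvec"
  assumes A: "unitary A" and ab: "a \<noteq> b"
  defines "m \<equiv> exp (- one_norm l)" and "M \<equiv> exp (one_norm l)"
  shows "m \<le> diag_form l A a" "diag_form l A a \<le> M"
    and "0 < diag_form l A a"
    and "0 \<le> \<rho> \<Longrightarrow> \<rho> \<le> 1 \<Longrightarrow> m \<le> \<rho> * diag_form l A a + (1 - \<rho>) * diag_form l A b - cmod (2 * sqrt (\<rho> * (1 - \<rho>)) * off_form l A a b)"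
    and "(cmod (off_form l A a b))\<^sup>2 < diag_form l A a * diag_form l A b"
proof -
  show p: "m \<le> diag_form l A a" "diag_form l A a \<le> M" for a
    using qform_bounds[OF A, of "axis a 1" l] by (auto simp: diag_form_qform m_def M_def)
  have m: "0 < m" by (simp add: m_def)
  then show pos: "0 < diag_form l A a" for a using p(1)[of a] by linarith
  show low: "m \<le> \<rho> * diag_form l A a + (1 - \<rho>) * diag_form l A b - cmod (2 * sqrt (\<rho> * (1 - \<rho>)) * off_form l A a b)"
    if \<rho>: "0 \<le> \<rho>" "\<rho> \<le> 1" for \<rho>
  proof -
    define d where "d = complex_of_real (2 * sqrt (\<rho> * (1 - \<rho>))) * off_form l A a b"
    obtain \<omega> where w: "cmod \<omega> = 1" "\<omega> * d = - complex_of_real (cmod d)"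
    proof (cases "d = 0")
      case True then show ?thesis using that[of 1] by simp
    next
      case False
      have "- cnj d / complex_of_real (cmod d) * d = - complex_of_real (cmod d)"
        using False by (simp add: cnj_mult_self)
      moreover have "cmod (- cnj d / complex_of_real (cmod d)) = 1" using False by (simp add: norm_divide)
      ultimately show ?thesis using that by blast
    qed
    have "m \<le> qform l A (mix_vec a b \<rho> \<omega>)"
      using qform_bounds(1)[OF A cinner_mix_vec(2)[OF ab \<rho> w(1)], of l] by (simp add: m_def)
    also have "\<dots> = \<rho> * diag_form l A a + (1 - \<rho>) * diag_form l A b + Re (\<omega> * d)"
      unfolding qform_mix_vec[OF \<rho> w(1)] d_def by simp
    finally have "m \<le> \<rho> * diag_form l A a + (1 - \<rho>) * diag_form l A b + Re (\<omega> * d)" .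
    moreover have "Re (\<omega> * d) = - cmod d" unfolding w(2) by simp
    ultimately show ?thesis unfolding d_def by linarith
  qed
  define p q where "p = diag_form l A a" and "q = diag_form l A b"
  have pq: "0 < p" "0 < q" using pos by (auto simp: p_def q_def)
  \<comment> \<open>This choice balances the two diagonal terms,
    \<open>\<rho> * p = (1 - \<rho>) * q\<close>. There the arithmetic mean meets the geometric one,
    and the fourth claim compares the off-diagonal entry with \<open>sqrt (p * q)\<close>.\<close>
  define \<rho> where "\<rho> = q / (p + q)"
  have \<rho>: "0 < \<rho>" "\<rho> < 1" "1 - \<rho> = p / (p + q)" using pq by (auto simp: \<rho>_def field_simps)
  have "\<rho> * (1 - \<rho>) = p * q / (p + q)\<^sup>2" unfolding \<rho>(3) by (simp add: \<rho>_def power2_eq_square)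
  then have sq: "sqrt (\<rho> * (1 - \<rho>)) = sqrt (p * q) / (p + q)" using pq by (simp add: real_sqrt_divide)
  have "cmod (2 * sqrt (\<rho> * (1 - \<rho>)) * off_form l A a b) < \<rho> * p + (1 - \<rho>) * q"
    using low[of \<rho>] \<rho>(1,2) m by (simp add: p_def q_def)
  also have "\<rho> * p + (1 - \<rho>) * q = 2 * (p * q / (p + q))" unfolding \<rho>(3) by (simp add: \<rho>_def)
  finally have "2 * (sqrt (p * q) / (p + q) * cmod (off_form l A a b)) < 2 * (p * q / (p + q))"
    unfolding sq norm_mult norm_of_real using pq by simp
  then have "sqrt (p * q) * cmod (off_form l A a b) / (p + q) < p * q / (p + q)" by simp
  then have "sqrt (p * q) * cmod (off_form l A a b) < p * q"
    using pq by (subst (asm) divide_less_cancel) auto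
  also have "p * q = sqrt (p * q) * sqrt (p * q)" using pq by simp
  finally have "cmod (off_form l A a b) < sqrt (p * q)"
    by (rule mult_left_less_imp_less) (use pq in simp)
  then have "(cmod (off_form l A a b))\<^sup>2 < (sqrt (p * q))\<^sup>2" by (intro power_strict_mono) auto
  then show "(cmod (off_form l A a b))\<^sup>2 < diag_form l A a * diag_form l A b"
    using pq by (simp add: p_def q_def)
qed

lemma diag_form_phase: "cmod \<omega> = 1 \<Longrightarrow> diag_form l (A ** phase_mat b \<omega>) a = diag_form l A a"
  by (simp add: diag_form_def mult_phase_mat norm_mult)

lemma off_form_phase: "a \<noteq> b \<Longrightarrow> off_form l (A ** phase_mat b \<omega>) a b = \<omega> * off_form l A a b"
  by (simp add: off_form_def mult_phase_mat sum_distrib_left ac_simps)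

text \<open>The average of \<open>ln (qform l A (mix_vec a b \<rho> \<omega>))\<close> over the
  phase \<open>\<omega>\<close>.\<close>

definition form_log :: "'n::finite rvec \<Rightarrow> 'n cmat \<Rightarrow> 'n \<Rightarrow> 'n \<Rightarrow> real \<Rightarrow> real" where
  "form_log l A a b \<rho> = circle_log (diag_form l A a) (diag_form l A b) ((cmod (off_form l A a b))\<^sup>2) \<rho>"

definition form_slope :: "'n::finite rvec \<Rightarrow> 'n cmat \<Rightarrow> 'n \<Rightarrow> 'n \<Rightarrow> real \<Rightarrow> real" where
  "form_slope l A a b \<rho> = circle_slope (diag_form l A a) (diag_form l A b) ((cmod (off_form l A a b))\<^sup>2) \<rho>"

lemma abs_form_log_le:
  fixes l :: "'n::finite rvec"
  assumes "unitary A" "a \<noteq> b" "0 < \<rho>" "\<rho> < 1"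
  shows "\<bar>form_log l A a b \<rho>\<bar> \<le> one_norm l + ln 2"
proof -
  let ?s = "\<Sum>i\<in>UNIV. \<bar>l $ i\<bar>"
  let ?x = "\<rho> * diag_form l A a + (1 - \<rho>) * diag_form l A b"
  have "exp (- ?s) \<le> ?x - cmod (2 * sqrt (\<rho> * (1 - \<rho>)) * off_form l A a b)"
    using form_bounds(4)[OF assms(1,2), of \<rho> l] assms by simp
  moreover have "0 \<le> cmod (2 * sqrt (\<rho> * (1 - \<rho>)) * off_form l A a b)" by (rule norm_ge_zero)
  ultimately have lo: "exp (- ?s) \<le> ?x" by linarith
  have "?x \<le> \<rho> * exp ?s + (1 - \<rho>) * exp ?s"
    using assms form_bounds(2)[OF assms(1,2), of l] form_bounds(2)[OF assms(1) assms(2)[symmetric], of l]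
    by (intro add_mono mult_left_mono) auto
  also have "\<dots> = exp ?s" by (simp add: algebra_simps)
  finally have hi: "?x \<le> exp ?s" .
  have pos: "0 < ?x" using lo exp_gt_zero less_le_trans by blast
  have "ln (exp (- ?s) / 2) \<le> ln (?x / 2)" "ln ?x \<le> ln (exp ?s)"
    using lo hi pos by (auto intro!: ln_le_cancel_iff[THEN iffD2] simp del: ln_exp)
  moreover have "ln (exp (- ?s) / 2) = - ?s - ln 2" by (simp add: ln_div)
  moreover have "ln (?x / 2) \<le> form_log l A a b \<rho>" "form_log l A a b \<rho> \<le> ln ?x"
    unfolding form_log_def using assms
    by (intro circle_log_bounds form_bounds(3)[OF assms(1,2)] form_bounds(3)[OF assms(1) assms(2)[symmetric]] form_bounds(5); simp)+
  moreover have "ln (exp ?s) = ?s" by simp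
  moreover have "0 < ln (2::real)" by simp
  ultimately show ?thesis by linarith
qed

lemma abs_form_slope_le:
  assumes "unitary A" "a \<noteq> b" "0 < \<rho>" "\<rho> < 1"
  shows "\<bar>form_slope l A a b \<rho>\<bar> \<le> 1"
  unfolding form_slope_def using assms by (intro abs_circle_slope_le less_imp_le form_bounds)

lemma form_log_deriv:
  assumes "unitary A" "a \<noteq> b" "0 < \<rho>" "\<rho> < 1"
  shows "((\<lambda>\<rho>. form_log l A a b \<rho>) has_real_derivative (1 - 2 * \<rho> + form_slope l A a b \<rho>) / (2 * \<rho> * (1 - \<rho>))) (at \<rho>)"
  unfolding form_slope_def form_log_def using assms
  by (intro circle_log_deriv form_bounds) auto

context haar_measure
begin

lemma diag_form_measurable [measurable]: "(\<lambda>A. diag_form l A a) \<in> borel_measurable H"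
  unfolding diag_form_def by measurable

lemma off_form_measurable [measurable]: "(\<lambda>A. off_form l A a b) \<in> borel_measurable H"
proof -
  have [measurable]: "cnj \<in> borel_measurable borel"
    by (rule borel_measurable_continuous_onI) (intro continuous_intros)
  show ?thesis unfolding off_form_def by measurable
qed

lemma form_log_measurable [measurable]: "(\<lambda>A. form_log l A a b \<rho>) \<in> borel_measurable H"
  unfolding form_log_def circle_log_def circle_disc_def by measurable

lemma form_slope_measurable [measurable]: "(\<lambda>A. form_slope l A a b \<rho>) \<in> borel_measurable H"
  unfolding form_slope_def circle_slope_def circle_disc_def by measurable

lemma integrable_mult_bounded:
  fixes f g :: "'n cmat \<Rightarrow> real"
  assumes "integrable H f" "g \<in> borel_measurable H" "\<And>A. unitary A \<Longrightarrow> \<bar>g A\<bar> \<le> C"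
  shows "integrable H (\<lambda>A. f A * g A)"
proof (rule Bochner_Integration.integrable_bound)
  show "integrable H (\<lambda>A. C * f A)" using assms by simp
  show "(\<lambda>A. f A * g A) \<in> borel_measurable H" using assms by (intro borel_measurable_times) auto
  show "AE A in H. norm (f A * g A) \<le> norm (C * f A)"
  proof (intro AE_I2)
    fix A assume "A \<in> space H"
    then have "\<bar>g A\<bar> \<le> C" using assms(3) by (simp add: space_H)
    then have "\<bar>f A\<bar> * \<bar>g A\<bar> \<le> \<bar>f A\<bar> * \<bar>C\<bar>" by (intro mult_left_mono) auto
    then show "norm (f A * g A) \<le> norm (C * f A)" by (simp add: abs_mult mult.commute)
  qed
qed

lemma integrable_form_log:
  assumes "integrable H f" "a \<noteq> b" "0 < \<rho>" "\<rho> < 1"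
  shows "integrable H (\<lambda>A. f A * form_log l A a b \<rho>)"
  by (rule integrable_mult_bounded[OF assms(1) _ abs_form_log_le[OF _ assms(2-4)]]) measurable

text \<open>The form is \<open>K * (cmod (1 - z))^2\<close>, where \<open>K\<close> does not change
  with the phase and \<open>z\<close> rotates with it inside the unit disc. Comparing coefficients
  forces \<open>z = - d / (2 * K)\<close> and \<open>K^2 - x * K + (cmod d)^2 / 4 = 0\<close>; the
  larger root is the argument of the logarithm in \<open>circle_log\<close>. The factor
  \<open>ln (cmod (1 - z))\<close> averages to 0 by \<open>phase_average_zero\<close>.\<close>

lemma qform_phase_average:
  fixes f :: "'n cmat \<Rightarrow> real"
  assumes f: "integrable H f"
    and f_inv: "\<And>A \<omega>. unitary A \<Longrightarrow> cmod \<omega> = 1 \<Longrightarrow> f (A ** phase_mat b \<omega>) = f A"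
    and ab: "a \<noteq> b" and \<rho>: "0 < \<rho>" "\<rho> < 1"
  shows "(\<integral>A. f A * ln (qform l A (mix_vec a b \<rho> 1)) \<partial>H) = (\<integral>A. f A * form_log l A a b \<rho> \<partial>H)"
proof -
  define x where "x A = \<rho> * diag_form l A a + (1 - \<rho>) * diag_form l A b" for A
  define d where "d A = complex_of_real (2 * sqrt (\<rho> * (1 - \<rho>))) * off_form l A a b" for A
  define K where "K A = (x A + sqrt (circle_disc (diag_form l A a) (diag_form l A b) ((cmod (off_form l A a b))\<^sup>2) \<rho>)) / 2" for A
  define z where "z A = - d A / complex_of_real (2 * K A)" for A
  define m M where "m = exp (- one_norm l)" and "M = exp (one_norm l)"
  have mM: "0 < m" "0 < M" by (auto simp: m_def M_def)
  have [measurable]: "x \<in> borel_measurable H" "d \<in> borel_measurable H"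
    unfolding x_def[abs_def] d_def[abs_def] by measurable
  have [measurable]: "K \<in> borel_measurable H" unfolding K_def[abs_def] circle_disc_def by measurable
  have [measurable]: "z \<in> borel_measurable H" unfolding z_def[abs_def] by measurable
  have disc: "circle_disc (diag_form l A a) (diag_form l A b) ((cmod (off_form l A a b))\<^sup>2) \<rho> = (x A)\<^sup>2 - (cmod (d A))\<^sup>2" for A
    using \<rho> by (simp add: circle_disc_def x_def d_def norm_mult power_mult_distrib)
  have dx: "cmod (d A) \<le> x A - m" "x A \<le> M" if "unitary A" for A
  proof -
    show "cmod (d A) \<le> x A - m"
      using form_bounds(4)[OF that ab, of \<rho> l] \<rho> unfolding x_def d_def m_def by linarith
    have "x A \<le> \<rho> * M + (1 - \<rho>) * M"
      using \<rho> form_bounds(2)[OF that ab, of l] form_bounds(2)[OF that ab[symmetric], of l]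
      unfolding x_def M_def by (intro add_mono mult_left_mono) auto
    then show "x A \<le> M" by (simp add: algebra_simps)
  qed
  have K: "x A \<le> 2 * K A" "0 < K A" "K A * K A - x A * K A + (cmod (d A))\<^sup>2 / 4 = 0" if "unitary A" for A
  proof -
    have c: "cmod (d A) \<le> x A - m" using dx[OF that] by simp
    then have x0: "0 < x A" using mM norm_ge_zero[of "d A"] by linarith
    have "(cmod (d A))\<^sup>2 \<le> (x A)\<^sup>2" using c mM by (intro power_mono) auto
    then have s: "0 \<le> sqrt ((x A)\<^sup>2 - (cmod (d A))\<^sup>2)" "(sqrt ((x A)\<^sup>2 - (cmod (d A))\<^sup>2))\<^sup>2 = (x A)\<^sup>2 - (cmod (d A))\<^sup>2"
      by auto
    show "x A \<le> 2 * K A" using s by (simp add: K_def disc)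
    then show "0 < K A" using x0 by simp
    have "sqrt ((x A)\<^sup>2 - (cmod (d A))\<^sup>2) = 2 * K A - x A" by (simp add: K_def disc field_simps)
    then have "(2 * K A - x A)\<^sup>2 = (x A)\<^sup>2 - (cmod (d A))\<^sup>2" using s(2) by simp
    then show "K A * K A - x A * K A + (cmod (d A))\<^sup>2 / 4 = 0"
      by (simp add: power2_eq_square algebra_simps)
  qed
  \<comment> \<open>\<open>cmod (d A)\<close> falls short of \<open>x A\<close> by at least
    \<open>m\<close>, and \<open>x A\<close> is at most \<open>M\<close>; this keeps
    \<open>z\<close> uniformly away from the unit circle.\<close>
  have z: "cmod (z A) \<le> 1 - m / M" if "unitary A" for A
  proof -
    have c: "cmod (d A) \<le> x A - m" "x A \<le> M" using dx[OF that] by auto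
    then have x0: "0 < x A" using mM norm_ge_zero[of "d A"] by linarith
    have "cmod (z A) = cmod (d A) / (2 * K A)" using K(2)[OF that] by (simp add: z_def norm_divide)
    also have "\<dots> \<le> cmod (d A) / x A" using K(1)[OF that] x0 by (intro divide_left_mono) auto
    also have "\<dots> \<le> (x A - m) / x A" using c x0 by (intro divide_right_mono) auto
    also have "\<dots> = 1 - m / x A" using x0 by (simp add: diff_divide_distrib)
    also have "\<dots> \<le> 1 - m / M" using c x0 mM by (intro diff_left_mono divide_left_mono) auto
    finally show ?thesis .
  qed
  have rot: "z (A ** phase_mat b \<omega>) = \<omega> * z A" if "cmod \<omega> = 1" for A \<omega>
    using that ab by (simp add: z_def d_def K_def x_def diag_form_phase off_form_phase norm_mult)
  have zint: "integrable H (\<lambda>A. f A * ln (cmod (1 - z A)))" "(\<integral>A. f A * ln (cmod (1 - z A)) \<partial>H) = 0"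
    by (rule phase_average_zero[OF f f_inv _ rot z]; use mM in simp)+
  have "(\<integral>A. f A * ln (qform l A (mix_vec a b \<rho> 1)) \<partial>H)
     = (\<integral>A. f A * form_log l A a b \<rho> + 2 * (f A * ln (cmod (1 - z A))) \<partial>H)"
  proof (rule Bochner_Integration.integral_cong[OF refl])
    fix A assume "A \<in> space H"
    then have A: "unitary A" by (simp add: space_H)
    note KA = K[OF A]
    have "(cmod (1 - z A))\<^sup>2 = 1 - 2 * Re (z A) + (cmod (z A))\<^sup>2"
      unfolding cmod_power2 by (simp add: power2_eq_square algebra_simps)
    also have "Re (z A) = - Re (d A) / (2 * K A)" by (simp only: z_def Re_divide_of_real) simp
    also have "(cmod (z A))\<^sup>2 = (cmod (d A))\<^sup>2 / (4 * (K A)\<^sup>2)"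
      using KA(2) by (simp add: z_def norm_divide power_divide power_mult_distrib)
    finally have "(cmod (1 - z A))\<^sup>2 = 1 + Re (d A) / K A + (cmod (d A))\<^sup>2 / (4 * (K A)\<^sup>2)"
      by simp
    then have "K A * (cmod (1 - z A))\<^sup>2 = K A + Re (d A) + (cmod (d A))\<^sup>2 / 4 / K A"
      using KA(2) by (simp add: distrib_left power2_eq_square)
    also have "(cmod (d A))\<^sup>2 / 4 = (x A - K A) * K A"
      using KA(3) by (simp add: algebra_simps)
    also have "K A + Re (d A) + (x A - K A) * K A / K A = x A + Re (d A)"
      using KA(2) by simp
    also have "\<dots> = qform l A (mix_vec a b \<rho> 1)"
      using \<rho> by (simp add: qform_mix_vec x_def d_def)
    finally have q: "qform l A (mix_vec a b \<rho> 1) = K A * (cmod (1 - z A))\<^sup>2" ..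
    have "cmod (z A) < 1" using z[OF A] mM by (smt (verit) divide_pos_pos)
    then have "0 < cmod (1 - z A)" by auto
    then have "ln (qform l A (mix_vec a b \<rho> 1)) = ln (K A) + 2 * ln (cmod (1 - z A))"
      unfolding q using KA(2) by (simp add: ln_mult ln_realpow)
    moreover have "form_log l A a b \<rho> = ln (K A)"
      by (simp add: form_log_def circle_log_def K_def x_def)
    ultimately show "f A * ln (qform l A (mix_vec a b \<rho> 1)) = f A * form_log l A a b \<rho> + 2 * (f A * ln (cmod (1 - z A)))"
      by (simp add: algebra_simps)
  qed
  also have "\<dots> = (\<integral>A. f A * form_log l A a b \<rho> \<partial>H)"
    using zint integrable_form_log[OF f ab \<rho>] by simp
  finally show ?thesis .
qed

end

lemma norm_axis_one: "norm (axis a (1::complex)) = 1"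
proof -
  have "(norm (axis a (1::complex)))\<^sup>2 = (1::real)"
    using cinner_self[of "axis a 1"] unfolding cinner_axis_axis by (simp del: of_real_power)
  then show ?thesis by (smt (verit) norm_ge_zero power2_eq_1_iff)
qed

section \<open>Haar averages\<close>

definition block_invariant :: "'n::finite \<Rightarrow> 'n \<Rightarrow> ('n cmat \<Rightarrow> real) \<Rightarrow> bool" where
  "block_invariant a b f \<longleftrightarrow>
     (\<forall>A V. unitary A \<longrightarrow> unitary V \<longrightarrow> (\<forall>i. i \<noteq> a \<longrightarrow> i \<noteq> b \<longrightarrow> V *v axis i 1 = axis i 1) \<longrightarrow> f (A ** V) = f A)"

definition pair_mass :: "'n::finite \<Rightarrow> 'n \<Rightarrow> 'n \<Rightarrow> 'n cmat \<Rightarrow> real" where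
  "pair_mass j a b A = entry_mass A j a + entry_mass A j b"

lemma pair_mass_eq:
  assumes "unitary A" "a \<noteq> b"
  shows "pair_mass j a b A = 1 - (\<Sum>i\<in>UNIV - {a, b}. entry_mass A j i)"
proof -
  have "(\<Sum>i\<in>UNIV. entry_mass A j i) = (\<Sum>i\<in>UNIV - {a, b}. entry_mass A j i) + (\<Sum>i\<in>{a, b}. entry_mass A j i)"
    by (rule sum.subset_diff) auto
  then show ?thesis using unitary_row_norm[OF assms(1), of j] assms(2) by (simp add: pair_mass_def)
qed

text \<open>Row \<open>j\<close> has norm 1, so the mass in columns \<open>a\<close> and
  \<open>b\<close> is what the other columns leave over, and those columns are unchanged by a matrix
  that fixes the other basis vectors.\<close>

lemma block_invariant_pair_mass:
  assumes "a \<noteq> b" shows "block_invariant a b (\<lambda>A. g (pair_mass j a b A))"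
  unfolding block_invariant_def
proof (intro allI impI)
  fix A V :: "'a cmat"
  assume A: "unitary A" and V: "unitary V" and V_fix: "\<forall>i. i \<noteq> a \<longrightarrow> i \<noteq> b \<longrightarrow> V *v axis i 1 = axis i 1"
  have "(A ** V) $ j $ i = A $ j $ i" if "i \<noteq> a" "i \<noteq> b" for i
    using V_fix that by (metis mult_axis_nth matrix_vector_mul_assoc)
  then have "pair_mass j a b (A ** V) = pair_mass j a b A"
    using A V assms by (simp add: pair_mass_eq unitary_mult)
  then show "g (pair_mass j a b (A ** V)) = g (pair_mass j a b A)" by simp
qed

lemma block_invariant_const: "block_invariant a b (\<lambda>A. c)"
  by (simp add: block_invariant_def)

lemma column_norm:
  assumes "unitary A" shows "(\<Sum>i\<in>UNIV. entry_mass A i a) = 1"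
proof -
  have "norm (A *v axis a 1) = norm (axis a (1::complex))" by (rule unitary_norm[OF assms])
  then show ?thesis using norm_vec_square[of "A *v axis a 1"] by (simp add: mult_axis_nth norm_axis_one)
qed

lemma column_orthogonal:
  assumes "unitary A" "a \<noteq> b" shows "(\<Sum>i\<in>UNIV. cnj (A $ i $ a) * A $ i $ b) = 0"
proof -
  have "cinner (A *v axis a 1) (A *v axis b 1) = 0"
    using assms by (simp add: unitary_iff_cinner cinner_axis_axis)
  then show ?thesis by (simp add: cinner_def mult_axis_nth)
qed

lemma entry_le_1: "unitary A \<Longrightarrow> entry_mass A j a \<le> 1"
  using member_le_sum[of j UNIV "\<lambda>i. entry_mass A i a"] column_norm[of A a] by simp

lemma pair_mass_le_1: "unitary A \<Longrightarrow> a \<noteq> b \<Longrightarrow> pair_mass j a b A \<le> 1"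
  by (simp add: pair_mass_eq sum_nonneg)

text \<open>The weights \<open>ln \<epsilon>\<close> off the index \<open>j\<close> regularize \<open>|\<langle>row j, \<cdot>\<rangle>|^2\<close> to a positive definite form.\<close>

definition peak :: "'n::finite \<Rightarrow> real \<Rightarrow> 'n rvec" where
  "peak j t = (\<chi> i. if i = j then 0 else - t)"

lemma sum_peak:
  fixes f :: "'n::finite \<Rightarrow> 'b::comm_ring_1"
  shows "(\<Sum>i\<in>UNIV. (if i = j then 1 else e) * f i) = f j + e * ((\<Sum>i\<in>UNIV. f i) - f j)"
  by (simp add: sum.remove[of UNIV j] sum_distrib_left)

lemma diag_form_peak:
  assumes "unitary A"
  shows "diag_form (peak j t) A a = entry_mass A j a + exp (- t) * (1 - entry_mass A j a)"
proof -
  have "diag_form (peak j t) A a = (\<Sum>i\<in>UNIV. (if i = j then 1 else exp (- t)) * entry_mass A i a)"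
    unfolding diag_form_def peak_def by (intro sum.cong) auto
  then show ?thesis by (simp only: sum_peak column_norm[OF assms])
qed

lemma off_form_peak:
  assumes "unitary A" "a \<noteq> b"
  shows "off_form (peak j t) A a b = complex_of_real (1 - exp (- t)) * (cnj (A $ j $ a) * A $ j $ b)"
proof -
  have "off_form (peak j t) A a b = (\<Sum>i\<in>UNIV. (if i = j then 1 else complex_of_real (exp (- t))) * (cnj (A $ i $ a) * A $ i $ b))"
    unfolding off_form_def peak_def by (intro sum.cong) auto
  then show ?thesis by (simp only: sum_peak column_orthogonal[OF assms]) (simp add: algebra_simps)
qed

lemma diag_form_shift: "diag_form (\<chi> i. l $ i - c) A a = exp (- c) * diag_form l A a"
  by (simp add: diag_form_def sum_distrib_left exp_diff exp_minus field_simps)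

lemma off_form_shift: "off_form (\<chi> i. l $ i - c) A a b = complex_of_real (exp (- c)) * off_form l A a b"
  by (simp add: off_form_def sum_distrib_left exp_diff exp_minus field_simps)

lemma circle_slope_scale:
  assumes "0 < c" shows "circle_slope (c * p) (c * q) (c\<^sup>2 * r) \<rho> = circle_slope p q r \<rho>"
proof -
  have "circle_disc (c * p) (c * q) (c\<^sup>2 * r) \<rho> = c\<^sup>2 * circle_disc p q r \<rho>"
    by (simp add: circle_disc_def power2_eq_square algebra_simps)
  moreover have "\<rho> * (c * p) - (1 - \<rho>) * (c * q) = c * (\<rho> * p - (1 - \<rho>) * q)"
    by (simp add: algebra_simps)
  ultimately show ?thesis using assms by (simp add: circle_slope_def real_sqrt_mult)
qed

text \<open>Shifting all exponents by a constant multiplies \<open>P\<close> by a positive scalar,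
  and the slope is homogeneous of degree 0 in the entries. So exponents may be measured from the
  largest one.\<close>

lemma form_slope_shift: "form_slope (\<chi> i. l $ i - c) A a b \<rho> = form_slope l A a b \<rho>"
  unfolding form_slope_def diag_form_shift off_form_shift
  using circle_slope_scale[of "exp (- c)"] by (simp add: norm_mult power_mult_distrib)

section \<open>Plane rotations and the mean of the slope\<close>

context haar_measure
begin

text \<open>The reflection carrying \<open>e_a\<close> to \<open>mix_vec a b \<rho> 1\<close> fixes
  every basis vector other than \<open>e_a\<close> and \<open>e_b\<close>, so translating by it
  changes the vector inside the logarithm but not \<open>f\<close>.\<close>

lemma qform_reflection_average:
  assumes f: "integrable H f" and inv: "block_invariant a b f"
    and ab: "a \<noteq> b" and \<rho>: "0 < \<rho>" "\<rho> < 1"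
  shows "(\<integral>A. f A * ln (qform l A (mix_vec a b \<rho> 1)) \<partial>H) = (\<integral>A. f A * ln (diag_form l A a) \<partial>H)"
proof -
  have [measurable]: "f \<in> borel_measurable H" using f by simp
  have "norm (axis a (1::complex)) = norm (mix_vec a b \<rho> 1)"
    using cinner_mix_vec(2)[OF ab, of \<rho> 1] \<rho> by (simp add: norm_axis_one)
  then obtain R where R: "unitary R" "R *v axis a 1 = mix_vec a b \<rho> 1"
      "\<And>y. cinner (axis a 1 - mix_vec a b \<rho> 1) y = 0 \<Longrightarrow> R *v y = y"
    using unitary_reflection by blast
  have R_fix: "R *v axis i 1 = axis i 1" if "i \<noteq> a" "i \<noteq> b" for i
  proof (rule R(3))
    show "cinner (axis a 1 - mix_vec a b \<rho> 1) (axis i 1) = 0"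
      unfolding mix_vec_def using that
      by (simp add: cinner_diff_left cinner_add_left cinner_scale_left cinner_axis_axis)
  qed
  have "(\<integral>A. f A * ln (diag_form l A a) \<partial>H) = (\<integral>A. f (A ** R) * ln (diag_form l (A ** R) a) \<partial>H)"
    by (rule integral_translate[symmetric, OF R(1)]) measurable
  also have "\<dots> = (\<integral>A. f A * ln (qform l A (mix_vec a b \<rho> 1)) \<partial>H)"
    using inv R_fix R
    by (intro Bochner_Integration.integral_cong) (auto simp: space_H block_invariant_def diag_form_qform qform_mult)
  finally show ?thesis ..
qed

text \<open>The mean of \<open>f A * ln (qform l A (mix_vec a b \<rho> 1))\<close> is evaluated in
  two ways, by the average over a relative phase and by a rotation of the plane. The second value is
  free of \<open>\<rho>\<close>, which is the point.\<close>

lemma form_log_average: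
  assumes f: "integrable H f" and inv: "block_invariant a b f"
    and ab: "a \<noteq> b" and \<rho>: "0 < \<rho>" "\<rho> < 1"
  shows "(\<integral>A. f A * form_log l A a b \<rho> \<partial>H) = (\<integral>A. f A * ln (diag_form l A a) \<partial>H)"
proof -
  have "f (A ** phase_mat b \<omega>) = f A" if "unitary A" "cmod \<omega> = 1" for A \<omega>
    using inv that by (simp add: block_invariant_def unitary_phase_mat phase_mat_axis)
  from qform_phase_average[OF f this ab \<rho>] qform_reflection_average[OF f inv ab \<rho>] show ?thesis by simp
qed

text \<open>The interval reaches half-way from \<open>\<rho>\<close> to 0 and to 1, so
  \<open>y\<close> and \<open>1 - y\<close> keep at least half of \<open>\<rho>\<close> and
  \<open>1 - \<rho>\<close>. It is the neighbourhood on which one function dominates all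
  derivatives.\<close>

lemma slope_factor_bound:
  fixes \<rho> y :: real
  assumes \<rho>: "0 < \<rho>" "\<rho> < 1" and y: "\<rho> / 2 < y" "y < (1 + \<rho>) / 2"
  shows "1 / (y * (1 - y)) \<le> 4 / (\<rho> * (1 - \<rho>))"
proof -
  have "\<rho> * (1 - \<rho>) / 4 \<le> y * (1 - y)"
    using mult_mono[of "\<rho> / 2" y "(1 - \<rho>) / 2" "1 - y"] y \<rho> by simp
  then have "1 / (y * (1 - y)) \<le> 1 / (\<rho> * (1 - \<rho>) / 4)"
    using \<rho> y by (intro divide_left_mono mult_pos_pos) auto
  then show ?thesis by simp
qed

lemma form_log_integral_deriv:
  assumes f: "integrable H f" and ab: "a \<noteq> b" and \<rho>: "0 < \<rho>" "\<rho> < 1"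
  shows "((\<lambda>y. \<integral>A. f A * form_log l A a b y \<partial>H) has_real_derivative
      (\<integral>A. f A * ((1 - 2 * \<rho> + form_slope l A a b \<rho>) / (2 * \<rho> * (1 - \<rho>))) \<partial>H)) (at \<rho>)"
proof (rule has_derivative_integral_dominated[where a = "\<rho> / 2" and b = "(1 + \<rho>) / 2" and G = "\<lambda>A. \<bar>f A\<bar> * (4 / (\<rho> * (1 - \<rho>)))"])
  have [measurable]: "f \<in> borel_measurable H" using f by simp
  show "(\<lambda>A. f A * ((1 - 2 * \<rho> + form_slope l A a b \<rho>) / (2 * \<rho> * (1 - \<rho>)))) \<in> borel_measurable H" by measurable
  fix y assume y: "\<rho> / 2 < y" "y < (1 + \<rho>) / 2"
  then have y01: "0 < y" "y < 1" using \<rho> by auto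
  show "integrable H (\<lambda>A. f A * form_log l A a b y)"
    by (rule integrable_form_log[OF f ab y01])
  fix A assume "A \<in> space H"
  then have A: "unitary A" by (simp add: space_H)
  show "((\<lambda>y. f A * form_log l A a b y) has_real_derivative f A * ((1 - 2 * y + form_slope l A a b y) / (2 * y * (1 - y)))) (at y)"
    by (intro DERIV_cmult form_log_deriv A ab y01)
  have "\<bar>1 - 2 * y + form_slope l A a b y\<bar> \<le> 2"
    using abs_form_slope_le[OF A ab y01, of l] y01 by (simp add: abs_le_iff)
  then have "\<bar>1 - 2 * y + form_slope l A a b y\<bar> / (2 * (y * (1 - y))) \<le> 2 / (2 * (y * (1 - y)))"
    using y01 by (intro divide_right_mono) auto
  then have "\<bar>(1 - 2 * y + form_slope l A a b y) / (2 * y * (1 - y))\<bar> \<le> 1 / (y * (1 - y))"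
    using y01 by (simp add: abs_divide abs_mult mult.assoc)
  also have "\<dots> \<le> 4 / (\<rho> * (1 - \<rho>))" by (rule slope_factor_bound[OF \<rho> y])
  finally show "\<bar>f A * ((1 - 2 * y + form_slope l A a b y) / (2 * y * (1 - y)))\<bar> \<le> \<bar>f A\<bar> * (4 / (\<rho> * (1 - \<rho>)))"
    unfolding abs_mult by (intro mult_left_mono) auto
qed (use \<rho> f in auto)

text \<open>Differentiate \<open>form_log_average\<close>, whose right side is constant in
  \<open>\<rho>\<close>: the factor \<open>1 - 2 * \<rho> + form_slope l A a b \<rho>\<close> has
  mean 0 against \<open>f\<close>.\<close>

lemma form_slope_average:
  assumes f: "integrable H f" and inv: "block_invariant a b f"
    and ab: "a \<noteq> b" and \<rho>: "0 < \<rho>" "\<rho> < 1"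
  shows "(\<integral>A. f A * form_slope l A a b \<rho> \<partial>H) = (2 * \<rho> - 1) * (\<integral>A. f A \<partial>H)"
proof -
  have [measurable]: "f \<in> borel_measurable H" using f by simp
  let ?F' = "\<lambda>y A. f A * ((1 - 2 * y + form_slope l A a b y) / (2 * y * (1 - y)))"
  have 1: "((\<lambda>y. \<integral>A. f A * form_log l A a b y \<partial>H) has_real_derivative (\<integral>A. ?F' \<rho> A \<partial>H)) (at \<rho>)"
    by (rule form_log_integral_deriv[OF f ab \<rho>])
  have "((\<lambda>y. \<integral>A. f A * form_log l A a b y \<partial>H) has_real_derivative 0) (at \<rho>)"
  proof (rule has_field_derivative_transform_within_open[where S = "{0<..<1}"])
    show "((\<lambda>y. \<integral>A. f A * ln (diag_form l A a) \<partial>H) has_real_derivative 0) (at \<rho>)" by simp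
    fix y :: real assume "y \<in> {0<..<1}"
    then show "(\<integral>A. f A * ln (diag_form l A a) \<partial>H) = (\<integral>A. f A * form_log l A a b y \<partial>H)"
      by (intro form_log_average[OF f inv ab, symmetric]) auto
  qed (use \<rho> in auto)
  with 1 have "(\<integral>A. ?F' \<rho> A \<partial>H) = 0" by (rule DERIV_unique)
  moreover have int: "integrable H (\<lambda>A. f A * form_slope l A a b \<rho>)"
    by (rule integrable_mult_bounded[OF f _ abs_form_slope_le[OF _ ab \<rho>]]) measurable
  have "(\<integral>A. ?F' \<rho> A \<partial>H) = (\<integral>A. ((1 - 2 * \<rho>) * f A + f A * form_slope l A a b \<rho>) / (2 * \<rho> * (1 - \<rho>)) \<partial>H)"
    by (intro Bochner_Integration.integral_cong) (auto simp: algebra_simps)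
  also have "\<dots> = ((1 - 2 * \<rho>) * (\<integral>A. f A \<partial>H) + (\<integral>A. f A * form_slope l A a b \<rho> \<partial>H)) / (2 * \<rho> * (1 - \<rho>))"
    using f int by simp
  ultimately show ?thesis using \<rho> by (simp add: algebra_simps)
qed

lemma pair_mass_measurable [measurable]: "pair_mass j a b \<in> borel_measurable H"
  unfolding pair_mass_def[abs_def] by measurable

text \<open>
  Where the pair mass is at least \<open>1/N\<close>, the phase average at \<open>\<rho> = 1/2\<close> bounds the mean of the regularized
  logarithm from below uniformly in the regularization, which Fatou's lemma then removes.
\<close>

lemma entry_nonzero_aux:
  fixes j :: 'n
  assumes ab: "a \<noteq> b"
  defines "c \<equiv> 1 / real CARD('n)"
  defines "g \<equiv> \<lambda>A. if c \<le> pair_mass j a b A then 1 else 0 :: real"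
  shows "AE A in H. c \<le> pair_mass j a b A \<longrightarrow> A $ j $ a \<noteq> 0"
    and "integrable H (\<lambda>A. g A * ln (entry_mass A j a))"
proof -
  have c: "0 < c" by (simp add: c_def)
  have [measurable]: "g \<in> borel_measurable H" unfolding g_def by measurable
  have g: "integrable H g"
    by (rule integrable_const_bound[where B = 1]) (auto simp: g_def)
  have g_inv: "block_invariant a b g"
    unfolding g_def by (rule block_invariant_pair_mass[OF ab, of "\<lambda>x. if c \<le> x then 1 else 0"])
  define X where "X A = entry_mass A j a" for A :: "'n cmat"
  have [measurable]: "X \<in> borel_measurable H" unfolding X_def[abs_def] by measurable
  define p where "p n A = diag_form (peak j (real n)) A a" for n A
  have [measurable]: "p n \<in> borel_measurable H" for n unfolding p_def[abs_def] by measurable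
  have p: "p n A = X A + exp (- real n) * (1 - X A)" if "unitary A" for n A
    using diag_form_peak[OF that] by (simp add: p_def X_def)
  have X: "0 \<le> X A" "X A \<le> 1" if "unitary A" for A
    using entry_le_1[OF that] by (auto simp: X_def)
  have p01: "0 < p n A" "p n A \<le> 1" if A: "unitary A" for n A
  proof -
    show "0 < p n A" unfolding p_def by (rule form_bounds(3)[OF A ab])
    have "exp (- real n) * (1 - X A) \<le> 1 * (1 - X A)" using X[OF A] by (intro mult_right_mono) auto
    then show "p n A \<le> 1" using p[OF A, of n] by simp
  qed
  have bound: "(\<integral>A. g A * (- ln (p n A)) \<partial>H) \<le> - ln (c / 4)" for n
  proof -
    have "(\<integral>A. g A * ln (p n A) \<partial>H) = (\<integral>A. g A * form_log (peak j (real n)) A a b (1/2) \<partial>H)"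
      using form_log_average[OF g g_inv ab, of "1/2"] by (simp add: p_def)
    moreover have "(\<integral>A. ln (c / 4) * 1 \<partial>H) \<le> (\<integral>A. g A * form_log (peak j (real n)) A a b (1/2) \<partial>H)"
    proof (rule integral_mono)
      show "integrable H (\<lambda>A. g A * form_log (peak j (real n)) A a b (1/2))"
        by (rule integrable_form_log[OF g ab]) auto
      fix A assume "A \<in> space H"
      then have A: "unitary A" by (simp add: space_H)
      let ?q = "diag_form (peak j (real n)) A b"
      \<comment> \<open>For \<open>\<rho> = 1/2\<close> the lower bound is
        \<open>ln ((p + q) / 4)\<close>, and \<open>p + q\<close> is at least the pair mass. Hence
        the constant \<open>c / 4\<close>, from which the regularization has disappeared.\<close>
      have lo: "ln ((p n A + ?q) / 4) \<le> form_log (peak j (real n)) A a b (1/2)"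
        using circle_log_bounds(1)[OF _ _ _ form_bounds(5)[OF A ab] form_bounds(3)[OF A ab] form_bounds(3)[OF A ab[symmetric]], of "1/2" "peak j (real n)"]
        by (simp add: form_log_def p_def field_simps)
      have "X A \<le> p n A" using p[OF A, of n] X[OF A] by simp
      moreover have "entry_mass A j b \<le> ?q" using diag_form_peak[OF A, of j "real n" b] entry_le_1[OF A, of j b] by simp
      ultimately have pm: "pair_mass j a b A \<le> p n A + ?q" by (simp add: pair_mass_def X_def)
      have "c \<le> 1" by (simp add: c_def)
      then have neg: "ln (c / 4) \<le> 0" using c by simp
      show "ln (c / 4) * 1 \<le> g A * form_log (peak j (real n)) A a b (1/2)"
      proof (cases "c \<le> pair_mass j a b A")
        case True
        then have "ln (c / 4) \<le> ln ((p n A + ?q) / 4)" using pm c by (intro ln_mono) auto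
        then show ?thesis using lo True by (simp add: g_def)
      qed (use neg in \<open>simp add: g_def\<close>)
    qed simp
    ultimately show ?thesis by (simp add: prob_space)
  qed
  \<comment> \<open>Since \<open>ln 0 = 0\<close> in HOL, the value infinity has to be put in by
    hand where \<open>X\<close> vanishes. Finiteness of the integral of \<open>G\<close> then shows
    that this happens only on a null set.\<close>
  define G where "G A = (if c \<le> pair_mass j a b A then if X A = 0 then \<infinity> else ennreal (- ln (X A)) else 0)" for A
  have [measurable]: "G \<in> borel_measurable H" unfolding G_def[abs_def] by measurable
  have lim: "(\<lambda>n. ennreal (g A * (- ln (p n A)))) \<longlonglongrightarrow> G A" if A: "unitary A" for A
  proof (cases "c \<le> pair_mass j a b A \<and> X A = 0")
    case True
    \<comment> \<open>Where \<open>X A = 0\<close> only the regularizing term is left,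
      \<open>p n A = exp (- real n)\<close>.\<close>
    then have "g A * (- ln (p n A)) = real n" for n using p[OF A] by (simp add: g_def)
    moreover have "(\<lambda>n. ennreal (real n)) \<longlonglongrightarrow> \<infinity>"
      by (simp add: ennreal_of_nat_eq_real_of_nat[symmetric] of_nat_tendsto_top_ennreal)
    ultimately show ?thesis using True by (simp add: G_def)
  next
    case False
    show ?thesis
    proof (cases "c \<le> pair_mass j a b A")
      case True
      then have "X A \<noteq> 0" using False by simp
      have "(\<lambda>n. exp (- real n)) \<longlonglongrightarrow> 0" by real_asymp
      then have "(\<lambda>n. X A + exp (- real n) * (1 - X A)) \<longlonglongrightarrow> X A + 0 * (1 - X A)" by (intro tendsto_intros)
      then have "(\<lambda>n. p n A) \<longlonglongrightarrow> X A" using p[OF A] by simp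
      then have "(\<lambda>n. ennreal (- ln (p n A))) \<longlonglongrightarrow> ennreal (- ln (X A))"
        using \<open>X A \<noteq> 0\<close> by (intro tendsto_ennrealI tendsto_minus tendsto_ln)
      then show ?thesis using True \<open>X A \<noteq> 0\<close> by (simp add: G_def g_def)
    qed (simp add: G_def g_def)
  qed
  have "(\<integral>\<^sup>+A. G A \<partial>H) = (\<integral>\<^sup>+A. liminf (\<lambda>n. ennreal (g A * (- ln (p n A)))) \<partial>H)"
    using lim by (intro nn_integral_cong) (auto simp: space_H intro!: lim_imp_Liminf[symmetric])
  also have "\<dots> \<le> liminf (\<lambda>n. \<integral>\<^sup>+A. ennreal (g A * (- ln (p n A))) \<partial>H)"
    by (rule nn_integral_liminf) measurable
  also have "\<dots> \<le> ennreal (- ln (c / 4))"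
  proof -
    have "(\<integral>\<^sup>+A. ennreal (g A * (- ln (p n A))) \<partial>H) \<le> ennreal (- ln (c / 4))" for n
    proof -
      have int: "integrable H (\<lambda>A. g A * (- ln (p n A)))"
      proof (rule integrable_mult_bounded[OF g])
        show "\<bar>- ln (p n A)\<bar> \<le> (\<Sum>i\<in>UNIV. \<bar>peak j (real n) $ i\<bar>)" if "unitary A" for A
          using abs_ln_qform[OF that norm_axis_one] by (simp add: p_def diag_form_qform)
      qed measurable
      have "(\<integral>\<^sup>+A. ennreal (g A * (- ln (p n A))) \<partial>H) = ennreal (\<integral>A. g A * (- ln (p n A)) \<partial>H)"
        using int by (rule nn_integral_eq_integral) (use p01 in \<open>auto simp: space_H g_def intro!: AE_I2\<close>)
      then show ?thesis using bound[of n] by (simp add: ennreal_leI)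
    qed
    then show ?thesis by (intro Liminf_le) auto
  qed
  finally have fin: "(\<integral>\<^sup>+A. G A \<partial>H) < \<infinity>" by (simp add: order_le_less_trans)
  then have "AE A in H. G A \<noteq> \<infinity>" by (intro nn_integral_PInf_AE) auto
  then show ae: "AE A in H. c \<le> pair_mass j a b A \<longrightarrow> A $ j $ a \<noteq> 0"
    by eventually_elim (auto simp: G_def X_def split: if_splits)
  show "integrable H (\<lambda>A. g A * ln (entry_mass A j a))"
  proof (rule integrableI_bounded)
    have "(\<integral>\<^sup>+A. ennreal (norm (g A * ln (entry_mass A j a))) \<partial>H) \<le> (\<integral>\<^sup>+A. G A \<partial>H)"
    proof (rule nn_integral_mono)
      fix A assume "A \<in> space H"
      then have A: "unitary A" by (simp add: space_H)
      have "\<bar>ln (X A)\<bar> = - ln (X A)" using X[OF A] by (cases "X A = 0") auto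
      then show "ennreal (norm (g A * ln (entry_mass A j a))) \<le> G A"
        by (auto simp: g_def G_def X_def[symmetric])
    qed
    then show "(\<integral>\<^sup>+A. ennreal (norm (g A * ln (entry_mass A j a))) \<partial>H) < \<infinity>"
      using fin by (rule order_le_less_trans)
  qed measurable
qed

section \<open>Nonvanishing of the entries and integrability of their logarithms\<close>

lemma large_entry:
  assumes "unitary (A :: 'n cmat)" obtains b where "1 / real CARD('n) \<le> entry_mass A j b"
proof (rule ccontr)
  assume "\<not> thesis"
  then have "entry_mass A j b < 1 / real CARD('n)" for b using that not_le by blast
  then have "(\<Sum>b\<in>UNIV. entry_mass A j b) < (\<Sum>b\<in>(UNIV::'n set). 1 / real CARD('n))"
    by (intro sum_strict_mono) auto
  then show False using unitary_row_norm[OF assms, of j] by simp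
qed

text \<open>By pigeonhole some entry of row \<open>j\<close> has mass at least \<open>1/N\<close>.
  If it is not the entry at \<open>a\<close> itself, it forms a heavy pair with \<open>a\<close>,
  and \<open>entry_nonzero_aux\<close> applies to each of the finitely many pairs.\<close>

lemma entry_nonzero: "AE A in H. A $ j $ a \<noteq> 0"
proof -
  have "AE A in H. \<forall>b. a \<noteq> b \<longrightarrow> 1 / real CARD('n) \<le> pair_mass j a b A \<longrightarrow> A $ j $ a \<noteq> 0"
    using entry_nonzero_aux(1) by (subst AE_all_countable) (auto intro!: AE_I2)
  then show ?thesis
  proof (rule AE_mp, intro AE_I2 impI)
    fix A assume "A \<in> space H" and *: "\<forall>b. a \<noteq> b \<longrightarrow> 1 / real CARD('n) \<le> pair_mass j a b A \<longrightarrow> A $ j $ a \<noteq> 0"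
    then have A: "unitary A" by (simp add: space_H)
    obtain b where b: "1 / real CARD('n) \<le> entry_mass A j b" by (rule large_entry[OF A])
    show "A $ j $ a \<noteq> 0"
    proof (cases "a = b")
      case True
      then show ?thesis using b by (auto simp: field_simps)
    next
      case False
      have "1 / real CARD('n) \<le> pair_mass j a b A" using b by (simp add: pair_mass_def add_increasing)
      then show ?thesis using False * by blast
    qed
  qed
qed

text \<open>The same dichotomy as in \<open>entry_nonzero\<close>: either the entry at
  \<open>a\<close> is heavy and \<open>- ln c\<close> bounds the logarithm, or some column
  \<open>b\<close> forms a heavy pair with \<open>a\<close>, and the truncated logarithm for that
  pair is one of the integrable summands of the majorant.\<close>

lemma integrable_ln_entry: "integrable H (\<lambda>A. ln (entry_mass A j a))"
proof -
  define c where "c = 1 / real CARD('n)"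
  define g where "g b A = (if c \<le> pair_mass j a b A then 1 else 0 :: real)" for b A
  have c: "0 < c" by (simp add: c_def)
  have [measurable]: "g b \<in> borel_measurable H" for b unfolding g_def by measurable
  let ?L = "\<lambda>A :: 'n cmat. ln (entry_mass A j a)"
  show ?thesis
  proof (rule Bochner_Integration.integrable_bound)
    show "integrable H (\<lambda>A. - ln c + (\<Sum>b\<in>UNIV - {a}. \<bar>g b A * ?L A\<bar>))"
      using entry_nonzero_aux(2)[of a _ j] unfolding g_def c_def
      by (intro Bochner_Integration.integrable_add Bochner_Integration.integrable_sum integrable_abs) auto
    show "AE A in H. norm (?L A) \<le> norm (- ln c + (\<Sum>b\<in>UNIV - {a}. \<bar>g b A * ?L A\<bar>))"
    proof (intro AE_I2)
      fix A assume "A \<in> space H"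
      then have A: "unitary A" by (simp add: space_H)
      have "c \<le> 1" by (simp add: c_def)
      then have lc: "0 \<le> - ln c" using c by simp
      obtain b where b: "c \<le> entry_mass A j b" using large_entry[OF A] by (metis c_def)
      have s0: "0 \<le> (\<Sum>b\<in>UNIV - {a}. \<bar>g b A * ?L A\<bar>)" by (rule sum_nonneg) auto
      have "\<bar>?L A\<bar> \<le> - ln c + (\<Sum>b\<in>UNIV - {a}. \<bar>g b A * ?L A\<bar>)"
      proof (cases "a = b")
        case True
        then have "0 < entry_mass A j a" using less_le_trans[OF c b] by (simp only:)
        then have "?L A \<le> 0" using entry_le_1[OF A, of j a] by (rule ln_le_zero_iff[THEN iffD2])
        moreover have "ln c \<le> ?L A" using True b c by (auto intro: ln_mono)
        ultimately show ?thesis using s0 by (simp add: abs_if)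
      next
        case False
        have "g b A = 1" using b by (simp add: g_def pair_mass_def add_increasing)
        then have "\<bar>?L A\<bar> = \<bar>g b A * ?L A\<bar>" by simp
        also have "\<dots> \<le> (\<Sum>b\<in>UNIV - {a}. \<bar>g b A * ?L A\<bar>)"
          using False by (intro member_le_sum) auto
        finally show ?thesis using lc by simp
      qed
      then show "norm (?L A) \<le> norm (- ln c + (\<Sum>b\<in>UNIV - {a}. \<bar>g b A * ?L A\<bar>))" by simp
    qed
  qed measurable
qed

section \<open>Limits of the forms when one exponent dominates\<close>

lemma diag_form_limit:
  fixes l :: "real \<Rightarrow> 'n rvec"
  assumes gap: "\<And>i. i \<noteq> j \<Longrightarrow> filterlim (\<lambda>t. l t $ j - l t $ i) at_top at_top"
  shows "((\<lambda>t. diag_form (\<chi> i. l t $ i - l t $ j) A a) \<longlongrightarrow> entry_mass A j a) at_top"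
    "((\<lambda>t. off_form (\<chi> i. l t $ i - l t $ j) A a b) \<longlongrightarrow> cnj (A $ j $ a) * A $ j $ b) at_top"
proof -
  have e: "((\<lambda>t. exp (l t $ i - l t $ j)) \<longlongrightarrow> (if i = j then 1 else 0)) at_top" for i
  proof (cases "i = j")
    case False
    have "filterlim (\<lambda>t. - (l t $ j - l t $ i)) at_bot at_top"
      using gap[OF False] by (simp add: filterlim_uminus_at_bot)
    then have "((\<lambda>t. exp (- (l t $ j - l t $ i))) \<longlongrightarrow> 0) at_top"
      by (rule filterlim_compose[OF exp_at_bot])
    then show ?thesis using False by simp
  qed simp
  have "((\<lambda>t. diag_form (\<chi> i. l t $ i - l t $ j) A a) \<longlongrightarrow> (\<Sum>i\<in>UNIV. (if i = j then 1 else 0) * entry_mass A i a)) at_top"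
    unfolding diag_form_def by (simp del: mult_delta_left if_distrib) (intro tendsto_intros e)
  then show "((\<lambda>t. diag_form (\<chi> i. l t $ i - l t $ j) A a) \<longlongrightarrow> entry_mass A j a) at_top"
    by (simp add: if_distrib[where f = "\<lambda>x. x * _"] cong: if_cong)
  have "((\<lambda>t. off_form (\<chi> i. l t $ i - l t $ j) A a b) \<longlongrightarrow> (\<Sum>i\<in>UNIV. complex_of_real (if i = j then 1 else 0) * cnj (A $ i $ a) * A $ i $ b)) at_top"
    unfolding off_form_def vec_lambda_beta by (intro tendsto_intros e)
  also have "(\<Sum>i\<in>UNIV. complex_of_real (if i = j then 1 else 0) * cnj (A $ i $ a) * A $ i $ b) = (\<Sum>i\<in>UNIV. if i = j then cnj (A $ i $ a) * A $ i $ b else 0)"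
    by (intro sum.cong) auto
  finally show "((\<lambda>t. off_form (\<chi> i. l t $ i - l t $ j) A a b) \<longlongrightarrow> cnj (A $ j $ a) * A $ j $ b) at_top"
    by simp
qed

text \<open>Rescaled by its largest eigenvalue, \<open>P\<close> tends to a matrix of rank one,
  whose squared off-diagonal modulus equals the product of the diagonal entries. The discriminant
  becomes a perfect square, and the slope the quotient of a nonzero number by its modulus.\<close>

lemma form_slope_limit:
  fixes l :: "real \<Rightarrow> 'n rvec"
  assumes gap: "\<And>i. i \<noteq> j \<Longrightarrow> filterlim (\<lambda>t. l t $ j - l t $ i) at_top at_top"
    and ne: "\<rho> * entry_mass A j a \<noteq> (1 - \<rho>) * entry_mass A j b"
  shows "((\<lambda>t. form_slope (l t) A a b \<rho>) \<longlongrightarrow> sgn (\<rho> * entry_mass A j a - (1 - \<rho>) * entry_mass A j b)) at_top"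
proof -
  let ?X = "entry_mass A j a" and ?Y = "entry_mass A j b"
  have d: "circle_disc ?X ?Y ((cmod (cnj (A $ j $ a) * A $ j $ b))\<^sup>2) \<rho> = (\<rho> * ?X - (1 - \<rho>) * ?Y)\<^sup>2"
    by (simp add: circle_disc_eq norm_mult power_mult_distrib)
  have "((\<lambda>t. circle_disc (diag_form (\<chi> i. l t $ i - l t $ j) A a) (diag_form (\<chi> i. l t $ i - l t $ j) A b)
      ((cmod (off_form (\<chi> i. l t $ i - l t $ j) A a b))\<^sup>2) \<rho>)
      \<longlongrightarrow> circle_disc ?X ?Y ((cmod (cnj (A $ j $ a) * A $ j $ b))\<^sup>2) \<rho>) at_top"
    unfolding circle_disc_def by (intro tendsto_intros diag_form_limit[OF gap])
  then have "((\<lambda>t. form_slope (\<chi> i. l t $ i - l t $ j) A a b \<rho>) \<longlongrightarrow> circle_slope ?X ?Y ((cmod (cnj (A $ j $ a) * A $ j $ b))\<^sup>2) \<rho>) at_top"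
    unfolding form_slope_def circle_slope_def
    by (intro tendsto_intros diag_form_limit[OF gap]) (use ne d in auto)
  moreover have "circle_slope ?X ?Y ((cmod (cnj (A $ j $ a) * A $ j $ b))\<^sup>2) \<rho> = sgn (\<rho> * ?X - (1 - \<rho>) * ?Y)"
    unfolding circle_slope_def d by (simp add: real_sgn_eq)
  ultimately show ?thesis unfolding form_slope_shift by simp
qed

text \<open>Ties must be treated here, although there numerator and discriminant both tend to 0.
  That ties form a null set is a consequence of the law of \<open>mass_ratio\<close>, which itself
  rests on this limit through \<open>sgn_average\<close>.\<close>

lemma form_slope_peak_limit:
  fixes A :: "'n cmat"
  assumes A: "unitary A" and ab: "a \<noteq> b" and \<rho>: "0 < \<rho>" "\<rho> < 1" and nz: "A $ j $ a \<noteq> 0"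
  shows "((\<lambda>t. form_slope (peak j t) A a b \<rho>) \<longlongrightarrow> sgn (\<rho> * entry_mass A j a - (1 - \<rho>) * entry_mass A j b)) at_top"
proof (cases "\<rho> * entry_mass A j a = (1 - \<rho>) * entry_mass A j b")
  case False
  show ?thesis
  proof (rule form_slope_limit)
    show "filterlim (\<lambda>t. peak j t $ j - peak j t $ i) at_top at_top" if "i \<noteq> j" for i
      using that by (simp add: peak_def filterlim_ident)
  qed (rule False)
next
  case True
  define X Y where "X = entry_mass A j a" and "Y = entry_mass A j b"
  have tie: "\<rho> * X = (1 - \<rho>) * Y" using True by (simp add: X_def Y_def)
  have X: "0 < X" "0 \<le> Y" using nz by (auto simp: X_def Y_def)
  \<comment> \<open>At a tie, with \<open>e = exp (- t / 2)\<close>, the numerator of the slope is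
    \<open>e^2 * (2 * \<rho> - 1)\<close> and the discriminant is \<open>e^2 * W e\<close>. As
    \<open>W 0\<close> is positive, the slope is of order \<open>e\<close>.\<close>
  define W where "W e = e\<^sup>2 * (2 * \<rho> - 1)\<^sup>2 + 4 * \<rho> * (1 - \<rho>) * ((1 - e\<^sup>2) * (X + Y) + e\<^sup>2)" for e
  have eq: "form_slope (peak j t) A a b \<rho> = exp (- t / 2) * (2 * \<rho> - 1) / sqrt (W (exp (- t / 2)))" for t
  proof -
    define e where "e = exp (- t / 2)"
    have e: "0 < e" "exp (- t) = e * e" by (auto simp: e_def exp_add[symmetric])
    have n: "\<rho> * (X + e * e * (1 - X)) - (1 - \<rho>) * (Y + e * e * (1 - Y)) = e * e * (2 * \<rho> - 1)"
    proof -
      have "\<rho> * (X + e * e * (1 - X)) - (1 - \<rho>) * (Y + e * e * (1 - Y)) = (1 - e * e) * (\<rho> * X - (1 - \<rho>) * Y) + e * e * (2 * \<rho> - 1)"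
        by (simp add: algebra_simps)
      then show ?thesis using tie by simp
    qed
    have "circle_disc (X + e * e * (1 - X)) (Y + e * e * (1 - Y)) ((1 - e * e)\<^sup>2 * (X * Y)) \<rho>
       = (e * e * (2 * \<rho> - 1))\<^sup>2 + 4 * \<rho> * (1 - \<rho>) * ((X + e * e * (1 - X)) * (Y + e * e * (1 - Y)) - (1 - e * e)\<^sup>2 * (X * Y))"
      unfolding circle_disc_eq n ..
    also have "(X + e * e * (1 - X)) * (Y + e * e * (1 - Y)) - (1 - e * e)\<^sup>2 * (X * Y) = e\<^sup>2 * ((1 - e\<^sup>2) * (X + Y) + e\<^sup>2)"
      by (simp add: power2_eq_square algebra_simps)
    also have "(e * e * (2 * \<rho> - 1))\<^sup>2 + 4 * \<rho> * (1 - \<rho>) * (e\<^sup>2 * ((1 - e\<^sup>2) * (X + Y) + e\<^sup>2)) = e\<^sup>2 * W e"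
      by (simp add: W_def power2_eq_square algebra_simps)
    finally have "circle_slope (X + e * e * (1 - X)) (Y + e * e * (1 - Y)) ((1 - e * e)\<^sup>2 * (X * Y)) \<rho> = e * (2 * \<rho> - 1) / sqrt (W e)"
      unfolding circle_slope_def n using e by (simp add: real_sqrt_mult)
    moreover have "(cmod (off_form (peak j t) A a b))\<^sup>2 = (1 - e * e)\<^sup>2 * (X * Y)"
      unfolding off_form_peak[OF A ab] e X_def Y_def norm_mult norm_of_real complex_mod_cnj power_mult_distrib power2_abs ..
    ultimately show ?thesis
      unfolding form_slope_def diag_form_peak[OF A] X_def[symmetric] Y_def[symmetric] e e_def[symmetric] by simp
  qed
  have e0: "((\<lambda>t. exp (- t / 2)) \<longlongrightarrow> (0::real)) at_top" by real_asymp
  then have "((\<lambda>t. W (exp (- t / 2))) \<longlongrightarrow> W 0) at_top"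
    unfolding W_def by (intro tendsto_intros)
  moreover have "0 < W 0" using X \<rho> by (simp add: W_def add_pos_nonneg)
  ultimately have "((\<lambda>t. exp (- t / 2) * (2 * \<rho> - 1) / sqrt (W (exp (- t / 2)))) \<longlongrightarrow> 0 * (2 * \<rho> - 1) / sqrt (W 0)) at_top"
    by (intro tendsto_intros e0) auto
  then show ?thesis unfolding eq using True by simp
qed

text \<open>The form of a single row is degenerate, so \<open>form_slope_average\<close> is applied
  to the forms with exponents \<open>peak j t\<close> and carried to the limit; the bound 1 on the
  slope supplies the dominating function \<open>\<bar>f A\<bar>\<close>.\<close>

lemma sgn_average:
  assumes f: "integrable H f" and inv: "block_invariant a b f"
    and ab: "a \<noteq> b" and \<rho>: "0 < \<rho>" "\<rho> < 1"
  shows "(\<integral>A. f A * sgn (\<rho> * entry_mass A j a - (1 - \<rho>) * entry_mass A j b) \<partial>H) = (2 * \<rho> - 1) * (\<integral>A. f A \<partial>H)"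
proof -
  have [measurable]: "f \<in> borel_measurable H" using f by simp
  have "((\<lambda>t. \<integral>A. f A * form_slope (peak j t) A a b \<rho> \<partial>H) \<longlongrightarrow>
      (\<integral>A. f A * sgn (\<rho> * entry_mass A j a - (1 - \<rho>) * entry_mass A j b) \<partial>H)) at_top"
  proof (rule integral_dominated_convergence_at_top[where w = "\<lambda>A. \<bar>f A\<bar>"])
    show "AE A in H. ((\<lambda>t. f A * form_slope (peak j t) A a b \<rho>) \<longlongrightarrow> f A * sgn (\<rho> * entry_mass A j a - (1 - \<rho>) * entry_mass A j b)) at_top"
      using entry_nonzero[of j a]
      by (rule AE_mp) (auto intro!: AE_I2 tendsto_mult_left form_slope_peak_limit ab \<rho> simp: space_H)
    have "norm (f A * form_slope (peak j t) A a b \<rho>) \<le> \<bar>f A\<bar>" if "A \<in> space H" for t A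
      using that mult_left_mono[OF abs_form_slope_le[OF _ ab \<rho>, of A "peak j t"], of "\<bar>f A\<bar>"]
      by (simp add: space_H abs_mult)
    then show "\<forall>\<^sub>F t in at_top. AE A in H. norm (f A * form_slope (peak j t) A a b \<rho>) \<le> \<bar>f A\<bar>"
      by (intro always_eventually allI AE_I2)
  qed (use f in \<open>auto\<close>)
  then have "((\<lambda>t :: real. (2 * \<rho> - 1) * (\<integral>A. f A \<partial>H)) \<longlongrightarrow>
      (\<integral>A. f A * sgn (\<rho> * entry_mass A j a - (1 - \<rho>) * entry_mass A j b) \<partial>H)) at_top"
    unfolding form_slope_average[OF f inv ab \<rho>] .
  then show ?thesis by (simp add: tendsto_const_iff)
qed

section \<open>The law of \<open>B\<close> and the limiting integral\<close>

definition mass_ratio :: "'n \<Rightarrow> 'n \<Rightarrow> 'n \<Rightarrow> 'n cmat \<Rightarrow> real" where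
  "mass_ratio j a b A = entry_mass A j a / pair_mass j a b A"

lemma mass_ratio_measurable [measurable]: "mass_ratio j a b \<in> borel_measurable H"
  unfolding mass_ratio_def[abs_def] by measurable

text \<open>With \<open>\<rho> = 1 - y\<close> the comparison of the two entries becomes a
  comparison of their ratio with the level \<open>y\<close>. The coefficient
  \<open>1 - (1 - y)\<close> stays unsimplified to match \<open>sgn_average\<close>.\<close>

lemma sgn_mass_ratio:
  assumes "A $ j $ a \<noteq> 0"
  shows "sgn ((1 - y) * entry_mass A j a - (1 - (1 - y)) * entry_mass A j b) = sgn (mass_ratio j a b A - y)"
    "0 < mass_ratio j a b A" "mass_ratio j a b A \<le> 1" "0 < pair_mass j a b A"
proof -
  show S: "0 < pair_mass j a b A" using assms by (simp add: pair_mass_def add_pos_nonneg)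
  have "(1 - y) * entry_mass A j a - (1 - (1 - y)) * entry_mass A j b = entry_mass A j a - y * pair_mass j a b A"
    by (simp add: pair_mass_def algebra_simps)
  also have "\<dots> = pair_mass j a b A * (mass_ratio j a b A - y)"
    using S by (simp add: mass_ratio_def algebra_simps)
  finally show "sgn ((1 - y) * entry_mass A j a - (1 - (1 - y)) * entry_mass A j b) = sgn (mass_ratio j a b A - y)"
    using S by (simp add: sgn_mult)
  show "0 < mass_ratio j a b A" using S assms by (simp add: mass_ratio_def)
  show "mass_ratio j a b A \<le> 1" using S by (simp add: mass_ratio_def pair_mass_def divide_le_eq)
qed

text \<open>
  The sign average gives \<open>P(B \<le> y) + P(B < y) = 2y\<close>, and monotonicity excludes atoms.
\<close>

lemma mass_ratio_uniform:
  assumes ab: "a \<noteq> b"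
  shows "distributed H lborel (mass_ratio j a b) (\<lambda>x. indicator {0..1} x / measure lborel {0..1::real})"
proof -
  let ?B = "mass_ratio j a b"
  define F G where "F y = prob {A \<in> space H. ?B A \<le> y}" and "G y = prob {A \<in> space H. ?B A < y}" for y
  have sum: "F y + G y = 2 * y" if y: "0 < y" "y < 1" for y
  proof -
    have "(\<integral>A. 1 * sgn ((1 - y) * entry_mass A j a - (1 - (1 - y)) * entry_mass A j b) \<partial>H) = (2 * (1 - y) - 1) * (\<integral>A. 1 \<partial>H)"
      using y by (intro sgn_average block_invariant_const ab) auto
    moreover have "(\<integral>A. 1 * sgn ((1 - y) * entry_mass A j a - (1 - (1 - y)) * entry_mass A j b) \<partial>H)
       = (\<integral>A. 1 - (indicator {A \<in> space H. ?B A \<le> y} A + indicator {A \<in> space H. ?B A < y} A) \<partial>H)"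
    proof (rule integral_cong_AE)
      show "AE A in H. 1 * sgn ((1 - y) * entry_mass A j a - (1 - (1 - y)) * entry_mass A j b)
         = 1 - (indicator {A \<in> space H. ?B A \<le> y} A + indicator {A \<in> space H. ?B A < y} A)"
        using entry_nonzero[of j a]
      proof (rule AE_mp, intro AE_I2 impI)
        fix A assume "A \<in> space H" "A $ j $ a \<noteq> 0"
        moreover have "sgn (?B A - y) = 1 - (indicator {A \<in> space H. ?B A \<le> y} A + indicator {A \<in> space H. ?B A < y} A)"
          using \<open>A \<in> space H\<close> by (auto simp: sgn_real_def indicator_def)
        ultimately show "1 * sgn ((1 - y) * entry_mass A j a - (1 - (1 - y)) * entry_mass A j b)
         = 1 - (indicator {A \<in> space H. ?B A \<le> y} A + indicator {A \<in> space H. ?B A < y} A)"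
          unfolding sgn_mass_ratio(1)[OF \<open>A $ j $ a \<noteq> 0\<close>] by simp
      qed
    qed measurable
    moreover have "\<dots> = 1 - (F y + G y)"
    proof -
      have [measurable]: "{A \<in> space H. ?B A \<le> y} \<in> sets H" "{A \<in> space H. ?B A < y} \<in> sets H" by measurable
      have "integrable H (indicat_real {A \<in> space H. ?B A \<le> y})" "integrable H (indicat_real {A \<in> space H. ?B A < y})"
        by (auto intro!: integrable_real_indicator simp: less_top[symmetric])
      then show ?thesis by (simp add: F_def G_def prob_space)
    qed
    ultimately show ?thesis by (simp add: prob_space)
  qed
  have GF: "G y \<le> F y" for y unfolding F_def G_def by (rule finite_measure_mono) auto
  have FG: "F y \<le> G z" if "y < z" for y z unfolding F_def G_def using that by (intro finite_measure_mono) auto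
  have Fy: "F y = y" if y: "0 < y" "y < 1" for y
  proof (rule antisym)
    show "y \<le> F y" using sum[OF y] GF[of y] by simp
    \<comment> \<open>For \<open>z > y\<close> one has \<open>F y \<le> G z\<close>, and
      \<open>G z \<le> z\<close> as the smaller of two numbers with sum
      \<open>2 * z\<close>.\<close>
    show "F y \<le> y"
    proof (rule dense_ge_bounded)
      show "y < 1" by fact
      fix z assume "y < z" "z < 1"
      then show "F y \<le> z" using FG[of y z] sum[of z] GF[of z] y by simp
    qed
  qed
  have F0: "F 0 = 0"
  proof -
    have "F 0 \<le> 0"
    proof (rule dense_ge_bounded)
      show "(0::real) < 1" by simp
      fix z :: real assume "0 < z" "z < 1"
      then show "F 0 \<le> z" using FG[of 0 z] sum[of z] GF[of z] by simp
    qed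
    moreover have "0 \<le> F 0" by (simp add: F_def)
    ultimately show ?thesis by simp
  qed
  have F1: "F 1 = 1"
    unfolding F_def
  proof (rule prob_eq_1[THEN iffD2])
    show "AE A in H. A \<in> {A \<in> space H. ?B A \<le> 1}"
      using entry_nonzero[of j a] by (rule AE_mp) (auto intro!: AE_I2 sgn_mass_ratio)
  qed measurable
  show ?thesis
  proof (rule uniform_distrI_borel_atLeastAtMost)
    fix t :: real assume "0 \<le> t" "t \<le> 1"
    then have "F t = t" using Fy[of t] F0 F1 by (cases "t = 0 \<or> t = 1") auto
    then show "prob {x \<in> space H. ?B x \<le> t} = (t - 0) / (1 - 0)" by (simp add: F_def)
  qed auto
qed

end

text \<open>Continuity at 0 admits the fundamental theorem of calculus on intervals that touch the
  singularity of \<open>ln\<close>.\<close>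

lemma continuous_on_xlnx: "continuous_on {0..} (\<lambda>x::real. x * ln x)"
proof -
  have "continuous (at x within {0..}) (\<lambda>x::real. x * ln x)" if "0 \<le> x" for x :: real
  proof (cases "x = 0")
    case True
    have "((\<lambda>x::real. x * ln x) \<longlongrightarrow> 0) (at_right 0)" by real_asymp
    then show ?thesis using True by (simp add: continuous_within at_within_Ici_at_right)
  next
    case False
    then have "isCont (\<lambda>x::real. x * ln x) x" by (intro continuous_intros) auto
    then show ?thesis by (rule continuous_at_imp_continuous_at_within)
  qed
  then show ?thesis by (simp add: continuous_on_eq_continuous_within)
qed

text \<open>Agreement of \<open>f\<close> with a multiple of \<open>ln\<close> is asked only in the
  open interval, so that a sign function may take any value at its break point.\<close>

lemma ln_has_integral:
  fixes u v k :: real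
  assumes "0 \<le> u" "u \<le> v" and f: "\<And>x. u < x \<Longrightarrow> x < v \<Longrightarrow> f x = k * ln x"
  shows "(f has_integral k * (v * ln v - v) - k * (u * ln u - u)) {u..v}"
proof (rule fundamental_theorem_of_calculus_interior[OF assms(2)])
  show "continuous_on {u..v} (\<lambda>x. k * (x * ln x - x))"
    using assms by (intro continuous_intros continuous_on_subset[OF continuous_on_xlnx]) auto
  fix x assume x: "x \<in> {u<..<v}"
  have "((\<lambda>x. k * (x * ln x - x)) has_real_derivative k * ln x) (at x)"
    using x assms by (auto intro!: derivative_eq_intros simp: field_simps)
  then show "((\<lambda>x. k * (x * ln x - x)) has_vector_derivative f x) (at x)"
    using f x by (simp add: has_real_derivative_iff_has_vector_derivative)
qed

context haar_measure
begin

lemma ln_entry_sgn_average: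
  assumes ab: "a \<noteq> b" and \<rho>: "0 < \<rho>" "\<rho> < 1"
  shows "(\<integral>A. ln (entry_mass A j a) * (1 - 2 * \<rho> + sgn (\<rho> * entry_mass A j a - (1 - \<rho>) * entry_mass A j b)) \<partial>H)
       = - 2 * (1 - \<rho>) * ln (1 - \<rho>)"
proof -
  define y where "y = 1 - \<rho>"
  have y: "0 < y" "y < 1" "\<rho> = 1 - y" using \<rho> by (auto simp: y_def)
  let ?s = "\<lambda>A :: 'n cmat. sgn (\<rho> * entry_mass A j a - (1 - \<rho>) * entry_mass A j b)"
  let ?X = "\<lambda>A :: 'n cmat. entry_mass A j a" and ?S = "pair_mass j a b" and ?B = "mass_ratio j a b"
  have split: "ln (?X A) = ln (?S A) + ln (?B A)" "ln (?S A) \<le> 0" "ln (?B A) \<le> 0"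
    if "unitary A" "A $ j $ a \<noteq> 0" for A
  proof -
    note S = sgn_mass_ratio(2-4)[OF that(2), where b = b]
    have "?X A = ?S A * ?B A" using S by (simp add: mass_ratio_def)
    then show "ln (?X A) = ln (?S A) + ln (?B A)" using S by (simp add: ln_mult)
    show "ln (?S A) \<le> 0" using S pair_mass_le_1[OF that(1) ab, of j] by simp
    show "ln (?B A) \<le> 0" using S by simp
  qed
  \<comment> \<open>\<open>ln (?X A)\<close> is a sum of two nonpositive terms, so its modulus
    dominates each of them.\<close>
  have bd: "integrable H f" if [measurable]: "f \<in> borel_measurable H"
    and *: "\<And>A. unitary A \<Longrightarrow> A $ j $ a \<noteq> 0 \<Longrightarrow> \<bar>f A\<bar> \<le> \<bar>ln (?X A)\<bar>" for f
  proof (rule Bochner_Integration.integrable_bound[OF integrable_ln_entry[of j a]])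
    show "AE A in H. norm (f A) \<le> norm (ln (?X A))"
      using entry_nonzero[of j a] by (rule AE_mp) (auto intro!: AE_I2 * simp: space_H)
  qed measurable
  have S_int: "integrable H (\<lambda>A. ln (?S A))"
  proof (rule bd)
    show "\<bar>ln (?S A)\<bar> \<le> \<bar>ln (?X A)\<bar>" if "unitary A" "A $ j $ a \<noteq> 0" for A
      using split[OF that] by linarith
  qed measurable
  have B_int: "integrable H (\<lambda>A. ln (?B A))"
  proof (rule bd)
    show "\<bar>ln (?B A)\<bar> \<le> \<bar>ln (?X A)\<bar>" if "unitary A" "A $ j $ a \<noteq> 0" for A
      using split[OF that] by linarith
  qed measurable
  define h where "h x = ln x * (2 * y - 1 + sgn (x - y))" for x :: real
  have [measurable]: "h \<in> borel_measurable borel" unfolding h_def[abs_def] by measurable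
  have Bs_int: "integrable H (\<lambda>A. h (?B A))"
    unfolding h_def
    by (rule integrable_mult_bounded[OF B_int, where C = 2]) (use y in \<open>auto simp: sgn_real_def\<close>)
  have Ss_int: "integrable H (\<lambda>A. ln (?S A) * ?s A)"
    by (rule integrable_mult_bounded[OF S_int, where C = 1]) (auto simp: sgn_real_def)
  have "(\<integral>A. ln (?X A) * (1 - 2 * \<rho> + ?s A) \<partial>H) = (\<integral>A. (1 - 2 * \<rho>) * ln (?S A) + ln (?S A) * ?s A + h (?B A) \<partial>H)"
  proof (rule integral_cong_AE)
    show "AE A in H. ln (?X A) * (1 - 2 * \<rho> + ?s A) = (1 - 2 * \<rho>) * ln (?S A) + ln (?S A) * ?s A + h (?B A)"
      using entry_nonzero[of j a]
    proof (rule AE_mp, intro AE_I2 impI)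
      fix A assume "A \<in> space H" and nz: "A $ j $ a \<noteq> 0"
      then have A: "unitary A" by (simp add: space_H)
      have e: "?s A = sgn (?B A - y)" unfolding y(3) by (rule sgn_mass_ratio[OF nz])
      show "ln (?X A) * (1 - 2 * \<rho> + ?s A) = (1 - 2 * \<rho>) * ln (?S A) + ln (?S A) * ?s A + h (?B A)"
        unfolding e split(1)[OF A nz] h_def by (simp add: y(3) algebra_simps)
    qed
  qed measurable
  also have "\<dots> = (1 - 2 * \<rho>) * (\<integral>A. ln (?S A) \<partial>H) + (\<integral>A. ln (?S A) * ?s A \<partial>H) + (\<integral>A. h (?B A) \<partial>H)"
    using S_int Ss_int Bs_int by simp
  also have "(\<integral>A. ln (?S A) * ?s A \<partial>H) = (2 * \<rho> - 1) * (\<integral>A. ln (?S A) \<partial>H)"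
    by (rule sgn_average[OF S_int block_invariant_pair_mass[OF ab, of ln j] ab \<rho>])
  also have "(\<integral>A. h (?B A) \<partial>H) = - 2 * y * ln y"
  proof -
    note D = mass_ratio_uniform[OF ab, of j]
    have int: "set_integrable lborel {0..1} h"
      using distributed_integrable[OF D, of h] Bs_int by (simp add: set_integrable_def)
    \<comment> \<open>\<open>h\<close> is \<open>(2 * y - 2) * ln\<close> below \<open>y\<close> and
      \<open>2 * y * ln\<close> above it. The parts of the antiderivatives without logarithm
      cancel.\<close>
    have "(h has_integral ((2 * y - 2) * (y * ln y - y) - (2 * y - 2) * (0 * ln 0 - 0))
       + ((2 * y) * (1 * ln 1 - 1) - (2 * y) * (y * ln y - y))) {0..1}"
      by (rule has_integral_combine[where c = y]; (rule ln_has_integral)?) (use y in \<open>auto simp: h_def\<close>)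
    then have hk: "integral {0..1} h = - 2 * y * ln y"
      by (simp add: integral_unique algebra_simps)
    have "(\<integral>A. h (?B A) \<partial>H) = (LINT x:{0..1}|lborel. h x)"
      using distributed_integral[OF D, of h] by (simp add: set_lebesgue_integral_def)
    also have "\<dots> = integral {0..1} h"
      by (rule set_borel_integral_eq_integral[OF int])
    also have "\<dots> = - 2 * y * ln y" by (rule hk)
    finally show ?thesis .
  qed
  finally show ?thesis by (simp add: y_def algebra_simps)
qed

section \<open>The derivative at fixed exponents: uniform bound and limit\<close>

definition ln_slope_average :: "'n rvec \<Rightarrow> 'n \<Rightarrow> 'n \<Rightarrow> real \<Rightarrow> real" where
  "ln_slope_average l a b \<rho> = (\<integral>A. ln (diag_form l A a) * ((1 - 2 * \<rho> + form_slope l A a b \<rho>) / (2 * \<rho> * (1 - \<rho>))) \<partial>H)"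

lemma integrable_ln_diag_form:
  fixes l :: "'n rvec"
  shows "integrable H (\<lambda>A. ln (diag_form l A a))"
proof (rule integrable_const_bound)
  show "AE A in H. norm (ln (diag_form l A a)) \<le> one_norm l"
    by (auto intro!: AE_I2 abs_ln_qform norm_axis_one simp: space_H diag_form_qform)
qed measurable

text \<open>The mean of \<open>1 - 2\<rho> + form_slope\<close> vanishes, so a constant may be subtracted from the logarithm.\<close>

lemma ln_slope_average_shift:
  assumes ab: "a \<noteq> b" and \<rho>: "0 < \<rho>" "\<rho> < 1"
  shows "ln_slope_average l a b \<rho>
     = (\<integral>A. ln (diag_form (\<chi> i. l $ i - c) A a) * (1 - 2 * \<rho> + form_slope l A a b \<rho>) \<partial>H) / (2 * \<rho> * (1 - \<rho>))"
proof -
  let ?d = "diag_form (\<chi> i. l $ i - c)"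
  have s1: "(\<integral>A. form_slope l A a b \<rho> \<partial>H) = 2 * \<rho> - 1"
    using form_slope_average[OF _ block_invariant_const ab \<rho>, of 1 l] by (simp add: prob_space)
  have s_int: "integrable H (\<lambda>A. form_slope l A a b \<rho>)"
    by (rule integrable_const_bound[where B = 1]) (auto intro!: AE_I2 abs_form_slope_le ab \<rho> simp: space_H)
  have d_int: "integrable H (\<lambda>A. ln (?d A a) * (1 - 2 * \<rho> + form_slope l A a b \<rho>))"
  proof (rule integrable_mult_bounded[OF integrable_ln_diag_form])
    show "\<bar>1 - 2 * \<rho> + form_slope l A a b \<rho>\<bar> \<le> 2" if "unitary A" for A
      using abs_form_slope_le[OF that ab \<rho>, of l] \<rho> by (simp add: abs_le_iff)
  qed measurable
  have "ln_slope_average l a b \<rho> = (\<integral>A. (ln (?d A a) * (1 - 2 * \<rho> + form_slope l A a b \<rho>) + c * (1 - 2 * \<rho> + form_slope l A a b \<rho>)) / (2 * \<rho> * (1 - \<rho>)) \<partial>H)"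
    unfolding ln_slope_average_def
  proof (rule Bochner_Integration.integral_cong[OF refl])
    fix A assume "A \<in> space H"
    then have "0 < diag_form l A a" using form_bounds(3)[OF _ ab] by (simp add: space_H)
    then have "ln (?d A a) + c = ln (diag_form l A a)"
      by (simp add: diag_form_shift ln_mult)
    then show "ln (diag_form l A a) * ((1 - 2 * \<rho> + form_slope l A a b \<rho>) / (2 * \<rho> * (1 - \<rho>)))
      = (ln (?d A a) * (1 - 2 * \<rho> + form_slope l A a b \<rho>) + c * (1 - 2 * \<rho> + form_slope l A a b \<rho>)) / (2 * \<rho> * (1 - \<rho>))"
      by (simp only: distrib_right[symmetric] times_divide_eq_right)
  qed
  also have "\<dots> = (\<integral>A. ln (?d A a) * (1 - 2 * \<rho> + form_slope l A a b \<rho>) + c * (1 - 2 * \<rho> + form_slope l A a b \<rho>) \<partial>H) / (2 * \<rho> * (1 - \<rho>))"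
    by (rule integral_divide_zero)
  also have "(\<integral>A. ln (?d A a) * (1 - 2 * \<rho> + form_slope l A a b \<rho>) + c * (1 - 2 * \<rho> + form_slope l A a b \<rho>) \<partial>H)
      = (\<integral>A. ln (?d A a) * (1 - 2 * \<rho> + form_slope l A a b \<rho>) \<partial>H) + (\<integral>A. c * (1 - 2 * \<rho> + form_slope l A a b \<rho>) \<partial>H)"
    using s_int by (intro Bochner_Integration.integral_add d_int integrable_mult_right Bochner_Integration.integrable_add integrable_const)
  also have "(\<integral>A. c * (1 - 2 * \<rho> + form_slope l A a b \<rho>) \<partial>H) = c * (\<integral>A. 1 - 2 * \<rho> + form_slope l A a b \<rho> \<partial>H)"
    by (rule integral_mult_right_zero)
  also have "(\<integral>A. 1 - 2 * \<rho> + form_slope l A a b \<rho> \<partial>H) = 0"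
    using s_int s1 by (simp add: prob_space)
  finally show ?thesis by simp
qed

text \<open>After the shift the form at \<open>e_a\<close> is a weighted mean of numbers at most 1
  in which the value 1 has weight \<open>entry_mass A j a\<close>. It therefore lies between that
  weight and 1, whatever the other exponents are.\<close>

lemma ln_diag_form_shift_bound:
  assumes A: "unitary A" and nz: "A $ j $ a \<noteq> 0" and max: "\<And>i. l $ i \<le> l $ j"
  shows "\<bar>ln (diag_form (\<chi> i. l $ i - l $ j) A a)\<bar> \<le> \<bar>ln (entry_mass A j a)\<bar>"
proof -
  let ?d = "diag_form (\<chi> i. l $ i - l $ j) A a"
  have "?d \<le> (\<Sum>i\<in>UNIV. 1 * entry_mass A i a)"
    unfolding diag_form_def using max by (intro sum_mono mult_right_mono) auto
  then have "?d \<le> 1" using column_norm[OF A] by simp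
  moreover have lo: "entry_mass A j a \<le> ?d"
    unfolding diag_form_def
    using member_le_sum[of j UNIV "\<lambda>i. exp ((\<chi> i. l $ i - l $ j) $ i) * entry_mass A i a"] by simp
  moreover have X: "0 < entry_mass A j a" using nz by simp
  ultimately have "0 < ?d" "?d \<le> 1" by linarith+
  then have "ln ?d \<le> 0" by (rule ln_le_zero_iff[THEN iffD2])
  moreover have "ln (entry_mass A j a) \<le> ln ?d" using lo X \<open>0 < ?d\<close> by (auto intro: ln_mono)
  ultimately show ?thesis by linarith
qed

text \<open>The index \<open>j\<close> of the largest exponent depends on \<open>l\<close>; summing
  over all \<open>j\<close> makes the bound uniform. The bound 2 on
  \<open>\<bar>1 - 2 * \<rho> + form_slope l A a b \<rho>\<bar>\<close> cancels the 2 in the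
  denominator.\<close>

lemma ln_slope_average_bound:
  assumes ab: "a \<noteq> b" and \<rho>: "0 < \<rho>" "\<rho> < 1"
  shows "\<bar>ln_slope_average l a b \<rho>\<bar> \<le> (\<Sum>j\<in>UNIV. \<integral>A. \<bar>ln (entry_mass A j a)\<bar> \<partial>H) / (\<rho> * (1 - \<rho>))"
proof -
  obtain j where j: "\<And>i. l $ i \<le> l $ j"
  proof -
    have "Max (range (($) l)) \<in> range (($) l)" by (rule Max_in) auto
    then obtain j where "l $ j = Max (range (($) l))" by (metis imageE)
    then show ?thesis using that[of j] by (metis Max_ge finite finite_imageI rangeI)
  qed
  let ?d = "\<lambda>A. ln (diag_form (\<chi> i. l $ i - l $ j) A a)"
  have d_int: "integrable H (\<lambda>A. ?d A * (1 - 2 * \<rho> + form_slope l A a b \<rho>))"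
  proof (rule integrable_mult_bounded[OF integrable_ln_diag_form])
    show "\<bar>1 - 2 * \<rho> + form_slope l A a b \<rho>\<bar> \<le> 2" if "unitary A" for A
      using abs_form_slope_le[OF that ab \<rho>, of l] \<rho> by (simp add: abs_le_iff)
  qed measurable
  have "\<bar>\<integral>A. ?d A * (1 - 2 * \<rho> + form_slope l A a b \<rho>) \<partial>H\<bar> \<le> (\<integral>A. \<bar>?d A * (1 - 2 * \<rho> + form_slope l A a b \<rho>)\<bar> \<partial>H)"
    by (rule integral_abs_bound)
  also have "\<dots> \<le> (\<integral>A. \<bar>ln (entry_mass A j a)\<bar> * 2 \<partial>H)"
  proof (rule integral_mono_AE)
    show "AE A in H. \<bar>?d A * (1 - 2 * \<rho> + form_slope l A a b \<rho>)\<bar> \<le> \<bar>ln (entry_mass A j a)\<bar> * 2"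
      using entry_nonzero[of j a]
    proof (rule AE_mp, intro AE_I2 impI)
      fix A assume "A \<in> space H" and nz: "A $ j $ a \<noteq> 0"
      then have A: "unitary A" by (simp add: space_H)
      have "\<bar>1 - 2 * \<rho> + form_slope l A a b \<rho>\<bar> \<le> 2"
        using abs_form_slope_le[OF A ab \<rho>, of l] \<rho> by (simp add: abs_le_iff)
      with ln_diag_form_shift_bound[OF A nz j]
      show "\<bar>?d A * (1 - 2 * \<rho> + form_slope l A a b \<rho>)\<bar> \<le> \<bar>ln (entry_mass A j a)\<bar> * 2"
        unfolding abs_mult by (intro mult_mono) auto
    qed
  qed (use d_int integrable_ln_entry in auto)
  also have "\<dots> = 2 * (\<integral>A. \<bar>ln (entry_mass A j a)\<bar> \<partial>H)" by simp
  also have "(\<integral>A. \<bar>ln (entry_mass A j a)\<bar> \<partial>H) \<le> (\<Sum>j\<in>UNIV. \<integral>A. \<bar>ln (entry_mass A j a)\<bar> \<partial>H)"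
    by (rule member_le_sum[where f = "\<lambda>j. \<integral>A. \<bar>ln (entry_mass A j a)\<bar> \<partial>H"]) auto
  finally have *: "\<bar>\<integral>A. ?d A * (1 - 2 * \<rho> + form_slope l A a b \<rho>) \<partial>H\<bar> \<le> 2 * (\<Sum>j\<in>UNIV. \<integral>A. \<bar>ln (entry_mass A j a)\<bar> \<partial>H)"
    by simp
  have "\<bar>ln_slope_average l a b \<rho>\<bar> = \<bar>\<integral>A. ?d A * (1 - 2 * \<rho> + form_slope l A a b \<rho>) \<partial>H\<bar> / (2 * (\<rho> * (1 - \<rho>)))"
    unfolding ln_slope_average_shift[OF ab \<rho>, of l "l $ j"] using \<rho> by (simp add: abs_divide abs_mult mult.assoc)
  also have "\<dots> \<le> 2 * (\<Sum>j\<in>UNIV. \<integral>A. \<bar>ln (entry_mass A j a)\<bar> \<partial>H) / (2 * (\<rho> * (1 - \<rho>)))"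
    using * \<rho> by (intro divide_right_mono) auto
  finally show ?thesis by simp
qed

lemma ln_slope_average_limit:
  fixes l :: "real \<Rightarrow> 'n rvec"
  assumes ab: "a \<noteq> b" and \<rho>: "0 < \<rho>" "\<rho> < 1"
    and gap: "\<And>i. i \<noteq> j \<Longrightarrow> filterlim (\<lambda>t. l t $ j - l t $ i) at_top at_top"
  shows "((\<lambda>t. ln_slope_average (l t) a b \<rho>) \<longlongrightarrow> - (ln (1 - \<rho>) / \<rho>)) at_top"
proof -
  let ?X = "\<lambda>A :: 'n cmat. entry_mass A j a" and ?Y = "\<lambda>A :: 'n cmat. entry_mass A j b"
  let ?d = "\<lambda>t A. ln (diag_form (\<chi> i. l t $ i - l t $ j) A a)"
  \<comment> \<open>The mass ratio has a density, so ties now form a null set and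
    \<open>form_slope_limit\<close> applies almost everywhere.\<close>
  have tie: "AE A in H. \<rho> * ?X A \<noteq> (1 - \<rho>) * ?Y A"
  proof -
    note D = mass_ratio_uniform[OF ab, of j]
    have "AE A in H. mass_ratio j a b A \<noteq> 1 - \<rho>"
      using distributed_AE2[OF D, of "\<lambda>x. x \<noteq> 1 - \<rho>"] AE_lborel_singleton[of "1 - \<rho>"] by auto
    with entry_nonzero[of j a] show ?thesis
    proof eventually_elim
      fix A :: "'n cmat" assume nz: "A $ j $ a \<noteq> 0" and ne: "mass_ratio j a b A \<noteq> 1 - \<rho>"
      then have "sgn (mass_ratio j a b A - (1 - \<rho>)) \<noteq> 0" by (simp add: sgn_0_0)
      then show "\<rho> * ?X A \<noteq> (1 - \<rho>) * ?Y A" unfolding sgn_mass_ratio(1)[OF nz, symmetric] by auto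
    qed
  qed
  have max: "\<forall>\<^sub>F t in at_top. \<forall>i. l t $ i \<le> l t $ j"
  proof (rule eventually_all_finite)
    fix i
    show "\<forall>\<^sub>F t in at_top. l t $ i \<le> l t $ j"
    proof (cases "i = j")
      case False
      have "\<forall>\<^sub>F t in at_top. 0 \<le> l t $ j - l t $ i"
        using gap[OF False] unfolding filterlim_at_top by (rule spec)
      then show ?thesis by (rule eventually_mono) simp
    qed simp
  qed
  have "((\<lambda>t. \<integral>A. ?d t A * (1 - 2 * \<rho> + form_slope (l t) A a b \<rho>) \<partial>H) \<longlongrightarrow>
     (\<integral>A. ln (?X A) * (1 - 2 * \<rho> + sgn (\<rho> * ?X A - (1 - \<rho>) * ?Y A)) \<partial>H)) at_top"
  proof (rule integral_dominated_convergence_at_top[where w = "\<lambda>A. \<bar>ln (?X A)\<bar> * 2"])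
    show "AE A in H. ((\<lambda>t. ?d t A * (1 - 2 * \<rho> + form_slope (l t) A a b \<rho>)) \<longlongrightarrow>
        ln (?X A) * (1 - 2 * \<rho> + sgn (\<rho> * ?X A - (1 - \<rho>) * ?Y A))) at_top"
      using entry_nonzero[of j a] tie
      by eventually_elim (intro tendsto_intros diag_form_limit[OF gap] form_slope_limit[OF gap]; simp)
    show "\<forall>\<^sub>F t in at_top. AE A in H. norm (?d t A * (1 - 2 * \<rho> + form_slope (l t) A a b \<rho>)) \<le> \<bar>ln (?X A)\<bar> * 2"
      using max
    proof eventually_elim
      fix t assume j: "\<forall>i. l t $ i \<le> l t $ j"
      show "AE A in H. norm (?d t A * (1 - 2 * \<rho> + form_slope (l t) A a b \<rho>)) \<le> \<bar>ln (?X A)\<bar> * 2"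
        using entry_nonzero[of j a]
      proof (rule AE_mp, intro AE_I2 impI)
        fix A assume "A \<in> space H" and nz: "A $ j $ a \<noteq> 0"
        then have A: "unitary A" by (simp add: space_H)
        have "\<bar>1 - 2 * \<rho> + form_slope (l t) A a b \<rho>\<bar> \<le> 2"
          using abs_form_slope_le[OF A ab \<rho>, of "l t"] \<rho> by (simp add: abs_le_iff)
        with ln_diag_form_shift_bound[OF A nz, of "l t"] j
        show "norm (?d t A * (1 - 2 * \<rho> + form_slope (l t) A a b \<rho>)) \<le> \<bar>ln (?X A)\<bar> * 2"
          unfolding real_norm_def abs_mult by (intro mult_mono) auto
      qed
    qed
  qed (use integrable_ln_entry in auto)
  then have "((\<lambda>t. (\<integral>A. ?d t A * (1 - 2 * \<rho> + form_slope (l t) A a b \<rho>) \<partial>H) / (2 * \<rho> * (1 - \<rho>))) \<longlongrightarrow>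
     (- 2 * (1 - \<rho>) * ln (1 - \<rho>)) / (2 * \<rho> * (1 - \<rho>))) at_top"
    unfolding ln_entry_sgn_average[OF ab \<rho>] using \<rho> by (intro tendsto_intros) auto
  moreover have "(- 2 * (1 - \<rho>) * ln (1 - \<rho>)) / (2 * \<rho> * (1 - \<rho>)) = - (ln (1 - \<rho>) / \<rho>)"
    using \<rho> by (simp add: field_simps)
  moreover have "ln_slope_average (l t) a b \<rho> = (\<integral>A. ?d t A * (1 - 2 * \<rho> + form_slope (l t) A a b \<rho>) \<partial>H) / (2 * \<rho> * (1 - \<rho>))" for t
    by (rule ln_slope_average_shift[OF ab \<rho>])
  ultimately show ?thesis by (simp only:)
qed

end

section \<open>The distribution of the eigenvalues\<close>

abbreviation free_indices :: "'n::{finite,linorder} set" where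
  "free_indices \<equiv> UNIV - {Max UNIV}"

abbreviation free_lborel :: "('n::{finite,linorder} \<Rightarrow> real) measure" where
  "free_lborel \<equiv> PiM free_indices (\<lambda>_. lborel)"

interpretation lborel_product: product_sigma_finite "\<lambda>_ :: 'n. lborel :: real measure"
  by standard

section \<open>Affine changes of variables on the trace-free hyperplane\<close>

lemma emeasure_lborel_affine_vimage:
  fixes s c :: real
  assumes "0 < s" "A \<in> sets borel"
  shows "ennreal s * emeasure lborel ((\<lambda>x. c + s * x) -` A) = emeasure lborel A"
proof -
  have "emeasure lborel A = emeasure (density (distr lborel borel (\<lambda>x. c + s * x)) (\<lambda>_. ennreal \<bar>s\<bar>)) A"
    using lborel_real_affine[of s c] assms by simp
  also have "\<dots> = ennreal s * emeasure (distr lborel borel (\<lambda>x. c + s * x)) A"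
    using assms by (simp add: emeasure_density_const)
  also have "emeasure (distr lborel borel (\<lambda>x. c + s * x)) A = emeasure lborel ((\<lambda>x. c + s * x) -` A)"
    using assms by (subst emeasure_distr) auto
  finally show ?thesis ..
qed

lemma affine_map_measurable [measurable]:
  "(\<lambda>x. \<lambda>i\<in>I. c i + s * x i) \<in> measurable (PiM I (\<lambda>_. lborel :: real measure)) (PiM I (\<lambda>_. lborel))"
  by (rule measurable_restrict) measurable

text \<open>It is enough to compare volumes of boxes, where each side scales by \<open>s\<close>.
  The restriction of the map to \<open>I\<close> keeps its values in the space of the product
  measure, which consists of extensional functions.\<close>

lemma PiM_lborel_affine:
  fixes s :: real and c :: "'i \<Rightarrow> real"
  assumes "finite I" "0 < s"
  shows "PiM I (\<lambda>_. lborel) = density (distr (PiM I (\<lambda>_. lborel)) (PiM I (\<lambda>_. lborel)) (\<lambda>x. \<lambda>i\<in>I. c i + s * x i)) (\<lambda>_. ennreal (s ^ card I))"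
proof -
  let ?M = "PiM I (\<lambda>_. lborel :: real measure)" and ?T = "\<lambda>x. \<lambda>i\<in>I. c i + s * x i"
  have "density (distr ?M ?M ?T) (\<lambda>_. ennreal (s ^ card I)) = ?M"
  proof (rule lborel_product.PiM_eqI[OF assms(1)])
    fix A assume A: "\<And>i. i \<in> I \<Longrightarrow> A i \<in> sets (lborel :: real measure)"
    have PA: "Pi\<^sub>E I A \<in> sets ?M" using A assms by (intro sets_PiM_I_finite) auto
    have "emeasure (density (distr ?M ?M ?T) (\<lambda>_. ennreal (s ^ card I))) (Pi\<^sub>E I A) = ennreal (s ^ card I) * emeasure (distr ?M ?M ?T) (Pi\<^sub>E I A)"
      using PA by (simp add: emeasure_density_const)
    also have "emeasure (distr ?M ?M ?T) (Pi\<^sub>E I A) = emeasure ?M (?T -` (Pi\<^sub>E I A) \<inter> space ?M)"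
      using PA by (intro emeasure_distr) auto
    also have "?T -` (Pi\<^sub>E I A) \<inter> space ?M = Pi\<^sub>E I (\<lambda>i. (\<lambda>x. c i + s * x) -` A i)"
      by (auto simp: space_PiM PiE_def Pi_def)
    also have "emeasure ?M \<dots> = (\<Prod>i\<in>I. emeasure lborel ((\<lambda>x. c i + s * x) -` A i))"
    proof (rule lborel_product.emeasure_PiM[OF assms(1)])
      fix i assume "i \<in> I"
      then have "(\<lambda>x. c i + s * x) -` A i \<in> sets borel"
        using A by (intro measurable_sets_borel[where M = borel]) auto
      then show "(\<lambda>x. c i + s * x) -` A i \<in> sets lborel" by simp
    qed
    also have "ennreal (s ^ card I) * \<dots> = (\<Prod>i\<in>I. ennreal s * emeasure lborel ((\<lambda>x. c i + s * x) -` A i))"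
      using assms by (simp add: prod.distrib ennreal_power)
    also have "\<dots> = (\<Prod>i\<in>I. emeasure lborel (A i))"
      using A assms by (intro prod.cong emeasure_lborel_affine_vimage) auto
    finally show "emeasure (density (distr ?M ?M ?T) (\<lambda>_. ennreal (s ^ card I))) (Pi\<^sub>E I A) = (\<Prod>i\<in>I. emeasure lborel (A i))" .
  qed simp
  then show ?thesis ..
qed

lemma integral_PiM_lborel_affine:
  fixes s :: real and c :: "'i \<Rightarrow> real" and f :: "('i \<Rightarrow> real) \<Rightarrow> real"
  assumes "finite I" "0 < s" and [measurable]: "f \<in> borel_measurable (PiM I (\<lambda>_. lborel))"
  shows "(\<integral>x. f x \<partial>PiM I (\<lambda>_. lborel)) = s ^ card I * (\<integral>x. f (\<lambda>i\<in>I. c i + s * x i) \<partial>PiM I (\<lambda>_. lborel))"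
    and "integrable (PiM I (\<lambda>_. lborel)) f \<Longrightarrow> integrable (PiM I (\<lambda>_. lborel)) (\<lambda>x. f (\<lambda>i\<in>I. c i + s * x i))"
proof -
  let ?M = "PiM I (\<lambda>_. lborel :: real measure)" and ?T = "\<lambda>x. \<lambda>i\<in>I. c i + s * x i"
  let ?D = "density (distr ?M ?M ?T) (\<lambda>_. ennreal (s ^ card I))"
  have eq: "?M = ?D" by (rule PiM_lborel_affine[OF assms(1,2)])
  have "integral\<^sup>L ?M f = integral\<^sup>L ?D f" using eq by simp
  also have "\<dots> = (\<integral>x. s ^ card I * f x \<partial>distr ?M ?M ?T)"
    using assms by (subst integral_density) auto
  also have "\<dots> = (\<integral>x. s ^ card I * f (?T x) \<partial>?M)"
    by (rule integral_distr) measurable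
  finally show "(\<integral>x. f x \<partial>?M) = s ^ card I * (\<integral>x. f (?T x) \<partial>?M)" by simp
  assume "integrable ?M f"
  then have "integrable ?D f" using eq by simp
  then have "integrable (distr ?M ?M ?T) (\<lambda>x. s ^ card I * f x)"
    using assms by (subst (asm) integrable_density) auto
  then have "integrable ?M (\<lambda>x. s ^ card I * f (?T x))"
    by (subst (asm) integrable_distr_eq) auto
  then show "integrable ?M (\<lambda>x. f (?T x))" using assms by simp
qed

lemma measurable_vec:
  fixes f :: "'a \<Rightarrow> 'b::euclidean_space ^ 'n"
  assumes "\<And>i. (\<lambda>x. f x $ i) \<in> borel_measurable M"
  shows "f \<in> borel_measurable M"
proof (subst borel_measurable_euclidean_space, intro ballI)
  fix b :: "'b ^ 'n" assume "b \<in> Basis"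
  then obtain i u where b: "b = axis i u" by (auto simp: Basis_vec_def)
  show "(\<lambda>x. f x \<bullet> b) \<in> borel_measurable M"
    unfolding b inner_axis using assms by (intro borel_measurable_inner) auto
qed

lemma vec_nth_measurable [measurable]: "(\<lambda>x :: real ^ 'n. x $ i) \<in> borel_measurable borel"
  by (rule borel_measurable_continuous_onI) (intro continuous_intros)

lemma trace_free_measurable [measurable]: "trace_free \<in> borel_measurable free_lborel"
proof (rule measurable_vec)
  fix i :: 'a
  show "(\<lambda>x. (trace_free x :: 'a rvec) $ i) \<in> borel_measurable free_lborel"
  proof (cases "i = Max UNIV")
    case True
    then show ?thesis unfolding trace_free_def by (simp del: sum.insert) measurable
  next
    case False
    then have [measurable]: "(\<lambda>x :: 'a \<Rightarrow> real. x i) \<in> borel_measurable free_lborel"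
      by (intro measurable_component_singleton[where M = "\<lambda>_. lborel", simplified]) auto
    from False show ?thesis unfolding trace_free_def by simp
  qed
qed

lemma trace_free_sum: "(\<Sum>i\<in>UNIV. trace_free x $ i) = 0"
proof -
  have "(\<Sum>i\<in>UNIV. trace_free x $ i) = trace_free x $ (Max UNIV) + (\<Sum>i\<in>UNIV - {Max UNIV}. trace_free x $ i)"
    by (rule sum.remove) auto
  also have "(\<Sum>i\<in>UNIV - {Max UNIV}. trace_free x $ i) = (\<Sum>i\<in>UNIV - {Max UNIV}. x i)"
    by (rule sum.cong) (auto simp: trace_free_def)
  finally show ?thesis by (simp add: trace_free_def)
qed

text \<open>A dilation and a translation by a vector of sum 0 preserve the hyperplane of sum 0.
  Hence an affine substitution in the free coordinates is one on the hyperplane.\<close>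

lemma trace_free_affine:
  assumes "(\<Sum>i\<in>UNIV. c $ i) = (0::real)"
  shows "trace_free (\<lambda>i\<in>free_indices. c $ i + s * x i) = c + s *\<^sub>R trace_free x"
proof -
  have c: "(\<Sum>i\<in>UNIV - {Max UNIV}. c $ i) = - c $ Max UNIV"
    using assms by (simp add: sum.remove[of UNIV "Max UNIV"])
  have "(\<Sum>i\<in>free_indices. (\<lambda>i\<in>free_indices. c $ i + s * x i) i) = (\<Sum>i\<in>free_indices. c $ i + s * x i)"
    by (rule sum.cong) auto
  then have "(\<Sum>i\<in>free_indices. (\<lambda>i\<in>free_indices. c $ i + s * x i) i) = - c $ Max UNIV + s * (\<Sum>i\<in>free_indices. x i)"
    by (simp add: sum.distrib c sum_distrib_left)
  then show ?thesis
    unfolding vec_eq_iff trace_free_def by (auto simp: algebra_simps)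
qed

section \<open>Gaussian integrability\<close>

lemma integrable_exp_abs_square:
  assumes "0 < B" shows "integrable lborel (\<lambda>x::real. exp (A * \<bar>x\<bar> - B * x\<^sup>2))"
proof -
  \<comment> \<open>With this variance the normal density uses half of the quadratic decay; the
    other half absorbs the linear term \<open>A * \<bar>x\<bar>\<close> up to the constant
    \<open>A^2 / (2 * B)\<close>.\<close>
  define \<sigma> where "\<sigma> = 1 / sqrt B"
  have \<sigma>: "0 < \<sigma>" "\<sigma>\<^sup>2 = 1 / B" using assms by (auto simp: \<sigma>_def power_divide)
  have "integrable lborel (\<lambda>x. exp (A\<^sup>2 / (2 * B)) * sqrt (2 * pi * \<sigma>\<^sup>2) * normal_density 0 \<sigma> x)"
    using integrable_normal_density[OF \<sigma>(1), of 0] by simp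
  then show ?thesis
  proof (rule Bochner_Integration.integrable_bound)
    show "AE x in lborel. norm (exp (A * \<bar>x\<bar> - B * x\<^sup>2)) \<le> norm (exp (A\<^sup>2 / (2 * B)) * sqrt (2 * pi * \<sigma>\<^sup>2) * normal_density 0 \<sigma> x)"
    proof (intro AE_I2)
      fix x :: real
      have "0 \<le> (A - B * \<bar>x\<bar>)\<^sup>2 / (2 * B)" using assms by simp
      also have "\<dots> = A\<^sup>2 / (2 * B) + B * x\<^sup>2 / 2 - A * \<bar>x\<bar>"
        using assms by (simp add: power2_eq_square field_simps)
      finally have "A * \<bar>x\<bar> \<le> A\<^sup>2 / (2 * B) + B * x\<^sup>2 / 2" by simp
      moreover have "- x\<^sup>2 / (2 * \<sigma>\<^sup>2) = - (B * x\<^sup>2 / 2)" using assms by (simp add: \<sigma>)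
      ultimately have "A * \<bar>x\<bar> - B * x\<^sup>2 \<le> A\<^sup>2 / (2 * B) + (- x\<^sup>2 / (2 * \<sigma>\<^sup>2))"
        by linarith
      then have "exp (A * \<bar>x\<bar> - B * x\<^sup>2) \<le> exp (A\<^sup>2 / (2 * B)) * exp (- x\<^sup>2 / (2 * \<sigma>\<^sup>2))"
        by (simp only: exp_add[symmetric] exp_le_cancel_iff)
      also have "exp (- x\<^sup>2 / (2 * \<sigma>\<^sup>2)) = sqrt (2 * pi * \<sigma>\<^sup>2) * normal_density 0 \<sigma> x"
        using \<sigma>(1) by (simp add: normal_density_def)
      finally show "norm (exp (A * \<bar>x\<bar> - B * x\<^sup>2)) \<le> norm (exp (A\<^sup>2 / (2 * B)) * sqrt (2 * pi * \<sigma>\<^sup>2) * normal_density 0 \<sigma> x)"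
        by (simp add: mult.assoc)
    qed
  qed measurable
qed

text \<open>The coordinate determined by the vanishing trace depends on all others, but it adds at
  most \<open>A^2 / (4 * B)\<close> to the exponent, as \<open>A * \<bar>z\<bar> - B * z^2\<close>
  never exceeds this. What remains is a product over the free coordinates.\<close>

lemma integrable_exp_trace_free:
  assumes "0 < B"
  shows "integrable free_lborel (\<lambda>x. exp (A * (\<Sum>i\<in>UNIV. \<bar>(trace_free x :: 'n::{finite,linorder} rvec) $ i\<bar>) - B * (\<Sum>i\<in>UNIV. (trace_free x $ i)\<^sup>2)))"
proof -
  let ?m = "Max UNIV :: 'n"
  have "integrable free_lborel (\<lambda>x :: 'n \<Rightarrow> real. exp (A\<^sup>2 / (4 * B)) * (\<Prod>i\<in>free_indices. exp (A * \<bar>x i\<bar> - B * (x i)\<^sup>2)))"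
    by (intro integrable_mult_right lborel_product.product_integrable_prod integrable_exp_abs_square assms) auto
  then show ?thesis
  proof (rule Bochner_Integration.integrable_bound)
    show "AE x in free_lborel. norm (exp (A * one_norm (trace_free x :: 'n rvec) - B * (\<Sum>i\<in>UNIV. (trace_free x $ i)\<^sup>2)))
        \<le> norm (exp (A\<^sup>2 / (4 * B)) * (\<Prod>i\<in>free_indices. exp (A * \<bar>x i\<bar> - B * (x i)\<^sup>2)))"
    proof (intro AE_I2)
      fix x :: "'n \<Rightarrow> real"
      let ?y = "\<lambda>i. (trace_free x :: 'n rvec) $ i"
      let ?z = "?y ?m"
      have "A * (\<Sum>i\<in>UNIV. \<bar>?y i\<bar>) - B * (\<Sum>i\<in>UNIV. (?y i)\<^sup>2) = (\<Sum>i\<in>UNIV. A * \<bar>?y i\<bar> - B * (?y i)\<^sup>2)"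
        by (simp add: sum_subtractf sum_distrib_left)
      also have "\<dots> = (A * \<bar>?z\<bar> - B * ?z\<^sup>2) + (\<Sum>i\<in>free_indices. A * \<bar>?y i\<bar> - B * (?y i)\<^sup>2)"
        by (rule sum.remove) auto
      also have "(\<Sum>i\<in>free_indices. A * \<bar>?y i\<bar> - B * (?y i)\<^sup>2) = (\<Sum>i\<in>free_indices. A * \<bar>x i\<bar> - B * (x i)\<^sup>2)"
        by (rule sum.cong) (auto simp: trace_free_def)
      also have "A * \<bar>?z\<bar> - B * ?z\<^sup>2 \<le> A\<^sup>2 / (4 * B)"
      proof -
        have "0 \<le> (A - 2 * B * \<bar>?z\<bar>)\<^sup>2 / (4 * B)" using assms by simp
        also have "\<dots> = A\<^sup>2 / (4 * B) + B * ?z\<^sup>2 - A * \<bar>?z\<bar>"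
          using assms by (simp add: power2_eq_square field_simps)
        finally show ?thesis by simp
      qed
      finally have "exp (A * (\<Sum>i\<in>UNIV. \<bar>?y i\<bar>) - B * (\<Sum>i\<in>UNIV. (?y i)\<^sup>2)) \<le> exp (A\<^sup>2 / (4 * B)) * (\<Prod>i\<in>free_indices. exp (A * \<bar>x i\<bar> - B * (x i)\<^sup>2))"
        by (simp add: exp_sum[symmetric] exp_add[symmetric])
      then show "norm (exp (A * (\<Sum>i\<in>UNIV. \<bar>?y i\<bar>) - B * (\<Sum>i\<in>UNIV. (?y i)\<^sup>2))) \<le> norm (exp (A\<^sup>2 / (4 * B)) * (\<Prod>i\<in>free_indices. exp (A * \<bar>x i\<bar> - B * (x i)\<^sup>2)))"
        by (simp add: prod_nonneg)
    qed
  qed measurable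
qed

section \<open>Orders of the eigenvalues and the Weyl vector\<close>

definition ranks :: "('n::finite \<Rightarrow> nat) set" where
  "ranks = {r. bij_betw r UNIV {..<CARD('n)}}"

text \<open>For \<open>r \<in> ranks\<close> this is a permuted Weyl vector: the ranks
  \<open>0, ..., N - 1\<close> moved to mean 0.\<close>

definition center :: "('n::finite \<Rightarrow> nat) \<Rightarrow> 'n rvec" where
  "center r = (\<chi> j. real (r j) - (\<Sum>i\<in>UNIV. real (r i)) / real CARD('n))"

text \<open>The squared length of the Weyl vector, common to all its permutations.\<close>

definition energy :: "'n::finite itself \<Rightarrow> real" where
  "energy _ = (\<Sum>k<CARD('n). (real k - (\<Sum>i<CARD('n). real i) / real CARD('n))\<^sup>2)"

text \<open>Breaking ties by the order of the index type makes this a strict total order, so that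
  \<open>rank_of l\<close> is a bijection even when exponents coincide.\<close>

definition precedes :: "'n::{finite,linorder} rvec \<Rightarrow> 'n \<Rightarrow> 'n \<Rightarrow> bool" where
  "precedes l i j \<longleftrightarrow> l $ i < l $ j \<or> l $ i = l $ j \<and> i < j"

definition rank_of :: "'n::{finite,linorder} rvec \<Rightarrow> 'n \<Rightarrow> nat" where
  "rank_of l j = card {i. precedes l i j}"

lemma finite_ranks: "finite (ranks :: ('n::finite \<Rightarrow> nat) set)"
proof (rule finite_subset)
  show "(ranks :: ('n \<Rightarrow> nat) set) \<subseteq> Pi\<^sub>E UNIV (\<lambda>_. {..<CARD('n)})"
    by (auto simp: ranks_def bij_betw_def PiE_def Pi_def)
  show "finite (Pi\<^sub>E UNIV (\<lambda>_. {..<CARD('n)}) :: ('n \<Rightarrow> nat) set)"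
    by (intro finite_PiE) auto
qed

lemma bij_ranks:
  fixes r :: "'n::finite \<Rightarrow> nat"
  assumes "inj r" "\<And>i. r i < CARD('n)" shows "r \<in> ranks"
proof -
  have "range r = {..<CARD('n)}"
    using assms by (intro card_subset_eq) (auto simp: card_image)
  then show ?thesis using assms by (simp add: ranks_def bij_betw_def)
qed

lemma rank_of_less:
  assumes "precedes l i j" shows "rank_of l i < rank_of l j"
  unfolding rank_of_def
proof (rule psubset_card_mono)
  have "{k. precedes l k i} \<subseteq> {k. precedes l k j}" using assms by (auto simp: precedes_def)
  moreover have "i \<in> {k. precedes l k j}" "i \<notin> {k. precedes l k i}" using assms by (auto simp: precedes_def)
  ultimately show "{k. precedes l k i} \<subset> {k. precedes l k j}" by blast
qed simp

lemma precedes_total: "i \<noteq> j \<Longrightarrow> precedes l i j \<or> precedes l j i"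
  by (auto simp: precedes_def)

lemma rank_of_ranks: "rank_of l \<in> ranks"
proof (rule bij_ranks)
  show "inj (rank_of l)"
  proof (rule injI)
    fix i j assume "rank_of l i = rank_of l j"
    then show "i = j" using rank_of_less[of l i j] rank_of_less[of l j i] precedes_total[of i j l] by force
  qed
  fix i
  have "{k. precedes l k i} \<subset> UNIV" by (auto simp: precedes_def)
  then show "rank_of l i < CARD('a)" unfolding rank_of_def by (intro psubset_card_mono) auto
qed

lemma center_sum: "(\<Sum>j\<in>UNIV. center r $ j) = 0"
  by (simp add: center_def sum_subtractf)

lemma center_square:
  fixes r :: "'n::finite \<Rightarrow> nat"
  assumes "r \<in> ranks" shows "(\<Sum>j\<in>UNIV. (center r $ j)\<^sup>2) = energy TYPE('n)"
proof -
  have b: "bij_betw r UNIV {..<CARD('n)}" using assms by (simp add: ranks_def)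
  have "(\<Sum>i\<in>UNIV. real (r i)) = (\<Sum>i<CARD('n). real i)" by (rule sum.reindex_bij_betw[OF b])
  then show ?thesis
    unfolding center_def energy_def
    using sum.reindex_bij_betw[OF b, of "\<lambda>k. (real k - (\<Sum>i<CARD('n). real i) / real CARD('n))\<^sup>2"] by simp
qed

lemma center_diff: "center r $ j - center r $ i = real (r j) - real (r i)"
  by (simp add: center_def)

text \<open>Completing the square: the exponent of the heat weight is maximal at \<open>2t\<close> times the center.\<close>

lemma heat_exponent:
  fixes r :: "'n::finite \<Rightarrow> nat" and y :: "'n rvec"
  assumes r: "r \<in> ranks" and t: "0 < t" and y: "(\<Sum>j\<in>UNIV. y $ j) = 0"
  defines "l \<equiv> (2 * t) *\<^sub>R center r + sqrt t *\<^sub>R y"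
  shows "(\<Sum>j\<in>UNIV. real (r j) * l $ j) - (1 / (4 * t)) * (\<Sum>j\<in>UNIV. (l $ j)\<^sup>2) = t * energy TYPE('n) - (\<Sum>j\<in>UNIV. (y $ j)\<^sup>2) / 4"
proof -
  define m where "m = (\<Sum>i\<in>UNIV. real (r i)) / real CARD('n)"
  have l0: "(\<Sum>j\<in>UNIV. l $ j) = 0"
    unfolding l_def by (simp add: sum.distrib sum_distrib_left[symmetric] center_sum y)
  \<comment> \<open>Since \<open>l\<close> sums to 0, each rank may be replaced by its centred
    value.\<close>
  have "(\<Sum>j\<in>UNIV. real (r j) * l $ j) = (\<Sum>j\<in>UNIV. center r $ j * l $ j + m * l $ j)"
    by (rule sum.cong) (auto simp: center_def m_def algebra_simps)
  also have "\<dots> = (\<Sum>j\<in>UNIV. center r $ j * l $ j)"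
    by (simp add: sum.distrib sum_distrib_left[symmetric] l0)
  finally have "(\<Sum>j\<in>UNIV. real (r j) * l $ j) - (1 / (4 * t)) * (\<Sum>j\<in>UNIV. (l $ j)\<^sup>2)
    = (\<Sum>j\<in>UNIV. center r $ j * l $ j - (1 / (4 * t)) * (l $ j)\<^sup>2)"
    by (simp add: sum_subtractf sum_distrib_left)
  also have "\<dots> = (\<Sum>j\<in>UNIV. t * (center r $ j)\<^sup>2 - (y $ j)\<^sup>2 / 4)"
  proof (rule sum.cong[OF refl])
    fix j
    have "(l $ j)\<^sup>2 = 4 * t * (t * (center r $ j)\<^sup>2 + sqrt t * (center r $ j * y $ j)) + (sqrt t)\<^sup>2 * (y $ j)\<^sup>2"
      unfolding l_def by (simp add: power2_eq_square algebra_simps)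
    then have "(1 / (4 * t)) * (l $ j)\<^sup>2 = t * (center r $ j)\<^sup>2 + sqrt t * (center r $ j * y $ j) + (y $ j)\<^sup>2 / 4"
      using t by (simp add: add_divide_distrib)
    moreover have "center r $ j * l $ j = 2 * (t * (center r $ j)\<^sup>2) + sqrt t * (center r $ j * y $ j)"
      unfolding l_def by (simp add: power2_eq_square algebra_simps)
    ultimately show "center r $ j * l $ j - (1 / (4 * t)) * (l $ j)\<^sup>2 = t * (center r $ j)\<^sup>2 - (y $ j)\<^sup>2 / 4"
      by simp
  qed
  also have "\<dots> = t * energy TYPE('n) - (\<Sum>j\<in>UNIV. (y $ j)\<^sup>2) / 4"
    by (simp add: sum_subtractf sum_distrib_left[symmetric] center_square[OF r] sum_divide_distrib)
  finally show ?thesis .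
qed

section \<open>Vandermonde products and a majorant of the heat weight\<close>

definition num_pairs :: "'n::{finite,linorder} itself \<Rightarrow> nat" where
  "num_pairs _ = card {(i :: 'n, j). i < j}"

lemma vandermonde_scale:
  "vandermonde (\<lambda>j. c * x j) = c ^ num_pairs TYPE('n) * vandermonde (x :: 'n::{finite,linorder} \<Rightarrow> real)"
  by (simp add: vandermonde_def num_pairs_def case_prod_unfold right_diff_distrib[symmetric] prod.distrib)

lemma abs_vandermonde_le:
  fixes x :: "'n::{finite,linorder} \<Rightarrow> real"
  assumes "\<And>i j. i < j \<Longrightarrow> \<bar>x j - x i\<bar> \<le> b"
  shows "\<bar>vandermonde x\<bar> \<le> b ^ num_pairs TYPE('n)"
proof -
  have "\<bar>vandermonde x\<bar> \<le> (\<Prod>p\<in>{(i :: 'n, j). i < j}. b)"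
    unfolding vandermonde_def abs_prod using assms by (intro prod_mono) auto
  then show ?thesis by (simp add: num_pairs_def)
qed

lemma vandermonde_ge:
  fixes x :: "'n::{finite,linorder} \<Rightarrow> real"
  assumes "0 \<le> b" "\<And>i j. i < j \<Longrightarrow> b \<le> x j - x i"
  shows "b ^ num_pairs TYPE('n) \<le> vandermonde x"
proof -
  have "(\<Prod>p\<in>{(i :: 'n, j). i < j}. b) \<le> vandermonde x"
    unfolding vandermonde_def using assms by (intro prod_mono) auto
  then show ?thesis by (simp add: num_pairs_def)
qed

lemma abs_vandermonde_le_exp:
  fixes x :: "'n::{finite,linorder} \<Rightarrow> real"
  shows "\<bar>vandermonde x\<bar> \<le> exp (real (num_pairs TYPE('n)) * (\<Sum>k\<in>UNIV. \<bar>x k\<bar>))"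
proof -
  have "\<bar>x j - x i\<bar> \<le> exp (\<Sum>k\<in>UNIV. \<bar>x k\<bar>)" if "i < j" for i j
  proof -
    have "\<bar>x j - x i\<bar> \<le> (\<Sum>k\<in>{i, j}. \<bar>x k\<bar>)" using that by simp
    also have "\<dots> \<le> (\<Sum>k\<in>UNIV. \<bar>x k\<bar>)" by (rule sum_mono2) auto
    also have "\<dots> \<le> exp (\<Sum>k\<in>UNIV. \<bar>x k\<bar>)" using exp_ge_add_one_self[of "\<Sum>k\<in>UNIV. \<bar>x k\<bar>"] by linarith
    finally show ?thesis .
  qed
  from abs_vandermonde_le[OF this] show ?thesis by (simp add: exp_of_nat_mult)
qed

text \<open>Index \<open>j\<close> is the larger member of exactly \<open>rank_of l j\<close> pairs,
  one for each index that precedes it.\<close>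

lemma sum_pairs_max:
  fixes l :: "'n::{finite,linorder} rvec"
  shows "(\<Sum>(i, j)\<in>{(i, j). i < j}. if precedes l i j then l $ j else l $ i) = (\<Sum>j\<in>UNIV. real (rank_of l j) * l $ j)"
proof -
  have "(\<Sum>(i, j)\<in>{(i, j). i < j}. if precedes l i j then l $ j else l $ i) = (\<Sum>(i, j)\<in>{(i, j). precedes l i j}. l $ j)"
    by (rule sum.reindex_bij_witness[where i = "\<lambda>(i, j). if i < j then (i, j) else (j, i)" and j = "\<lambda>(i, j). if precedes l i j then (i, j) else (j, i)"])
       (auto split: if_splits simp: precedes_def not_less_iff_gr_or_eq)
  also have "\<dots> = (\<Sum>p\<in>UNIV. if precedes l (fst p) (snd p) then l $ snd p else 0)"
    by (subst sum.inter_filter[symmetric]) (auto simp: case_prod_unfold)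
  also have "\<dots> = (\<Sum>i\<in>UNIV. \<Sum>j\<in>UNIV. if precedes l i j then l $ j else 0)"
    by (simp add: sum.cartesian_product case_prod_unfold UNIV_Times_UNIV)
  also have "\<dots> = (\<Sum>j\<in>UNIV. \<Sum>i\<in>UNIV. if precedes l i j then l $ j else 0)"
    by (rule sum.swap)
  also have "\<dots> = (\<Sum>j\<in>UNIV. real (rank_of l j) * l $ j)"
    by (intro sum.cong refl) (simp add: rank_of_def sum.inter_filter[symmetric])
  finally show ?thesis .
qed

text \<open>A difference of two exponentials is at most the larger of them, and
  \<open>sum_pairs_max\<close> collects the exponents. For well separated increasing exponents the
  bound is nearly attained, see \<open>vandermonde_exp_ge\<close>.\<close>

lemma abs_vandermonde_exp_le:
  fixes l :: "'n::{finite,linorder} rvec"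
  shows "\<bar>vandermonde (\<lambda>j. exp (l $ j))\<bar> \<le> exp (\<Sum>j\<in>UNIV. real (rank_of l j) * l $ j)"
proof -
  have "\<bar>vandermonde (\<lambda>j. exp (l $ j))\<bar> \<le> (\<Prod>(i, j)\<in>{(i, j). i < j}. exp (if precedes l i j then l $ j else l $ i))"
    unfolding vandermonde_def abs_prod
  proof (rule prod_mono)
    fix p :: "'n \<times> 'n" assume "p \<in> {(i, j). i < j}"
    then obtain i j where p: "p = (i, j)" "i < j" by auto
    have "\<bar>exp (l $ j) - exp (l $ i)\<bar> \<le> exp (if precedes l i j then l $ j else l $ i)"
      using p by (auto simp: precedes_def abs_if not_less dest: less_imp_le)
    then show "0 \<le> \<bar>case p of (i, j) \<Rightarrow> exp (l $ j) - exp (l $ i)\<bar> \<and>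
       \<bar>case p of (i, j) \<Rightarrow> exp (l $ j) - exp (l $ i)\<bar> \<le> (case p of (i, j) \<Rightarrow> exp (if precedes l i j then l $ j else l $ i))"
      using p by simp
  qed
  also have "\<dots> = exp (\<Sum>(i, j)\<in>{(i, j). i < j}. if precedes l i j then l $ j else l $ i)"
    by (simp add: exp_sum case_prod_unfold)
  finally show ?thesis by (simp add: sum_pairs_max)
qed

text \<open>For each pair the factors of the two Vandermonde products have the same sign.\<close>

lemma heat_weight_nonneg: "0 \<le> heat_weight t l"
proof -
  have "0 \<le> (l $ j - l $ i) * (exp (l $ j) - exp (l $ i))" for i j
    by (cases "l $ i \<le> l $ j") (auto intro: mult_nonneg_nonneg mult_nonpos_nonpos)
  then have "0 \<le> vandermonde (\<lambda>j. l $ j) * vandermonde (\<lambda>j. exp (l $ j))"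
    unfolding vandermonde_def prod.distrib[symmetric] by (intro prod_nonneg) auto
  then show ?thesis by (simp add: heat_weight_def)
qed

text \<open>The heat weight with \<open>\<Delta>(e^\<lambda>)\<close> replaced by its leading
  exponential for the order \<open>r\<close>. It is used on the whole hyperplane, not only where the
  exponents have that order, so that the square can be completed globally.\<close>

definition rank_weight :: "('n::{finite,linorder} \<Rightarrow> nat) \<Rightarrow> real \<Rightarrow> 'n rvec \<Rightarrow> real" where
  "rank_weight r t l = \<bar>vandermonde (\<lambda>j. l $ j)\<bar> * exp ((\<Sum>j\<in>UNIV. real (r j) * l $ j) - (1 / (4 * t)) * (\<Sum>j\<in>UNIV. (l $ j)\<^sup>2))"

text \<open>The term with \<open>r = rank_of l\<close> alone is a majorant; the sum over all orders
  frees the bound from the chamber in which \<open>l\<close> lies.\<close>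

lemma heat_weight_le: "heat_weight t l \<le> (\<Sum>r\<in>ranks. rank_weight r t l)"
proof -
  have "heat_weight t l = \<bar>heat_weight t l\<bar>" by (rule abs_of_nonneg[symmetric, OF heat_weight_nonneg])
  also have "\<dots> = \<bar>vandermonde (\<lambda>j. l $ j)\<bar> * \<bar>vandermonde (\<lambda>j. exp (l $ j))\<bar> * exp (- (1 / (4 * t)) * (\<Sum>j\<in>UNIV. (l $ j)\<^sup>2))"
    by (simp add: heat_weight_def abs_mult)
  also have "\<dots> \<le> \<bar>vandermonde (\<lambda>j. l $ j)\<bar> * exp (\<Sum>j\<in>UNIV. real (rank_of l j) * l $ j) * exp (- (1 / (4 * t)) * (\<Sum>j\<in>UNIV. (l $ j)\<^sup>2))"
    by (intro mult_right_mono mult_left_mono abs_vandermonde_exp_le) auto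
  also have "\<dots> = rank_weight (rank_of l) t l"
    by (simp add: rank_weight_def mult.assoc exp_add[symmetric])
  also have "\<dots> \<le> (\<Sum>r\<in>ranks. rank_weight r t l)"
    by (rule member_le_sum) (auto simp: rank_of_ranks finite_ranks rank_weight_def)
  finally show ?thesis .
qed

lemma vandermonde_measurable [measurable]:
  fixes f :: "'a \<Rightarrow> 'n::{finite,linorder} \<Rightarrow> real"
  assumes [measurable]: "\<And>i. (\<lambda>x. f x i) \<in> borel_measurable M"
  shows "(\<lambda>x. vandermonde (f x)) \<in> borel_measurable M"
  unfolding vandermonde_def case_prod_unfold by measurable

lemma heat_weight_measurable [measurable]: "heat_weight t \<in> borel_measurable borel"
  unfolding heat_weight_def[abs_def] by measurable

lemma rank_weight_measurable [measurable]: "rank_weight r t \<in> borel_measurable borel"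
  unfolding rank_weight_def[abs_def] by measurable

lemma sets_trace_free_lborel [simp, measurable_cong]: "sets trace_free_lborel = sets borel"
  by (simp add: trace_free_lborel_def)

lemma space_trace_free_lborel [simp]: "space trace_free_lborel = UNIV"
  by (simp add: trace_free_lborel_def)

lemma integral_trace_free_lborel:
  fixes f :: "'n::{finite,linorder} rvec \<Rightarrow> real"
  assumes "f \<in> borel_measurable borel"
  shows "(\<integral>l. f l \<partial>trace_free_lborel) = (\<integral>x. f (trace_free x) \<partial>free_lborel)"
    "integrable trace_free_lborel f \<longleftrightarrow> integrable free_lborel (\<lambda>x. f (trace_free x))"
  unfolding trace_free_lborel_def using assms
  by (auto intro!: integral_distr integrable_distr_eq)

lemma integrable_gaussian_bound:
  fixes f :: "'n::{finite,linorder} rvec \<Rightarrow> real"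
  assumes [measurable]: "f \<in> borel_measurable borel" and t: "0 < t"
    and bd: "\<And>l. \<bar>f l\<bar> \<le> C * exp (K * one_norm l - (1 / (4 * t)) * (\<Sum>j\<in>UNIV. (l $ j)\<^sup>2))"
  shows "integrable trace_free_lborel f"
  unfolding integral_trace_free_lborel(2)[OF assms(1)]
proof (rule Bochner_Integration.integrable_bound)
  show "integrable free_lborel (\<lambda>x. C * exp (K * one_norm (trace_free x :: 'n rvec) - (1 / (4 * t)) * (\<Sum>j\<in>UNIV. (trace_free x $ j)\<^sup>2)))"
    using t by (intro integrable_mult_right integrable_exp_trace_free) auto
  show "AE x in free_lborel. norm (f (trace_free x)) \<le> norm (C * exp (K * one_norm (trace_free x :: 'n rvec) - (1 / (4 * t)) * (\<Sum>j\<in>UNIV. (trace_free x $ j)\<^sup>2)))"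
    unfolding real_norm_def by (intro AE_I2 order_trans[OF bd abs_ge_self])
qed measurable

lemma rank_weight_bound:
  fixes l :: "'n::{finite,linorder} rvec"
  assumes "r \<in> ranks"
  shows "rank_weight r t l \<le> exp (real (num_pairs TYPE('n) + CARD('n)) * one_norm l - (1 / (4 * t)) * (\<Sum>j\<in>UNIV. (l $ j)\<^sup>2))"
proof -
  have "real (r j) * l $ j \<le> real CARD('n) * \<bar>l $ j\<bar>" for j
  proof -
    have "r j < CARD('n)" using assms by (auto simp: ranks_def bij_betw_def)
    then have "real (r j) * \<bar>l $ j\<bar> \<le> real CARD('n) * \<bar>l $ j\<bar>" by (intro mult_right_mono) auto
    moreover have "real (r j) * l $ j \<le> real (r j) * \<bar>l $ j\<bar>" by (intro mult_left_mono) auto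
    ultimately show ?thesis by linarith
  qed
  then have "(\<Sum>j\<in>UNIV. real (r j) * l $ j) \<le> real CARD('n) * one_norm l"
    unfolding sum_distrib_left by (rule sum_mono)
  then have "rank_weight r t l \<le> exp (real (num_pairs TYPE('n)) * one_norm l) * exp (real CARD('n) * one_norm l - (1 / (4 * t)) * (\<Sum>j\<in>UNIV. (l $ j)\<^sup>2))"
    unfolding rank_weight_def by (intro mult_mono abs_vandermonde_le_exp) auto
  then show ?thesis by (simp add: exp_add[symmetric] algebra_simps)
qed

lemma integrable_rank_weight:
  fixes f :: "'n::{finite,linorder} rvec \<Rightarrow> real"
  assumes r: "r \<in> ranks" and t: "0 < t" and [measurable]: "f \<in> borel_measurable borel"
    and f: "\<And>l. \<bar>f l\<bar> \<le> C * exp (K * one_norm l)"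
  shows "integrable trace_free_lborel (\<lambda>l. rank_weight r t l * f l)"
proof (rule integrable_gaussian_bound[OF _ t])
  fix l :: "'n rvec"
  let ?d = "real (num_pairs TYPE('n) + CARD('n))" and ?s = "\<Sum>j\<in>UNIV. \<bar>l $ j\<bar>" and ?q = "(1 / (4 * t)) * (\<Sum>j\<in>UNIV. (l $ j)\<^sup>2)"
  have "\<bar>rank_weight r t l * f l\<bar> = rank_weight r t l * \<bar>f l\<bar>"
    by (simp add: abs_mult rank_weight_def)
  also have "\<dots> \<le> exp (?d * ?s - ?q) * (C * exp (K * ?s))"
    by (intro mult_mono rank_weight_bound r f) auto
  also have "\<dots> = C * exp ((?d + K) * ?s - ?q)"
    by (simp add: exp_add[symmetric] algebra_simps)
  finally show "\<bar>rank_weight r t l * f l\<bar> \<le> C * exp ((?d + K) * ?s - ?q)" .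
qed measurable

lemma integrable_heat_weight:
  fixes f :: "'n::{finite,linorder} rvec \<Rightarrow> real"
  assumes t: "0 < t" and [measurable]: "f \<in> borel_measurable borel"
    and f: "\<And>l. \<bar>f l\<bar> \<le> C * exp (K * one_norm l)"
  shows "integrable trace_free_lborel (\<lambda>l. heat_weight t l * f l)"
proof (rule Bochner_Integration.integrable_bound)
  show "integrable trace_free_lborel (\<lambda>l. \<Sum>r\<in>ranks. rank_weight r t l * f l)"
  proof (rule Bochner_Integration.integrable_sum)
    fix r :: "'n \<Rightarrow> nat" assume "r \<in> ranks"
    then show "integrable trace_free_lborel (\<lambda>l. rank_weight r t l * f l)"
      using t assms(2) f by (rule integrable_rank_weight)
  qed
  show "AE l in trace_free_lborel. norm (heat_weight t l * f l) \<le> norm (\<Sum>r\<in>ranks. rank_weight r t l * f l)"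
  proof (intro AE_I2)
    fix l :: "'n rvec"
    have "\<bar>heat_weight t l\<bar> \<le> \<bar>\<Sum>r\<in>ranks. rank_weight r t l\<bar>"
      unfolding abs_of_nonneg[OF heat_weight_nonneg] by (rule order_trans[OF heat_weight_le abs_ge_self])
    then have "\<bar>heat_weight t l\<bar> * \<bar>f l\<bar> \<le> \<bar>\<Sum>r\<in>ranks. rank_weight r t l\<bar> * \<bar>f l\<bar>"
      by (rule mult_right_mono) simp
    then show "norm (heat_weight t l * f l) \<le> norm (\<Sum>r\<in>ranks. rank_weight r t l * f l)"
      by (simp only: real_norm_def abs_mult sum_distrib_right[symmetric])
  qed
qed measurable

text \<open>A factor \<open>t\<close> is drawn out of every Vandermonde difference, and
  \<open>heat_exponent\<close> evaluates the exponential. What remains is a Gaussian in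
  \<open>y\<close> times a Vandermonde product whose argument tends to
  \<open>2 * center r\<close>.\<close>

lemma rank_weight_affine:
  fixes r :: "'n::{finite,linorder} \<Rightarrow> nat"
  assumes r: "r \<in> ranks" and t: "0 < t" and y: "(\<Sum>j\<in>UNIV. y $ j) = 0"
  shows "rank_weight r t ((2 * t) *\<^sub>R center r + sqrt t *\<^sub>R y)
    = t ^ num_pairs TYPE('n) * exp (t * energy TYPE('n))
      * (\<bar>vandermonde (\<lambda>j. 2 * center r $ j + y $ j / sqrt t)\<bar> * exp (- (\<Sum>j\<in>UNIV. (y $ j)\<^sup>2) / 4))"
proof -
  have st: "sqrt t * v = t * (v / sqrt t)" for v
  proof -
    have "t * (v / sqrt t) = t / sqrt t * v" by simp
    also have "t / sqrt t = sqrt t" using t by (intro real_div_sqrt) simp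
    finally show ?thesis ..
  qed
  have split: "exp (u - v / 4) = exp u * exp (- v / 4)" for u v :: real
    by (simp add: exp_add[symmetric])
  have e: "(\<lambda>j. ((2 * t) *\<^sub>R center r + sqrt t *\<^sub>R y) $ j) = (\<lambda>j. t * (2 * center r $ j + y $ j / sqrt t))"
  proof
    fix j
    have "2 * t * center r $ j + sqrt t * y $ j = t * (2 * center r $ j + y $ j / sqrt t)"
      unfolding st distrib_left by simp
    then show "((2 * t) *\<^sub>R center r + sqrt t *\<^sub>R y) $ j = t * (2 * center r $ j + y $ j / sqrt t)" by simp
  qed
  have "rank_weight r t ((2 * t) *\<^sub>R center r + sqrt t *\<^sub>R y)
      = \<bar>vandermonde (\<lambda>j. ((2 * t) *\<^sub>R center r + sqrt t *\<^sub>R y) $ j)\<bar> * exp (t * energy TYPE('n) - (\<Sum>j\<in>UNIV. (y $ j)\<^sup>2) / 4)"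
    unfolding rank_weight_def heat_exponent[OF r t y] ..
  then show ?thesis
    unfolding e vandermonde_scale abs_mult split
    using t by (simp add: ac_simps)
qed

text \<open>The order of magnitude of the total mass: the Jacobian of the dilation by
  \<open>sqrt t\<close>, one factor \<open>t\<close> for each pair, and the exponential at its
  maximum.\<close>

definition heat_scale :: "'n::{finite,linorder} itself \<Rightarrow> real \<Rightarrow> real" where
  "heat_scale T t = sqrt t ^ card (free_indices :: 'n set) * (t ^ num_pairs T * exp (t * energy T))"

lemma integral_trace_free_affine:
  fixes f :: "'n::{finite,linorder} rvec \<Rightarrow> real" and c :: "'n rvec"
  assumes [measurable]: "f \<in> borel_measurable borel" and t: "0 < t" and c: "(\<Sum>j\<in>UNIV. c $ j) = 0"
  shows "(\<integral>l. f l \<partial>trace_free_lborel) = sqrt t ^ card (free_indices :: 'n set) * (\<integral>x. f (c + sqrt t *\<^sub>R trace_free x) \<partial>free_lborel)"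
proof -
  have "(\<integral>l. f l \<partial>trace_free_lborel) = (\<integral>x. f (trace_free x) \<partial>free_lborel)"
    by (rule integral_trace_free_lborel) measurable
  also have "\<dots> = sqrt t ^ card (free_indices :: 'n set) * (\<integral>x. f (trace_free (\<lambda>i\<in>free_indices. c $ i + sqrt t * x i)) \<partial>free_lborel)"
    using t by (intro integral_PiM_lborel_affine) auto
  finally show ?thesis by (simp add: trace_free_affine[OF c])
qed

text \<open>In the variable \<open>y\<close> the quotient is an integral over a fixed measure. For
  \<open>t \<ge> 1\<close> the factor \<open>1 / sqrt t\<close> is at most 1, which bounds the
  Vandermonde product independently of \<open>t\<close>, and dominated convergence applies.\<close>

lemma rank_weight_integral_limit:
  fixes r :: "'n::{finite,linorder} \<Rightarrow> nat" and f :: "'n rvec \<Rightarrow> real"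
  assumes r: "r \<in> ranks" and [measurable]: "f \<in> borel_measurable borel"
    and f: "\<And>l. \<bar>f l\<bar> \<le> C"
    and lim: "\<And>y. ((\<lambda>t. f ((2 * t) *\<^sub>R center r + sqrt t *\<^sub>R y)) \<longlongrightarrow> 0) at_top"
  shows "((\<lambda>t. (\<integral>l. rank_weight r t l * f l \<partial>trace_free_lborel) / heat_scale TYPE('n) t) \<longlongrightarrow> 0) at_top"
proof -
  let ?d = "real (num_pairs TYPE('n))"
  let ?V = "\<lambda>t x. \<bar>vandermonde (\<lambda>j. 2 * center r $ j + (trace_free x :: 'n rvec) $ j / sqrt t)\<bar>"
  let ?E = "\<lambda>x. exp (- (\<Sum>j\<in>UNIV. ((trace_free x :: 'n rvec) $ j)\<^sup>2) / 4)"
  let ?f = "\<lambda>t x. f ((2 * t) *\<^sub>R center r + sqrt t *\<^sub>R trace_free x)"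
  let ?c = "\<Sum>j\<in>UNIV. \<bar>2 * center r $ j\<bar>"
  have eq: "(\<integral>l. rank_weight r t l * f l \<partial>trace_free_lborel) / heat_scale TYPE('n) t = (\<integral>x. ?V t x * ?E x * ?f t x \<partial>free_lborel)"
    if t: "0 < t" for t
  proof -
    have "(\<integral>l. rank_weight r t l * f l \<partial>trace_free_lborel)
      = sqrt t ^ card (free_indices :: 'n set) * (\<integral>x. rank_weight r t ((2 * t) *\<^sub>R center r + sqrt t *\<^sub>R trace_free x) * ?f t x \<partial>free_lborel)"
      by (rule integral_trace_free_affine) (use t in \<open>auto simp: sum_distrib_left[symmetric] center_sum\<close>)
    also have "\<dots> = sqrt t ^ card (free_indices :: 'n set) * (\<integral>x. (t ^ num_pairs TYPE('n) * exp (t * energy TYPE('n))) * (?V t x * ?E x * ?f t x) \<partial>free_lborel)"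
      unfolding rank_weight_affine[OF r t trace_free_sum] by (simp add: mult.assoc)
    also have "\<dots> = heat_scale TYPE('n) t * (\<integral>x. ?V t x * ?E x * ?f t x \<partial>free_lborel)"
      by (simp add: heat_scale_def mult.assoc)
    finally show ?thesis using t by (simp add: heat_scale_def)
  qed
  have "((\<lambda>t. \<integral>x. ?V t x * ?E x * ?f t x \<partial>free_lborel) \<longlongrightarrow> (\<integral>x. 0 \<partial>(free_lborel :: ('n \<Rightarrow> real) measure))) at_top"
  proof (rule integral_dominated_convergence_at_top[where w = "\<lambda>x. C * exp (?d * ?c) * exp (?d * one_norm (trace_free x :: 'n rvec) - (1/4) * (\<Sum>j\<in>UNIV. (trace_free x $ j)\<^sup>2))"])
    show "integrable free_lborel (\<lambda>x. C * exp (?d * ?c) * exp (?d * one_norm (trace_free x :: 'n rvec) - (1/4) * (\<Sum>j\<in>UNIV. (trace_free x $ j)\<^sup>2)))"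
      by (intro integrable_mult_right integrable_exp_trace_free) simp
    have Vle: "?V t x \<le> exp (?d * ?c) * exp (?d * one_norm (trace_free x :: 'n rvec))" if t: "1 \<le> t" for t x
    proof -
      have "\<bar>2 * center r $ j + (trace_free x :: 'n rvec) $ j / sqrt t\<bar> \<le> \<bar>2 * center r $ j\<bar> + \<bar>(trace_free x :: 'n rvec) $ j\<bar>" for j
      proof -
        have "\<bar>(trace_free x :: 'n rvec) $ j\<bar> / sqrt t \<le> \<bar>(trace_free x :: 'n rvec) $ j\<bar> / 1"
          using t by (intro divide_left_mono) auto
        then have "\<bar>(trace_free x :: 'n rvec) $ j / sqrt t\<bar> \<le> \<bar>(trace_free x :: 'n rvec) $ j\<bar>"
          using t by (simp add: abs_divide)
        then show ?thesis by (meson abs_triangle_ineq add_left_mono order_trans)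
      qed
      then have "(\<Sum>j\<in>UNIV. \<bar>2 * center r $ j + (trace_free x :: 'n rvec) $ j / sqrt t\<bar>) \<le> ?c + one_norm (trace_free x :: 'n rvec)"
        unfolding sum.distrib[symmetric] by (rule sum_mono)
      then have "exp (?d * (\<Sum>j\<in>UNIV. \<bar>2 * center r $ j + (trace_free x :: 'n rvec) $ j / sqrt t\<bar>)) \<le> exp (?d * (?c + one_norm (trace_free x :: 'n rvec)))"
        by (simp add: mult_left_mono)
      then show ?thesis
        using order_trans[OF abs_vandermonde_le_exp] by (simp only: exp_add distrib_left)
    qed
    show "AE x in free_lborel. ((\<lambda>t. ?V t x * ?E x * ?f t x) \<longlongrightarrow> 0) at_top"
    proof (intro AE_I2)
      fix x :: "'n \<Rightarrow> real"
      let ?B = "exp (?d * ?c) * exp (?d * one_norm (trace_free x :: 'n rvec)) * ?E x"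
      show "((\<lambda>t. ?V t x * ?E x * ?f t x) \<longlongrightarrow> 0) at_top"
      proof (rule Lim_null_comparison)
        show "\<forall>\<^sub>F t in at_top. norm (?V t x * ?E x * ?f t x) \<le> ?B * \<bar>?f t x\<bar>"
          using eventually_ge_at_top[of 1]
        proof eventually_elim
          case (elim t)
          have "?V t x * ?E x * \<bar>?f t x\<bar> \<le> ?B * \<bar>?f t x\<bar>"
            by (intro mult_right_mono Vle[OF elim]) auto
          then show ?case by (simp add: abs_mult)
        qed
        show "((\<lambda>t. ?B * \<bar>?f t x\<bar>) \<longlongrightarrow> 0) at_top"
          using lim[of "trace_free x"] by (intro tendsto_mult_right_zero tendsto_rabs_zero)
      qed
    qed
    show "\<forall>\<^sub>F t in at_top. AE x in free_lborel. norm (?V t x * ?E x * ?f t x)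
       \<le> C * exp (?d * ?c) * exp (?d * one_norm (trace_free x :: 'n rvec) - (1/4) * (\<Sum>j\<in>UNIV. (trace_free x $ j)\<^sup>2))"
      using eventually_ge_at_top[of 1]
    proof eventually_elim
      case (elim t)
      show ?case
      proof (intro AE_I2)
        fix x :: "'n \<Rightarrow> real"
        have "?V t x * ?E x * \<bar>?f t x\<bar> \<le> exp (?d * ?c) * exp (?d * one_norm (trace_free x :: 'n rvec)) * ?E x * C"
          by (intro mult_mono Vle[OF elim] f) auto
        also have "\<dots> = C * exp (?d * ?c) * (exp (?d * one_norm (trace_free x :: 'n rvec)) * ?E x)"
          by (simp only: ac_simps)
        also have "exp (?d * one_norm (trace_free x :: 'n rvec)) * ?E x = exp (?d * one_norm (trace_free x :: 'n rvec) - (1/4) * (\<Sum>j\<in>UNIV. (trace_free x $ j)\<^sup>2))"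
          by (simp add: exp_add[symmetric])
        finally show "norm (?V t x * ?E x * ?f t x) \<le> C * exp (?d * ?c) * exp (?d * one_norm (trace_free x :: 'n rvec) - (1/4) * (\<Sum>j\<in>UNIV. (trace_free x $ j)\<^sup>2))"
          by (simp add: abs_mult)
      qed
    qed
  qed measurable
  then have "((\<lambda>t. \<integral>x. ?V t x * ?E x * ?f t x \<partial>free_lborel) \<longlongrightarrow> 0) at_top" by simp
  then show ?thesis
    by (rule Lim_transform_eventually) (use eventually_gt_at_top[of 0] in \<open>eventually_elim, simp add: eq\<close>)
qed

section \<open>Lower bound for the total mass, and averages under the heat weight\<close>

lemma vandermonde_exp_ge:
  fixes l :: "'n::{finite,linorder} rvec"
  assumes b: "0 \<le> b" and gap: "\<And>i j. i < j \<Longrightarrow> b \<le> l $ j - l $ i" and lt: "\<And>i j. i < j \<Longrightarrow> l $ i < l $ j"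
  shows "exp (\<Sum>j\<in>UNIV. real (rank_of l j) * l $ j) * (1 - exp (- b)) ^ num_pairs TYPE('n) \<le> vandermonde (\<lambda>j. exp (l $ j))"
proof -
  have pr: "precedes l i j" if "i < j" for i j using lt[OF that] by (simp add: precedes_def)
  have "exp (\<Sum>j\<in>UNIV. real (rank_of l j) * l $ j) * (1 - exp (- b)) ^ num_pairs TYPE('n)
     = (\<Prod>p\<in>{(i :: 'n, j). i < j}. exp (if precedes l (fst p) (snd p) then l $ snd p else l $ fst p)) * (\<Prod>p\<in>{(i :: 'n, j). i < j}. 1 - exp (- b))"
    by (simp add: sum_pairs_max[symmetric] exp_sum num_pairs_def case_prod_unfold)
  also have "\<dots> = (\<Prod>p\<in>{(i :: 'n, j). i < j}. exp (if precedes l (fst p) (snd p) then l $ snd p else l $ fst p) * (1 - exp (- b)))"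
    by (rule prod.distrib[symmetric])
  also have "\<dots> \<le> vandermonde (\<lambda>j. exp (l $ j))"
    unfolding vandermonde_def
  proof (rule prod_mono)
    fix p :: "'n \<times> 'n" assume "p \<in> {(i, j). i < j}"
    then obtain i j where p: "p = (i, j)" "i < j" by auto
    have "exp (l $ i) \<le> exp (l $ j - b)" using gap[OF p(2)] by simp
    also have "\<dots> = exp (l $ j) * exp (- b)" by (simp add: exp_add[symmetric])
    finally have "exp (l $ j) * (1 - exp (- b)) \<le> exp (l $ j) - exp (l $ i)" by (simp add: algebra_simps)
    then show "0 \<le> exp (if precedes l (fst p) (snd p) then l $ snd p else l $ fst p) * (1 - exp (- b)) \<and>
       exp (if precedes l (fst p) (snd p) then l $ snd p else l $ fst p) * (1 - exp (- b)) \<le> (case p of (i, j) \<Rightarrow> exp (l $ j) - exp (l $ i))"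
      using p pr b by simp
  qed
  finally show ?thesis .
qed

text \<open>All coordinates of the zero vector tie, so its ranks follow the order of the index type,
  as do those of every increasing vector.\<close>

lemma rank_of_eq_zero:
  fixes l :: "'n::{finite,linorder} rvec"
  assumes "\<And>i j. i < j \<Longrightarrow> l $ i < l $ j" shows "rank_of l = rank_of 0"
proof -
  have "precedes l i j \<longleftrightarrow> i < j" for i j
    using assms[of i j] assms[of j i] less_linear[of i j] by (auto simp: precedes_def)
  moreover have "precedes (0 :: 'n rvec) i j \<longleftrightarrow> i < j" for i j by (simp add: precedes_def)
  ultimately show ?thesis by (simp add: rank_of_def[abs_def])
qed

lemma abs_trace_free_le:
  fixes x :: "'n::{finite,linorder} \<Rightarrow> real"
  assumes "\<And>i. i \<in> free_indices \<Longrightarrow> 0 \<le> x i \<and> x i \<le> e" "0 \<le> e"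
  shows "\<bar>(trace_free x :: 'n rvec) $ j\<bar> \<le> real CARD('n) * e"
proof (cases "j = Max UNIV")
  case True
  have "\<bar>(trace_free x :: 'n rvec) $ j\<bar> = \<bar>\<Sum>i\<in>free_indices. x i\<bar>" using True by (simp add: trace_free_def)
  also have "\<dots> \<le> (\<Sum>i\<in>free_indices. \<bar>x i\<bar>)" by (rule sum_abs)
  also have "\<dots> \<le> (\<Sum>i\<in>(free_indices :: 'n set). e)" using assms by (intro sum_mono) auto
  also have "\<dots> \<le> (\<Sum>i\<in>(UNIV :: 'n set). e)" using assms by (intro sum_mono2) auto
  finally show ?thesis by simp
next
  case False
  then have "\<bar>(trace_free x :: 'n rvec) $ j\<bar> = \<bar>x j\<bar>" by (simp add: trace_free_def)
  also have "\<dots> \<le> 1 * e" using assms(1)[of j] False by simp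
  also have "\<dots> \<le> real CARD('n) * e" using assms(2) by (intro mult_right_mono) auto
  finally show ?thesis .
qed

lemma heat_weight_integrable: "0 < t \<Longrightarrow> integrable trace_free_lborel (heat_weight t)"
  using integrable_heat_weight[of t "\<lambda>_. 1" 1 0] by simp

text \<open>One chamber suffices, and in it a cube at the centre, where the free coordinates of
  \<open>y\<close> lie in \<open>{0..e}\<close>. Different centres are at least \<open>2 * t\<close>
  apart; the bound on \<open>e\<close> limits the loss from \<open>sqrt t *\<^sub>R y\<close> to
  \<open>t\<close>, so the gaps stay at least \<open>t\<close>. Moreover
  \<open>\<bar>y $ j\<bar> \<le> N\<close>, whence the constant
  \<open>exp (- (N ^ 3 / 4))\<close>.\<close>

lemma heat_integral_ge:
  fixes t e :: real
  assumes t: "0 < t" and e: "0 < e" "e \<le> 1" "2 * real CARD('n::{finite,linorder}) * e \<le> sqrt t"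
  shows "heat_scale TYPE('n) t * ((1 - exp (- t)) ^ num_pairs TYPE('n) * exp (- (real CARD('n) ^ 3 / 4)) * e ^ card (free_indices :: 'n set))
    \<le> (\<integral>l. heat_weight t (l :: 'n rvec) \<partial>trace_free_lborel)"
proof -
  let ?N = "real CARD('n)" and ?r = "rank_of (0 :: 'n rvec)" and ?d = "num_pairs TYPE('n)"
  let ?B = "Pi\<^sub>E (free_indices :: 'n set) (\<lambda>_. {0..e})"
  let ?k = "t ^ ?d * exp (t * energy TYPE('n)) * ((1 - exp (- t)) ^ ?d * exp (- (?N ^ 3 / 4)))"
  let ?l = "\<lambda>x. (2 * t) *\<^sub>R center ?r + sqrt t *\<^sub>R (trace_free x :: 'n rvec)"
  have et: "0 \<le> 1 - exp (- t)" using t by simp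
  have pt: "?k \<le> heat_weight t (?l x)" if x: "x \<in> ?B" for x
  proof -
    define y where "y = (trace_free x :: 'n rvec)"
    define l where "l = ?l x"
    have y: "\<bar>y $ j\<bar> \<le> ?N * e" for j
      unfolding y_def using x e by (intro abs_trace_free_le) (auto simp: PiE_def Pi_def)
    have gap: "t \<le> l $ j - l $ i" if ij: "i < j" for i j
    proof -
      have "?r i < ?r j" using ij by (intro rank_of_less) (simp add: precedes_def)
      then have "1 \<le> real (?r j) - real (?r i)" by simp
      then have "2 * t * 1 \<le> 2 * t * (real (?r j) - real (?r i))" using t by (intro mult_left_mono) auto
      moreover have "- (2 * ?N * e) \<le> y $ j - y $ i" using y[of j] y[of i] by (simp add: abs_le_iff)
      then have "sqrt t * - (2 * ?N * e) \<le> sqrt t * (y $ j - y $ i)" using t by (intro mult_left_mono) auto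
      moreover have "sqrt t * (2 * ?N * e) \<le> sqrt t * sqrt t" using t e by (intro mult_left_mono) auto
      moreover have "sqrt t * sqrt t = t" using t by simp
      moreover have "l $ j - l $ i = 2 * t * (center ?r $ j - center ?r $ i) + sqrt t * (y $ j - y $ i)"
        by (simp add: l_def y_def algebra_simps)
      ultimately show ?thesis unfolding center_diff by linarith
    qed
    then have lt: "l $ i < l $ j" if "i < j" for i j using t that by (meson diff_gt_0_iff_gt less_le_trans)
    have "(\<Sum>j\<in>UNIV. (y $ j)\<^sup>2) \<le> (\<Sum>j\<in>(UNIV :: 'n set). ?N\<^sup>2)"
    proof (rule sum_mono)
      fix j
      have "?N * e \<le> ?N" using mult_left_mono[of e 1 ?N] e by simp
      then have "\<bar>y $ j\<bar> \<le> ?N" using y[of j] by linarith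
      then show "(y $ j)\<^sup>2 \<le> ?N\<^sup>2" using abs_le_square_iff[of "y $ j" ?N] by simp
    qed
    then have sq: "(\<Sum>j\<in>UNIV. (y $ j)\<^sup>2) \<le> ?N ^ 3" by (simp add: power2_eq_square power3_eq_cube)
    have "?k = t ^ ?d * (exp (t * energy TYPE('n)) * exp (- (?N ^ 3 / 4)) * (1 - exp (- t)) ^ ?d)"
      by (simp only: ac_simps)
    also have "exp (t * energy TYPE('n)) * exp (- (?N ^ 3 / 4)) \<le> exp (t * energy TYPE('n) - (\<Sum>j\<in>UNIV. (y $ j)\<^sup>2) / 4)"
      using sq by (simp add: exp_add[symmetric])
    also have "t * energy TYPE('n) - (\<Sum>j\<in>UNIV. (y $ j)\<^sup>2) / 4 = (\<Sum>j\<in>UNIV. real (rank_of l j) * l $ j) + (- (1 / (4 * t)) * (\<Sum>j\<in>UNIV. (l $ j)\<^sup>2))"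
      using heat_exponent[OF rank_of_ranks t, of y 0] rank_of_eq_zero[OF lt]
      by (simp add: l_def y_def trace_free_sum)
    finally have "?k \<le> t ^ ?d * ((exp (\<Sum>j\<in>UNIV. real (rank_of l j) * l $ j) * (1 - exp (- t)) ^ ?d) * exp (- (1 / (4 * t)) * (\<Sum>j\<in>UNIV. (l $ j)\<^sup>2)))"
      using t et unfolding exp_add by (simp add: ac_simps mult_left_mono mult_right_mono)
    also have "\<dots> \<le> vandermonde (\<lambda>j. l $ j) * (vandermonde (\<lambda>j. exp (l $ j)) * exp (- (1 / (4 * t)) * (\<Sum>j\<in>UNIV. (l $ j)\<^sup>2)))"
    proof (rule mult_mono)
      show v: "t ^ ?d \<le> vandermonde (\<lambda>j. l $ j)" using t gap by (intro vandermonde_ge) auto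
      then show "0 \<le> vandermonde (\<lambda>j. l $ j)" using t by (meson order_trans zero_le_power less_imp_le)
      show "exp (\<Sum>j\<in>UNIV. real (rank_of l j) * l $ j) * (1 - exp (- t)) ^ ?d * exp (- (1 / (4 * t)) * (\<Sum>j\<in>UNIV. (l $ j)\<^sup>2))
        \<le> vandermonde (\<lambda>j. exp (l $ j)) * exp (- (1 / (4 * t)) * (\<Sum>j\<in>UNIV. (l $ j)\<^sup>2))"
        using t gap lt by (intro mult_right_mono vandermonde_exp_ge) auto
      show "0 \<le> exp (\<Sum>j\<in>UNIV. real (rank_of l j) * l $ j) * (1 - exp (- t)) ^ ?d * exp (- (1 / (4 * t)) * (\<Sum>j\<in>UNIV. (l $ j)\<^sup>2))"
        using et by (intro mult_nonneg_nonneg) auto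
    qed
    finally show ?thesis by (simp add: heat_weight_def l_def mult.assoc)
  qed
  have Bs: "?B \<in> sets (free_lborel :: ('n \<Rightarrow> real) measure)" by (intro sets_PiM_I_finite) auto
  have eB: "emeasure (free_lborel :: ('n \<Rightarrow> real) measure) ?B = ennreal (e ^ card (free_indices :: 'n set))"
    using e by (subst lborel_product.emeasure_PiM) (auto simp: ennreal_power)
  then have mB: "measure (free_lborel :: ('n \<Rightarrow> real) measure) ?B = e ^ card (free_indices :: 'n set)"
    using e by (simp add: measure_def)
  have wm: "integrable (free_lborel :: ('n \<Rightarrow> real) measure) (\<lambda>x. heat_weight t (?l x))"
  proof -
    have "integrable free_lborel (\<lambda>x. heat_weight t (trace_free x :: 'n rvec))"
      using heat_weight_integrable[OF t] by (subst (asm) integral_trace_free_lborel(2)) auto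
    then have "integrable free_lborel (\<lambda>x. heat_weight t (trace_free (\<lambda>i\<in>free_indices. ((2 * t) *\<^sub>R center ?r) $ i + sqrt t * x i) :: 'n rvec))"
      using t by (intro integral_PiM_lborel_affine(2)) auto
    then show ?thesis
      by (subst (asm) trace_free_affine) (auto simp: sum_distrib_left[symmetric] center_sum)
  qed
  have "?k * e ^ card (free_indices :: 'n set) = (\<integral>x. ?k * indicator ?B x \<partial>free_lborel)"
    using mB Bs by simp
  also have "\<dots> \<le> (\<integral>x. heat_weight t (?l x) \<partial>free_lborel)"
  proof (rule integral_mono)
    show "integrable free_lborel (\<lambda>x. ?k * indicator ?B x)"
      using Bs eB by (intro integrable_mult_right integrable_real_indicator) auto
    fix x :: "'n \<Rightarrow> real"
    show "?k * indicator ?B x \<le> heat_weight t (?l x)"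
      using pt[of x] heat_weight_nonneg[of t "?l x"] by (auto simp: indicator_def)
  qed (rule wm)
  finally have "sqrt t ^ card (free_indices :: 'n set) * (?k * e ^ card (free_indices :: 'n set))
     \<le> sqrt t ^ card (free_indices :: 'n set) * (\<integral>x. heat_weight t (?l x) \<partial>free_lborel)"
    using t by (intro mult_left_mono) auto
  also have "\<dots> = (\<integral>l. heat_weight t (l :: 'n rvec) \<partial>trace_free_lborel)"
    using t by (intro integral_trace_free_affine[symmetric]) (auto simp: sum_distrib_left[symmetric] center_sum)
  finally show ?thesis by (simp only: heat_scale_def ac_simps)
qed

definition heat_mass :: "'n::{finite,linorder} itself \<Rightarrow> real \<Rightarrow> real" where
  "heat_mass _ t = (\<integral>l. heat_weight t (l :: 'n rvec) \<partial>trace_free_lborel)"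

lemma heat_scale_pos: "0 < t \<Longrightarrow> 0 < heat_scale T t"
  by (simp add: heat_scale_def)

text \<open>For small \<open>t\<close> the side \<open>e\<close> of the cube has to shrink with
  \<open>sqrt t\<close>, which costs uniformity but not positivity.\<close>

lemma heat_mass_pos:
  assumes t: "0 < t" shows "0 < heat_mass TYPE('n::{finite,linorder}) t"
proof -
  define e where "e = min 1 (sqrt t / (2 * real CARD('n)))"
  have e: "0 < e" "e \<le> 1" "2 * real CARD('n) * e \<le> sqrt t"
  proof -
    show "0 < e" "e \<le> 1" using t by (auto simp: e_def)
    have "2 * real CARD('n) * e \<le> 2 * real CARD('n) * (sqrt t / (2 * real CARD('n)))"
      unfolding e_def by (intro mult_left_mono) auto
    then show "2 * real CARD('n) * e \<le> sqrt t" by simp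
  qed
  have "0 < heat_scale TYPE('n) t * ((1 - exp (- t)) ^ num_pairs TYPE('n) * exp (- (real CARD('n) ^ 3 / 4)) * e ^ card (free_indices :: 'n set))"
    using t e heat_scale_pos[OF t] by (intro mult_pos_pos zero_less_power) auto
  then show ?thesis using heat_integral_ge[OF t e] unfolding heat_mass_def by linarith
qed

text \<open>Once \<open>sqrt t \<ge> 2 * N\<close> the cube of side 1 is admissible and
  \<open>exp (- t) \<le> 1/2\<close>, so the mass stays above a fixed multiple of its scale.\<close>

lemma heat_mass_ge:
  assumes t: "4 * (real CARD('n::{finite,linorder}))\<^sup>2 \<le> t"
  shows "heat_scale TYPE('n) t * ((1 / 2) ^ num_pairs TYPE('n) * exp (- (real CARD('n) ^ 3 / 4))) \<le> heat_mass TYPE('n) t"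
proof -
  let ?N = "real CARD('n)"
  have N: "1 \<le> ?N" by (simp add: Suc_leI)
  then have "1 \<le> ?N\<^sup>2" by (rule one_le_power)
  then have t4: "4 \<le> t" using t by linarith
  then have t0: "0 < t" by simp
  have e: "2 * ?N * 1 \<le> sqrt t" using t by (intro real_le_rsqrt) (simp add: power_mult_distrib)
  have "1 + t \<le> exp t" by (rule exp_ge_add_one_self)
  then have "2 \<le> exp t" using t4 by linarith
  then have "exp (- t) \<le> 1 / 2" by (simp add: exp_minus field_simps)
  then have "(1 / 2) ^ num_pairs TYPE('n) \<le> (1 - exp (- t)) ^ num_pairs TYPE('n)" by (intro power_mono) auto
  then have "heat_scale TYPE('n) t * ((1 / 2) ^ num_pairs TYPE('n) * exp (- (?N ^ 3 / 4)))
     \<le> heat_scale TYPE('n) t * ((1 - exp (- t)) ^ num_pairs TYPE('n) * exp (- (?N ^ 3 / 4)))"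
    using heat_scale_pos[OF t0, of "TYPE('n)"] by (intro mult_left_mono mult_right_mono) auto
  then show ?thesis
    using heat_integral_ge[OF t0 _ _ e] unfolding heat_mass_def by simp
qed

text \<open>The numerator is at most a finite sum of rank weight integrals, each negligible against
  \<open>heat_scale\<close>, while the denominator is at least a fixed multiple of
  \<open>heat_scale\<close>. So decay of \<open>f\<close> at distance \<open>sqrt t\<close> around
  each centre is all that matters.\<close>

lemma heat_average_limit:
  fixes f :: "'n::{finite,linorder} rvec \<Rightarrow> real"
  assumes [measurable]: "f \<in> borel_measurable borel" and f: "\<And>l. \<bar>f l\<bar> \<le> C"
    and lim: "\<And>r y. r \<in> ranks \<Longrightarrow> ((\<lambda>t. f ((2 * t) *\<^sub>R center r + sqrt t *\<^sub>R y)) \<longlongrightarrow> 0) at_top"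
  shows "((\<lambda>t. (\<integral>l. heat_weight t l * f l \<partial>trace_free_lborel) / heat_mass TYPE('n) t) \<longlongrightarrow> 0) at_top"
proof -
  define k where "k = (1 / 2) ^ num_pairs TYPE('n) * exp (- (real CARD('n) ^ 3 / 4))"
  have k: "0 < k" by (simp add: k_def)
  let ?R = "\<lambda>t. \<Sum>r\<in>ranks. (\<integral>l. rank_weight r t l * \<bar>f l\<bar> \<partial>trace_free_lborel) / heat_scale TYPE('n) t"
  show ?thesis
  proof (rule Lim_null_comparison)
    have "((\<lambda>t. ?R t / k) \<longlongrightarrow> (\<Sum>r\<in>(ranks :: ('n \<Rightarrow> nat) set). 0) / k) at_top"
      using k f lim by (intro tendsto_divide tendsto_sum tendsto_const rank_weight_integral_limit tendsto_rabs_zero) auto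
    then show "((\<lambda>t. ?R t / k) \<longlongrightarrow> 0) at_top" by simp
    show "\<forall>\<^sub>F t in at_top. norm ((\<integral>l. heat_weight t l * f l \<partial>trace_free_lborel) / heat_mass TYPE('n) t) \<le> ?R t / k"
      using eventually_ge_at_top[of "4 * (real CARD('n))\<^sup>2"] eventually_gt_at_top[of 0]
    proof eventually_elim
      case (elim t)
      have fb: "\<bar>\<bar>f l\<bar>\<bar> \<le> C * exp (0 * one_norm l)" for l using f[of l] by simp
      have int: "integrable trace_free_lborel (\<lambda>l. heat_weight t l * \<bar>f l\<bar>)"
        by (rule integrable_heat_weight[OF elim(2) _ fb]) measurable
      have rint: "integrable trace_free_lborel (\<lambda>l. rank_weight r t l * \<bar>f l\<bar>)" if "r \<in> ranks" for r
        by (rule integrable_rank_weight[OF that elim(2) _ fb]) measurable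
      have "\<bar>\<integral>l. heat_weight t l * f l \<partial>trace_free_lborel\<bar> \<le> (\<integral>l. \<bar>heat_weight t l * f l\<bar> \<partial>trace_free_lborel)"
        by (rule integral_abs_bound)
      also have "\<dots> = (\<integral>l. heat_weight t l * \<bar>f l\<bar> \<partial>trace_free_lborel)"
        by (simp add: abs_mult heat_weight_nonneg)
      also have "\<dots> \<le> (\<integral>l. (\<Sum>r\<in>ranks. rank_weight r t l * \<bar>f l\<bar>) \<partial>trace_free_lborel)"
        unfolding sum_distrib_right[symmetric]
      proof (rule integral_mono[OF int])
        show "integrable trace_free_lborel (\<lambda>l. (\<Sum>r\<in>ranks. rank_weight r t l) * \<bar>f l\<bar>)"
          unfolding sum_distrib_right by (rule Bochner_Integration.integrable_sum) (rule rint)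
      qed (auto intro!: mult_right_mono heat_weight_le)
      also have "\<dots> = (\<Sum>r\<in>ranks. \<integral>l. rank_weight r t l * \<bar>f l\<bar> \<partial>trace_free_lborel)"
        by (rule Bochner_Integration.integral_sum) (rule rint)
      also have "\<dots> = ?R t * heat_scale TYPE('n) t"
        using heat_scale_pos[OF elim(2), of "TYPE('n)"] by (simp add: sum_distrib_right)
      finally have num: "\<bar>\<integral>l. heat_weight t l * f l \<partial>trace_free_lborel\<bar> \<le> ?R t * heat_scale TYPE('n) t" .
      have "\<bar>\<integral>l. heat_weight t l * f l \<partial>trace_free_lborel\<bar> / heat_mass TYPE('n) t \<le> (?R t * heat_scale TYPE('n) t) / (heat_scale TYPE('n) t * k)"
        using num heat_mass_ge[OF elim(1)] heat_scale_pos[OF elim(2), of "TYPE('n)"] k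
        by (intro frac_le) (auto simp: k_def intro: order_trans[OF abs_ge_zero num])
      also have "\<dots> = ?R t / k" using heat_scale_pos[OF elim(2), of "TYPE('n)"] by simp
      finally show ?case using heat_mass_pos[OF elim(2), where 'n = 'n] by (simp add: abs_divide)
    qed
  qed
qed

text \<open>An image of a sigma-finite measure need not be sigma-finite. Here
  \<open>trace_free\<close> keeps the free coordinates, so sets bounded in those coordinates pull
  back into boxes of finite volume.\<close>

lemma sigma_finite_trace_free_lborel: "sigma_finite_measure (trace_free_lborel :: 'n::{finite,linorder} rvec measure)"
proof
  define B where "B k = {l :: 'n rvec. \<forall>i\<in>free_indices. \<bar>l $ i\<bar> \<le> real k}" for k :: nat
  have B: "B k \<in> sets borel" for k
  proof -
    have "{l :: 'n rvec. \<bar>l $ i\<bar> \<le> real k} \<in> sets borel" for i by measurable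
    moreover have "B k = (\<Inter>i\<in>free_indices. {l. \<bar>l $ i\<bar> \<le> real k}) \<inter> UNIV" by (auto simp: B_def)
    ultimately show ?thesis
      by (cases "free_indices = ({} :: 'n set)") (auto intro!: sets.finite_INT)
  qed
  have "emeasure trace_free_lborel (B k) \<noteq> \<infinity>" for k
  proof -
    have "emeasure trace_free_lborel (B k) = emeasure (free_lborel :: ('n \<Rightarrow> real) measure) (trace_free -` B k \<inter> space free_lborel)"
      unfolding trace_free_lborel_def by (rule emeasure_distr) (auto simp: B)
    also have "\<dots> \<le> emeasure (free_lborel :: ('n \<Rightarrow> real) measure) (Pi\<^sub>E free_indices (\<lambda>_. {- real k..real k}))"
    proof (rule emeasure_mono)
      show "trace_free -` B k \<inter> space free_lborel \<subseteq> Pi\<^sub>E free_indices (\<lambda>_. {- real k..real k})"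
      proof
        fix x assume "x \<in> trace_free -` B k \<inter> space free_lborel"
        then have x: "x \<in> extensional free_indices" "\<And>i. i \<in> free_indices \<Longrightarrow> \<bar>x i\<bar> \<le> real k"
          by (auto simp: B_def space_PiM trace_free_def PiE_def)
        have "x i \<in> {- real k..real k}" if "i \<in> free_indices" for i using x(2)[OF that] unfolding atLeastAtMost_iff by linarith
        then show "x \<in> Pi\<^sub>E free_indices (\<lambda>_. {- real k..real k})" using x(1) by (simp add: PiE_def)
      qed
      show "Pi\<^sub>E (free_indices :: 'n set) (\<lambda>_. {- real k..real k}) \<in> sets free_lborel"
        by (intro sets_PiM_I_finite) auto
    qed
    also have "\<dots> = (\<Prod>i\<in>(free_indices :: 'n set). emeasure lborel {- real k..real k})"
      by (rule lborel_product.emeasure_PiM) auto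
    also have "\<dots> < \<infinity>" by (simp add: ennreal_power[symmetric] less_top[symmetric] ennreal_power)
    finally show ?thesis by simp
  qed
  moreover have "(\<Union>k. B k) = UNIV"
  proof -
    have "l \<in> (\<Union>k. B k)" for l
    proof -
      obtain k where k: "one_norm l \<le> real k" using real_arch_simple by blast
      have "\<bar>l $ i\<bar> \<le> real k" for i
        using member_le_sum[of i UNIV "\<lambda>i. \<bar>l $ i\<bar>"] k by simp
      then show ?thesis by (auto simp: B_def)
    qed
    then show ?thesis by blast
  qed
  ultimately show "\<exists>A. countable A \<and> A \<subseteq> sets (trace_free_lborel :: 'n rvec measure) \<and> \<Union> A = space trace_free_lborel \<and> (\<forall>a\<in>A. emeasure trace_free_lborel a \<noteq> \<infinity>)"
    using B by (intro exI[of _ "range B"]) auto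
qed

lemma polar_entry: "polar l A $ i $ j = (\<Sum>k\<in>UNIV. cnj (A $ k $ i) * complex_of_real (exp (l $ k)) * A $ k $ j)"
proof -
  have "(hadjoint A ** (\<chi> i j. if i = j then complex_of_real (exp (l $ i)) else 0)) $ i $ k = cnj (A $ k $ i) * complex_of_real (exp (l $ k))" for k
    by (simp add: matrix_matrix_mult_def hadjoint_def if_distrib[where f = "\<lambda>x. _ * x"] cong: if_cong)
  then show ?thesis by (simp add: polar_def matrix_matrix_mult_def)
qed

lemma norm_of_inverse_norm:
  fixes u :: "'n::finite cvec"
  assumes "u \<noteq> 0" shows "norm (complex_of_real (inverse (norm u)) *s u) = 1"
proof -
  have "norm (complex_of_real (inverse (norm u)) *s u) = cmod (complex_of_real (inverse (norm u))) * norm u"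
    unfolding norm_vec_def by (simp add: norm_mult L2_set_right_distrib)
  then show ?thesis using assms by (simp add: norm_inverse)
qed

lemma Re_complex_of_real_mult: "Re (complex_of_real x * z) = x * Re z"
  by simp

section \<open>The two-point function\<close>

locale heat_setting = haar_measure H for H :: "('n::{finite,linorder} cmat) measure"
begin

sublocale T: sigma_finite_measure "trace_free_lborel :: 'n rvec measure"
  by (rule sigma_finite_trace_free_lborel)

sublocale P: pair_sigma_finite "trace_free_lborel :: 'n rvec measure" H ..

abbreviation joint :: "('n rvec \<times> 'n cmat) measure" where
  "joint \<equiv> trace_free_lborel \<Otimes>\<^sub>M H"

lemma joint_fst [measurable]: "(\<lambda>p. fst p $ i) \<in> borel_measurable joint"
  by measurable

lemma joint_entry [measurable]: "(\<lambda>p. snd p $ i $ j) \<in> borel_measurable joint"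
  by (rule measurable_compose[OF measurable_snd entry_measurable])

lemma qform_joint_measurable [measurable]: "(\<lambda>p. qform (fst p) (snd p) u) \<in> borel_measurable joint"
  unfolding qform_def matrix_vector_mult_def vec_lambda_beta by measurable

lemma cnj_borel_measurable [measurable]: "cnj \<in> borel_measurable borel"
  by (rule borel_measurable_continuous_onI) (intro continuous_intros)

lemma polar_measurable [measurable]: "(\<lambda>p. polar (fst p) (snd p)) \<in> borel_measurable joint"
  by (intro measurable_vec, unfold polar_entry) measurable

lemma diag_form_joint_measurable [measurable]: "(\<lambda>p. diag_form (fst p) (snd p) a) \<in> borel_measurable joint"
  unfolding diag_form_def by measurable

lemma off_form_joint_measurable [measurable]: "(\<lambda>p. off_form (fst p) (snd p) a b) \<in> borel_measurable joint"
  unfolding off_form_def by measurable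

lemma form_slope_joint_measurable [measurable]: "(\<lambda>p. form_slope (fst p) (snd p) a b \<rho>) \<in> borel_measurable joint"
  unfolding form_slope_def circle_slope_def circle_disc_def by measurable

lemma form_log_joint_measurable [measurable]: "(\<lambda>p. form_log (fst p) (snd p) a b \<rho>) \<in> borel_measurable joint"
  unfolding form_log_def circle_log_def circle_disc_def by measurable

lemma fiber_integral_measurable:
  fixes f :: "'n rvec \<times> 'n cmat \<Rightarrow> real"
  assumes "f \<in> borel_measurable joint"
  shows "(\<lambda>l. \<integral>A. f (l, A) \<partial>H) \<in> borel_measurable borel"
proof -
  have "(\<lambda>l. \<integral>A. f (l, A) \<partial>H) \<in> borel_measurable (trace_free_lborel :: 'n rvec measure)"
    using assms by (intro borel_measurable_lebesgue_integral) (simp add: case_prod_unfold)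
  then show ?thesis by (simp cong: measurable_cong_sets)
qed

text \<open>As \<open>H\<close> has mass 1, the normalizing factor is the inverse of
  \<open>heat_mass\<close>, and Fubini puts the Haar integral inside. Growth like
  \<open>exp (K * one_norm l)\<close> is admissible because the Gaussian weight beats it.\<close>

lemma heat_measure_integral:
  fixes g :: "'n cmat \<Rightarrow> real"
  assumes t: "0 < t" and g: "g \<in> borel_measurable borel"
    and bd: "\<And>l A. unitary A \<Longrightarrow> \<bar>g (polar l A)\<bar> \<le> C * exp (K * one_norm l)"
  shows "(\<integral>P. g P \<partial>heat_measure H t) = (\<integral>l. heat_weight t l * (\<integral>A. g (polar l A) \<partial>H) \<partial>trace_free_lborel) / heat_mass TYPE('n) t"
proof -
  let ?Z = "heat_mass TYPE('n) t"
  note [measurable] = g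
  have Z: "0 < ?Z" by (rule heat_mass_pos[OF t])
  have gm [measurable]: "(\<lambda>p. g (polar (fst p) (snd p))) \<in> borel_measurable joint" by measurable
  have wm [measurable]: "(\<lambda>p. heat_weight t (fst p)) \<in> borel_measurable joint" by measurable
  have raw: "heat_measure_raw H t = density joint (\<lambda>p. ennreal (heat_weight t (fst p)))"
    by (simp add: heat_measure_raw_def case_prod_unfold)
  have "emeasure (heat_measure_raw H t) (space (heat_measure_raw H t)) = (\<integral>\<^sup>+p. ennreal (heat_weight t (fst p)) \<partial>joint)"
    unfolding raw space_density by (subst emeasure_density[OF _ sets.top]) (auto intro!: nn_integral_cong)
  also have "\<dots> = (\<integral>\<^sup>+l. \<integral>\<^sup>+A. ennreal (heat_weight t l) \<partial>H \<partial>(trace_free_lborel :: 'n rvec measure))"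
    by (subst nn_integral_fst[symmetric]) auto
  also have "\<dots> = (\<integral>\<^sup>+l. ennreal (heat_weight t l) \<partial>(trace_free_lborel :: 'n rvec measure))"
    by (simp add: emeasure_space_1)
  also have "\<dots> = ennreal ?Z"
    unfolding heat_mass_def by (rule nn_integral_eq_integral[OF heat_weight_integrable[OF t]]) (simp add: heat_weight_nonneg)
  finally have em: "inverse (emeasure (heat_measure_raw H t) (space (heat_measure_raw H t))) = ennreal (1 / ?Z)"
    using Z by (simp add: inverse_ennreal inverse_eq_divide)
  have scale: "scale_measure (ennreal (1 / ?Z)) (heat_measure_raw H t) = density joint (\<lambda>p. ennreal (1 / ?Z * heat_weight t (fst p)))"
  proof (rule measure_eqI)
    fix X assume "X \<in> sets (scale_measure (ennreal (1 / ?Z)) (heat_measure_raw H t))"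
    then have X [measurable]: "X \<in> sets joint" by (simp add: raw)
    have "emeasure (scale_measure (ennreal (1 / ?Z)) (heat_measure_raw H t)) X = ennreal (1 / ?Z) * (\<integral>\<^sup>+p. ennreal (heat_weight t (fst p)) * indicator X p \<partial>joint)"
      unfolding raw using X by (simp add: emeasure_density)
    also have "\<dots> = (\<integral>\<^sup>+p. ennreal (1 / ?Z) * (ennreal (heat_weight t (fst p)) * indicator X p) \<partial>joint)"
      by (intro nn_integral_cmult[symmetric]) measurable
    also have "\<dots> = (\<integral>\<^sup>+p. ennreal (1 / ?Z * heat_weight t (fst p)) * indicator X p \<partial>joint)"
    proof (rule nn_integral_cong)
      fix p :: "'n rvec \<times> 'n cmat"
      have "ennreal (1 / ?Z * heat_weight t (fst p)) = ennreal (1 / ?Z) * ennreal (heat_weight t (fst p))"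
        using Z by (intro ennreal_mult) (auto simp: heat_weight_nonneg)
      then show "ennreal (1 / ?Z) * (ennreal (heat_weight t (fst p)) * indicator X p) = ennreal (1 / ?Z * heat_weight t (fst p)) * indicator X p"
        by (simp only: mult.assoc)
    qed
    also have "\<dots> = emeasure (density joint (\<lambda>p. ennreal (1 / ?Z * heat_weight t (fst p)))) X"
      using X by (simp add: emeasure_density)
    finally show "emeasure (scale_measure (ennreal (1 / ?Z)) (heat_measure_raw H t)) X = emeasure (density joint (\<lambda>p. ennreal (1 / ?Z * heat_weight t (fst p)))) X" .
  qed (simp add: raw)
  have hm: "heat_measure H t = distr (density joint (\<lambda>p. ennreal (1 / ?Z * heat_weight t (fst p)))) borel (\<lambda>p. polar (fst p) (snd p))"
    by (simp only: heat_measure_def em scale case_prod_unfold)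
  have int: "integrable joint (\<lambda>p. heat_weight t (fst p) * g (polar (fst p) (snd p)))"
  proof (rule Bochner_Integration.integrable_bound)
    have b: "integrable trace_free_lborel (\<lambda>l :: 'n rvec. heat_weight t l * (C * exp (K * one_norm l)))"
    proof (rule integrable_heat_weight[OF t])
      show "\<bar>C * exp (K * one_norm l)\<bar> \<le> \<bar>C\<bar> * exp (K * one_norm l)" for l :: "'n rvec"
        by (simp add: abs_mult)
    qed measurable
    show "integrable joint (\<lambda>p. heat_weight t (fst p) * (C * exp (K * (\<Sum>j\<in>UNIV. \<bar>fst p $ j\<bar>))))"
    proof (rule P.Fubini_integrable)
      show "integrable trace_free_lborel (\<lambda>l :: 'n rvec. \<integral>A. norm (heat_weight t (fst (l, A)) * (C * exp (K * (\<Sum>j\<in>UNIV. \<bar>fst (l, A) $ j\<bar>)))) \<partial>H)"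
        using integrable_abs[OF b] by (simp add: prob_space)
    qed auto
    show "AE p in joint. norm (heat_weight t (fst p) * g (polar (fst p) (snd p))) \<le> norm (heat_weight t (fst p) * (C * exp (K * (\<Sum>j\<in>UNIV. \<bar>fst p $ j\<bar>))))"
    proof (intro AE_I2)
      fix p assume "p \<in> space joint"
      then have "unitary (snd p)" by (auto simp: space_pair_measure space_H)
      from order_trans[OF bd[OF this, of "fst p"] abs_ge_self]
      have "\<bar>heat_weight t (fst p)\<bar> * \<bar>g (polar (fst p) (snd p))\<bar> \<le> \<bar>heat_weight t (fst p)\<bar> * \<bar>C * exp (K * (\<Sum>j\<in>UNIV. \<bar>fst p $ j\<bar>))\<bar>"
        by (rule mult_left_mono) simp
      then show "norm (heat_weight t (fst p) * g (polar (fst p) (snd p))) \<le> norm (heat_weight t (fst p) * (C * exp (K * (\<Sum>j\<in>UNIV. \<bar>fst p $ j\<bar>))))"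
        by (simp only: real_norm_def abs_mult)
    qed
  qed measurable
  have "(\<integral>P. g P \<partial>heat_measure H t) = (\<integral>p. (1 / ?Z * heat_weight t (fst p)) * g (polar (fst p) (snd p)) \<partial>joint)"
    unfolding hm using Z
    by (subst integral_distr) (auto simp: integral_density heat_weight_nonneg)
  also have "\<dots> = 1 / ?Z * (\<integral>p. heat_weight t (fst p) * g (polar (fst p) (snd p)) \<partial>joint)"
    by (simp only: mult.assoc integral_mult_right_zero)
  also have "(\<integral>p. heat_weight t (fst p) * g (polar (fst p) (snd p)) \<partial>joint) = (\<integral>l. \<integral>A. heat_weight t (fst (l, A)) * g (polar (fst (l, A)) (snd (l, A))) \<partial>H \<partial>trace_free_lborel)"
    by (rule P.integral_fst'[OF int, symmetric])
  finally show ?thesis by simp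
qed

section \<open>The correlation as a function of the Berezin kernel\<close>

definition fiber_corr :: "'n rvec \<Rightarrow> 'n cvec \<Rightarrow> 'n cvec \<Rightarrow> real" where
  "fiber_corr l u v = (\<integral>A. ln (qform l A u) * ln (qform l A v) \<partial>H)"

definition corr :: "real \<Rightarrow> 'n cvec \<Rightarrow> 'n cvec \<Rightarrow> real" where
  "corr t u v = (\<integral>l. heat_weight t l * fiber_corr l u v \<partial>trace_free_lborel) / heat_mass TYPE('n) t"

lemma qform_measurable [measurable]: "(\<lambda>A. qform l A u) \<in> borel_measurable H"
  unfolding qform_def matrix_vector_mult_def vec_lambda_beta by measurable

lemma square_le_exp: "0 \<le> (x::real) \<Longrightarrow> x * x \<le> exp (2 * x)"
proof -
  assume "0 \<le> x"
  moreover have "x \<le> exp x" using exp_ge_add_one_self[of x] by linarith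
  ultimately have "x * x \<le> exp x * exp x" by (intro mult_mono) auto
  then show ?thesis by (simp add: exp_add[symmetric])
qed

lemma ln_qform_product_bound:
  assumes "unitary A" "norm u = 1" "norm v = 1"
  shows "\<bar>ln (qform l A u) * ln (qform l A v)\<bar> \<le> 1 * exp (2 * one_norm l)"
proof -
  have "\<bar>ln (qform l A u) * ln (qform l A v)\<bar> \<le> one_norm l * one_norm l"
    unfolding abs_mult using assms by (intro mult_mono abs_ln_qform) (auto intro: sum_nonneg)
  also have "\<dots> \<le> exp (2 * one_norm l)" by (intro square_le_exp sum_nonneg) auto
  finally show ?thesis by simp
qed

lemma herm_form_measurable [measurable]: "(\<lambda>P. herm_form P u v) \<in> borel_measurable borel"
  unfolding herm_form_def by (rule borel_measurable_continuous_onI) (intro continuous_intros)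

lemma heat_measure_corr:
  assumes t: "0 < t" and u: "norm u = 1" and v: "norm v = 1"
  shows "(\<integral>P. ln (Re (herm_form P u u)) * ln (Re (herm_form P v v)) \<partial>heat_measure H t) = corr t u v"
proof -
  have "(\<integral>P. ln (Re (herm_form P u u)) * ln (Re (herm_form P v v)) \<partial>heat_measure H t)
     = (\<integral>l. heat_weight t l * (\<integral>A. ln (Re (herm_form (polar l A) u u)) * ln (Re (herm_form (polar l A) v v)) \<partial>H) \<partial>trace_free_lborel) / heat_mass TYPE('n) t"
  proof (rule heat_measure_integral[OF t, where C = 1 and K = 2])
    show "\<bar>ln (Re (herm_form (polar l A) u u)) * ln (Re (herm_form (polar l A) v v))\<bar> \<le> 1 * exp (2 * one_norm l)"
      if "unitary A" for l A
      using ln_qform_product_bound[OF that u v, of l] by (simp only: herm_form_polar Re_complex_of_real)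
    show "(\<lambda>P. ln (Re (herm_form P u u)) * ln (Re (herm_form P v v))) \<in> borel_measurable borel" by measurable
  qed
  then show ?thesis by (simp add: corr_def fiber_corr_def herm_form_polar)
qed

lemma fiber_corr_unitary:
  assumes "unitary V" shows "fiber_corr l (V *v u) (V *v v) = fiber_corr l u v"
proof -
  have "fiber_corr l u v = (\<integral>A. ln (qform l (A ** V) u) * ln (qform l (A ** V) v) \<partial>H)"
    unfolding fiber_corr_def by (rule integral_translate[symmetric, OF assms]) measurable
  then show ?thesis by (simp add: fiber_corr_def qform_mult)
qed

text \<open>\<open>unitary_pair_transitive\<close> aligns the two pairs up to a phase, which the
  form does not see, and Haar measure absorbs the unitary matrix.\<close>

lemma corr_eq:
  assumes "norm u = 1" "norm v = 1" "norm u' = 1" "norm v' = 1" "cmod (cinner u v) = cmod (cinner u' v')"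
  shows "corr t u v = corr t u' v'"
proof -
  obtain V \<omega> where V: "unitary V" "cmod \<omega> = 1" "V *v u = u'" "V *v v = \<omega> *s v'"
    by (rule unitary_pair_transitive[of u u' v v']) (use assms in auto)
  have "fiber_corr l u v = fiber_corr l u' v'" for l
  proof -
    have "fiber_corr l u v = fiber_corr l u' (\<omega> *s v')" using fiber_corr_unitary[OF V(1), of l u v] V by simp
    then show ?thesis by (simp add: fiber_corr_def qform_scale V(2))
  qed
  then show ?thesis by (simp add: corr_def)
qed

lemma I2_eq_corr:
  assumes t: "0 < t" and u: "norm u = 1" and v: "norm v = 1"
  shows "I2 H t ((cmod (cinner u v))\<^sup>2) = corr t u v"
  unfolding I2_def
proof (rule the_equality)
  show "\<forall>u' v'. norm u' = 1 \<and> norm v' = 1 \<and> (cmod (cinner u' v'))\<^sup>2 = (cmod (cinner u v))\<^sup>2 \<longrightarrow>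
      (\<integral>P. ln (Re (herm_form P u' u')) * ln (Re (herm_form P v' v')) \<partial>heat_measure H t) = corr t u v"
  proof (intro allI impI, elim conjE)
    fix u' v' :: "'n cvec"
    assume uv: "norm u' = 1" "norm v' = 1" "(cmod (cinner u' v'))\<^sup>2 = (cmod (cinner u v))\<^sup>2"
    then have "cmod (cinner u' v') = cmod (cinner u v)" by (simp add: power2_eq_iff_nonneg)
    then show "(\<integral>P. ln (Re (herm_form P u' u')) * ln (Re (herm_form P v' v')) \<partial>heat_measure H t) = corr t u v"
      using heat_measure_corr[OF t uv(1,2)] corr_eq[OF uv(1,2) u v, of t] by simp
  qed
next
  fix c
  assume "\<forall>u' v'. norm u' = 1 \<and> norm v' = 1 \<and> (cmod (cinner u' v'))\<^sup>2 = (cmod (cinner u v))\<^sup>2 \<longrightarrow>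
      (\<integral>P. ln (Re (herm_form P u' u')) * ln (Re (herm_form P v' v')) \<partial>heat_measure H t) = c"
  \<comment> \<open>The pair \<open>u\<close>, \<open>v\<close> itself shows that the condition is
    not vacuous, so the described value is unique.\<close>
  from this[rule_format, of u v] show "c = corr t u v" using u v heat_measure_corr[OF t u v] by simp
qed

lemma two_point_unit:
  assumes "0 < t" "norm u = 1" "norm v = 1"
  shows "two_point H t u v = I2 H t ((cmod (cinner u v))\<^sup>2)"
  using heat_measure_corr[OF assms] I2_eq_corr[OF assms] assms by (simp add: two_point_def)

lemma two_point_general:
  assumes t: "0 < t" and u: "u \<noteq> 0" and v: "v \<noteq> 0"
  shows "two_point H t u v = I2 H t ((cmod (cinner u v))\<^sup>2 / ((norm u)\<^sup>2 * (norm v)\<^sup>2))"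
proof -
  define c where "c w = complex_of_real (inverse (norm w))" for w :: "'n cvec"
  have c: "norm (c w *s w) = 1" if "w \<noteq> 0" for w using norm_of_inverse_norm[OF that] by (simp add: c_def)
  have h: "Re (herm_form P (c w *s w) (c w *s w)) = Re (herm_form P w w) / (norm w)\<^sup>2" for P w
  proof -
    have "herm_form P (c w *s w) (c w *s w) = complex_of_real ((inverse (norm w))\<^sup>2) * herm_form P w w"
      unfolding herm_form_cinner c_def
      by (simp add: vec.scale cinner_scale_left cinner_scale_right power2_eq_square)
    then have "Re (herm_form P (c w *s w) (c w *s w)) = (inverse (norm w))\<^sup>2 * Re (herm_form P w w)" by (simp only: Re_complex_of_real_mult)
    then show ?thesis by (simp add: power_inverse[symmetric] inverse_eq_divide power_divide)
  qed
  have "two_point H t u v = (\<integral>P. ln (Re (herm_form P (c u *s u) (c u *s u))) * ln (Re (herm_form P (c v *s v) (c v *s v))) \<partial>heat_measure H t)"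
    by (simp only: two_point_def h)
  also have "\<dots> = I2 H t ((cmod (cinner (c u *s u) (c v *s v)))\<^sup>2)"
    using heat_measure_corr[OF t c[OF u] c[OF v]] I2_eq_corr[OF t c[OF u] c[OF v]] by simp
  also have "(cmod (cinner (c u *s u) (c v *s v)))\<^sup>2 = (cmod (cinner u v))\<^sup>2 / ((norm u)\<^sup>2 * (norm v)\<^sup>2)"
  proof -
    have "cinner (c u *s u) (c v *s v) = complex_of_real (inverse (norm u) * inverse (norm v)) * cinner u v"
      by (simp add: cinner_scale_left cinner_scale_right c_def)
    then have "cmod (cinner (c u *s u) (c v *s v)) = cmod (cinner u v) / (norm u * norm v)"
      by (simp only: norm_mult norm_of_real) (simp add: abs_mult field_simps)
    then show ?thesis by (simp add: power_divide power_mult_distrib)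
  qed
  finally show ?thesis .
qed

text \<open>For \<open>u = e_a\<close> the factor \<open>ln (diag_form l A a)\<close> does not feel
  the phase of column \<open>b\<close>, so it can serve as \<open>f\<close> in
  \<open>qform_phase_average\<close>.\<close>

lemma I2_form_log:
  assumes t: "0 < t" and ab: "a \<noteq> b" and \<rho>: "0 < \<rho>" "\<rho> < 1"
  shows "I2 H t \<rho> = (\<integral>l. heat_weight t l * (\<integral>A. ln (diag_form l A a) * form_log l A a b \<rho> \<partial>H) \<partial>trace_free_lborel) / heat_mass TYPE('n) t"
proof -
  have n: "norm (axis a (1::complex)) = 1" "norm (mix_vec a b \<rho> 1) = 1"
    using norm_axis_one cinner_mix_vec(2)[OF ab, of \<rho> 1] \<rho> by auto
  have "(cmod (cinner (axis a 1) (mix_vec a b \<rho> 1)))\<^sup>2 = \<rho>"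
    using cinner_mix_vec(1)[OF ab, of \<rho> 1] \<rho> by simp
  then have "I2 H t \<rho> = corr t (axis a 1) (mix_vec a b \<rho> 1)"
    using I2_eq_corr[OF t n] by simp
  moreover have "fiber_corr l (axis a 1) (mix_vec a b \<rho> 1) = (\<integral>A. ln (diag_form l A a) * form_log l A a b \<rho> \<partial>H)" for l
    unfolding fiber_corr_def diag_form_qform[symmetric]
    by (rule qform_phase_average[OF integrable_ln_diag_form _ ab \<rho>]) (simp add: diag_form_phase)
  ultimately show ?thesis by (simp add: corr_def)
qed

lemma ln_diag_bound: "unitary A \<Longrightarrow> \<bar>ln (diag_form l A a)\<bar> \<le> one_norm l"
  unfolding diag_form_qform by (rule abs_ln_qform[OF _ norm_axis_one])

lemma fiber_log_deriv:
  assumes ab: "a \<noteq> b" and \<rho>: "0 < \<rho>" "\<rho> < 1"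
  shows "((\<lambda>y. \<integral>A. ln (diag_form l A a) * form_log l A a b y \<partial>H) has_real_derivative ln_slope_average l a b \<rho>) (at \<rho>)"
  unfolding ln_slope_average_def by (rule form_log_integral_deriv[OF integrable_ln_diag_form ab \<rho>])

lemma ln_slope_average_measurable [measurable]: "(\<lambda>l. ln_slope_average l a b \<rho>) \<in> borel_measurable borel"
proof -
  have "(\<lambda>p. ln (diag_form (fst p) (snd p) a) * ((1 - 2 * \<rho> + form_slope (fst p) (snd p) a b \<rho>) / (2 * \<rho> * (1 - \<rho>)))) \<in> borel_measurable joint"
    by measurable
  from fiber_integral_measurable[OF this] show ?thesis by (simp add: ln_slope_average_def)
qed

lemma fiber_log_measurable [measurable]: "(\<lambda>l. \<integral>A. ln (diag_form l A a) * form_log l A a b \<rho> \<partial>H) \<in> borel_measurable borel"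
proof -
  have "(\<lambda>p. ln (diag_form (fst p) (snd p) a) * form_log (fst p) (snd p) a b \<rho>) \<in> borel_measurable joint"
    by measurable
  from fiber_integral_measurable[OF this] show ?thesis by simp
qed

lemma fiber_log_bound:
  assumes ab: "a \<noteq> b" and \<rho>: "0 < \<rho>" "\<rho> < 1"
  shows "\<bar>\<integral>A. ln (diag_form l A a) * form_log l A a b \<rho> \<partial>H\<bar> \<le> 3 * exp (2 * one_norm l)"
proof -
  let ?s = "\<Sum>j\<in>UNIV. \<bar>l $ j\<bar>"
  have s: "0 \<le> ?s" by (rule sum_nonneg) auto
  have int: "integrable H (\<lambda>A. ln (diag_form l A a) * form_log l A a b \<rho>)"
    by (rule integrable_form_log[OF integrable_ln_diag_form ab \<rho>])
  have "\<bar>\<integral>A. ln (diag_form l A a) * form_log l A a b \<rho> \<partial>H\<bar> \<le> (\<integral>A. \<bar>ln (diag_form l A a) * form_log l A a b \<rho>\<bar> \<partial>H)"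
    by (rule integral_abs_bound)
  also have "\<dots> \<le> (\<integral>A. ?s * (?s + ln 2) \<partial>H)"
  proof (rule integral_mono)
    fix A assume "A \<in> space H"
    then have A: "unitary A" by (simp add: space_H)
    show "\<bar>ln (diag_form l A a) * form_log l A a b \<rho>\<bar> \<le> ?s * (?s + ln 2)"
      unfolding abs_mult using s by (intro mult_mono ln_diag_bound abs_form_log_le A ab \<rho>) auto
  qed (use int in auto)
  also have "\<dots> = ?s * ?s + ?s * ln 2" by (simp add: prob_space distrib_left)
  also have "\<dots> \<le> exp (2 * ?s) + exp (2 * ?s) * 1"
  proof (intro add_mono mult_mono square_le_exp s)
    show "?s \<le> exp (2 * ?s)" using exp_ge_add_one_self[of "2 * ?s"] s by linarith
    show "ln 2 \<le> (1::real)" using ln_le_minus_one[of "2::real"] by simp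
  qed auto
  also have "\<dots> \<le> 3 * exp (2 * ?s)" by simp
  finally show ?thesis .
qed

text \<open>Differentiation passes two integrals, over \<open>A\<close> and over \<open>l\<close>.
  For the outer one a constant multiple of the heat weight dominates, because
  \<open>ln_slope_average_bound\<close> is uniform in the exponents.\<close>

lemma I2_deriv:
  fixes a b :: 'n
  assumes t: "0 < t" and ab: "a \<noteq> b" and \<rho>: "0 < \<rho>" "\<rho> < 1"
  shows "(I2 H t has_real_derivative (\<integral>l. heat_weight t l * ln_slope_average l a b \<rho> \<partial>trace_free_lborel) / heat_mass TYPE('n) t) (at \<rho>)"
proof -
  define C where "C = (\<Sum>j\<in>UNIV. \<integral>A. \<bar>ln (entry_mass A j a)\<bar> \<partial>H)"
  have C: "0 \<le> C" unfolding C_def by (intro sum_nonneg) auto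
  have "((\<lambda>y. \<integral>l. heat_weight t l * (\<integral>A. ln (diag_form l A a) * form_log l A a b y \<partial>H) \<partial>trace_free_lborel)
      has_real_derivative (\<integral>l. heat_weight t l * ln_slope_average l a b \<rho> \<partial>trace_free_lborel)) (at \<rho>)"
  proof (rule has_derivative_integral_dominated[where a = "\<rho> / 2" and b = "(1 + \<rho>) / 2" and G = "\<lambda>l. heat_weight t l * (C * (4 / (\<rho> * (1 - \<rho>))))"])
    fix y assume y: "\<rho> / 2 < y" "y < (1 + \<rho>) / 2"
    then have y01: "0 < y" "y < 1" using \<rho> by auto
    show "integrable trace_free_lborel (\<lambda>l. heat_weight t l * (\<integral>A. ln (diag_form l A a) * form_log l A a b y \<partial>H))"
      by (rule integrable_heat_weight[OF t _ fiber_log_bound[OF ab y01]]) measurable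
    fix l :: "'n rvec"
    show "((\<lambda>y. heat_weight t l * (\<integral>A. ln (diag_form l A a) * form_log l A a b y \<partial>H)) has_real_derivative heat_weight t l * ln_slope_average l a b y) (at y)"
      by (intro DERIV_cmult fiber_log_deriv ab y01)
    have "\<bar>ln_slope_average l a b y\<bar> \<le> C * (1 / (y * (1 - y)))"
      using ln_slope_average_bound[OF ab y01, of l] by (simp add: C_def)
    also have "\<dots> \<le> C * (4 / (\<rho> * (1 - \<rho>)))" by (intro mult_left_mono slope_factor_bound \<rho> y C)
    finally show "\<bar>heat_weight t l * ln_slope_average l a b y\<bar> \<le> heat_weight t l * (C * (4 / (\<rho> * (1 - \<rho>))))"
      unfolding abs_mult abs_of_nonneg[OF heat_weight_nonneg] by (rule mult_left_mono) (rule heat_weight_nonneg)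
  next
    show "integrable trace_free_lborel (\<lambda>l :: 'n rvec. heat_weight t l * (C * (4 / (\<rho> * (1 - \<rho>)))))"
      using heat_weight_integrable[OF t] by (rule integrable_mult_left)
  qed (use \<rho> in auto)
  then have "((\<lambda>y. (\<integral>l. heat_weight t l * (\<integral>A. ln (diag_form l A a) * form_log l A a b y \<partial>H) \<partial>trace_free_lborel) / heat_mass TYPE('n) t)
      has_real_derivative (\<integral>l. heat_weight t l * ln_slope_average l a b \<rho> \<partial>trace_free_lborel) / heat_mass TYPE('n) t) (at \<rho>)"
    by (rule DERIV_cdivide)
  then show ?thesis
    by (rule has_field_derivative_transform_within_open[where S = "{0<..<1}"]) (use I2_form_log[OF t ab] \<rho> in auto)
qed

text \<open>Subtracting the expected limit reduces the claim to an average that tends to 0. Near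
  each centre the gaps below the top exponent grow linearly in \<open>t\<close> while the
  displacement is of order \<open>sqrt t\<close>, so \<open>ln_slope_average_limit\<close> gives the
  same value for every order \<open>r\<close>.\<close>

lemma I2_deriv_limit:
  fixes a b :: 'n
  assumes ab: "a \<noteq> b" and \<rho>: "0 < \<rho>" "\<rho> < 1"
  shows "((\<lambda>t. deriv (I2 H t) \<rho>) \<longlongrightarrow> - (ln (1 - \<rho>) / \<rho>)) at_top"
proof -
  define D where "D = - (ln (1 - \<rho>) / \<rho>)"
  define C where "C = (\<Sum>j\<in>UNIV. \<integral>A. \<bar>ln (entry_mass A j a)\<bar> \<partial>H) / (\<rho> * (1 - \<rho>))"
  have bound: "\<bar>ln_slope_average l a b \<rho>\<bar> \<le> C" for l unfolding C_def by (rule ln_slope_average_bound[OF ab \<rho>])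
  have "((\<lambda>t. (\<integral>l. heat_weight t l * (ln_slope_average l a b \<rho> - D) \<partial>trace_free_lborel) / heat_mass TYPE('n) t) \<longlongrightarrow> 0) at_top"
  proof (rule heat_average_limit)
    show "\<bar>ln_slope_average l a b \<rho> - D\<bar> \<le> C + \<bar>D\<bar>" for l using bound[of l] by linarith
    fix r :: "'n \<Rightarrow> nat" and y :: "'n rvec" assume r: "r \<in> ranks"
    then have bij: "bij_betw r UNIV {..<CARD('n)}" by (simp add: ranks_def)
    \<comment> \<open>Ranks start at 0, so the top exponent is the one of rank
      \<open>N - 1\<close>.\<close>
    have "CARD('n) - 1 \<in> {..<CARD('n)}" by simp
    then obtain j where j: "r j = CARD('n) - 1" using bij by (metis bij_betw_imp_surj_on imageE)
    let ?l = "\<lambda>t. (2 * t) *\<^sub>R center r + sqrt t *\<^sub>R y"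
    have "((\<lambda>t. ln_slope_average (?l t) a b \<rho>) \<longlongrightarrow> - (ln (1 - \<rho>) / \<rho>)) at_top"
    proof (rule ln_slope_average_limit[OF ab \<rho>])
      fix i assume ij: "i \<noteq> j"
      have "r i < CARD('n)" using bij by (auto simp: bij_betw_def)
      moreover have "r i \<noteq> r j" using bij ij by (auto simp: bij_betw_def inj_on_def)
      ultimately have k: "0 < real (r j) - real (r i)" using j by simp
      have "filterlim (\<lambda>t. 2 * t * (real (r j) - real (r i)) + sqrt t * (y $ j - y $ i)) at_top at_top"
        using k by real_asymp
      moreover have "?l t $ j - ?l t $ i = 2 * t * (real (r j) - real (r i)) + sqrt t * (y $ j - y $ i)" for t
        unfolding center_diff[symmetric] by (simp add: algebra_simps)
      ultimately show "filterlim (\<lambda>t. ?l t $ j - ?l t $ i) at_top at_top" by (simp only:)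
    qed
    from tendsto_diff[OF this tendsto_const[of D]]
    show "((\<lambda>t. ln_slope_average (?l t) a b \<rho> - D) \<longlongrightarrow> 0) at_top" by (simp add: D_def)
  qed measurable
  then have "((\<lambda>t. (\<integral>l. heat_weight t l * (ln_slope_average l a b \<rho> - D) \<partial>trace_free_lborel) / heat_mass TYPE('n) t + D) \<longlongrightarrow> 0 + D) at_top"
    by (intro tendsto_add tendsto_const)
  then have "((\<lambda>t. deriv (I2 H t) \<rho>) \<longlongrightarrow> 0 + D) at_top"
  proof (rule Lim_transform_eventually)
    show "\<forall>\<^sub>F t in at_top. (\<integral>l. heat_weight t l * (ln_slope_average l a b \<rho> - D) \<partial>trace_free_lborel) / heat_mass TYPE('n) t + D = deriv (I2 H t) \<rho>"
      using eventually_gt_at_top[of 0]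
    proof eventually_elim
      case (elim t)
      have int: "integrable trace_free_lborel (\<lambda>l. heat_weight t l * ln_slope_average l a b \<rho>)"
        by (rule integrable_heat_weight[OF elim, where C = C and K = 0]) (use bound in auto)
      have "(\<integral>l. heat_weight t l * (ln_slope_average l a b \<rho> - D) \<partial>trace_free_lborel)
        = (\<integral>l. heat_weight t l * ln_slope_average l a b \<rho> \<partial>trace_free_lborel) - heat_mass TYPE('n) t * D"
      proof -
        have "integrable trace_free_lborel (\<lambda>l :: 'n rvec. heat_weight t l * D)"
          by (rule integrable_mult_left[OF heat_weight_integrable[OF elim]])
        then show ?thesis using int by (simp add: right_diff_distrib heat_mass_def)
      qed
      then show ?case
        using heat_mass_pos[OF elim, where 'n = 'n] DERIV_imp_deriv[OF I2_deriv[OF elim ab \<rho>]]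
        by (simp add: diff_divide_distrib)
    qed
  qed
  then show ?thesis by (simp add: D_def)
qed

end

section \<open>The dilogarithm\<close>

text \<open>The majorant joins two regimes. For \<open>s \<le> 1/2\<close> one has
  \<open>- ln (1 - s) \<le> s / (1 - s) \<le> 2 * s\<close>, so the quotient is at most 2; for
  larger \<open>s\<close> the factor \<open>1 / s\<close> is below 2. At the end points HOL gives
  the integrand the value 0.\<close>

lemma dilog_integrand_integrable: "(\<lambda>s::real. ln (1 - s) / s) integrable_on {0..1}"
proof (rule measurable_bounded_by_integrable_imp_integrable)
  have [measurable]: "(\<lambda>s::real. ln (1 - s) / s) \<in> borel_measurable lborel" by measurable
  show "(\<lambda>s::real. ln (1 - s) / s) \<in> borel_measurable (lebesgue_on {0..1})"
    by (intro measurable_restrict_space1 measurable_completion) measurable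
  have "((\<lambda>s::real. - ln (1 - s)) has_integral (((1 - 1) * ln (1 - 1) + 1) - ((1 - 0) * ln (1 - 0) + 0))) {0..1}"
  proof (rule fundamental_theorem_of_calculus_interior)
    have "continuous_on {0..1} (\<lambda>s::real. (1 - s) * ln (1 - s))"
      by (rule continuous_on_compose2[OF continuous_on_xlnx, of _ "\<lambda>s. 1 - s"]) (auto intro!: continuous_intros)
    then show "continuous_on {0..1} (\<lambda>s::real. (1 - s) * ln (1 - s) + s)" by (intro continuous_on_add continuous_on_id)
    fix s :: real assume s: "s \<in> {0<..<1}"
    have "((\<lambda>s. (1 - s) * ln (1 - s) + s) has_real_derivative - ln (1 - s)) (at s)"
    proof -
      have "((\<lambda>s. (1 - s) * ln (1 - s) + s) has_real_derivative
          ((0 - 1) * ln (1 - s) + inverse (1 - s) * (0 - 1) * (1 - s)) + 1) (at s)"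
        using s by (intro DERIV_add DERIV_mult DERIV_chain2[OF DERIV_ln] DERIV_diff DERIV_const DERIV_ident) auto
      then show ?thesis using s by simp
    qed
    then show "((\<lambda>s. (1 - s) * ln (1 - s) + s) has_vector_derivative - ln (1 - s)) (at s)"
      by (simp add: has_real_derivative_iff_has_vector_derivative)
  qed simp
  then have "(\<lambda>s::real. - ln (1 - s)) integrable_on {0..1}" by blast
  then have "(\<lambda>s::real. 2 * (- ln (1 - s))) integrable_on {0..1}" by (rule integrable_on_mult_right)
  then show "(\<lambda>s::real. 2 + 2 * (- ln (1 - s))) integrable_on {0..1}"
    by (intro integrable_add) (auto intro: integrable_const_ivl)
  fix s :: real assume s: "s \<in> {0..1}"
  show "norm (ln (1 - s) / s) \<le> 2 + 2 * (- ln (1 - s))"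
  proof (cases "s \<le> 1 / 2")
    case True
    show ?thesis
    proof (cases "s = 0")
      case False
      then have s0: "0 < s" using s by simp
      have le: "ln (1 - s) \<le> 0" using s0 True by simp
      have "ln (1 / (1 - s)) \<le> 1 / (1 - s) - 1" using True s0 by (intro ln_le_minus_one) auto
      also have "\<dots> = s / (1 - s)" using True by (simp add: field_simps)
      also have "\<dots> \<le> s / (1 / 2)" using True s0 by (intro divide_left_mono) auto
      finally have "- ln (1 - s) \<le> 2 * s" using True by (simp add: ln_div)
      then have "- ln (1 - s) / s \<le> 2" by (simp only: pos_divide_le_eq[OF s0])
      then show ?thesis using le s0 by (simp add: abs_divide)
    qed simp
  next
    case False
    show ?thesis
    proof (cases "s = 1")
      case False
      then have s1: "1 / 2 < s" "s < 1" using s \<open>\<not> s \<le> 1 / 2\<close> by auto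
      have le: "ln (1 - s) \<le> 0" using s1 by simp
      have "- ln (1 - s) / s \<le> - ln (1 - s) / (1 / 2)"
        using s1 le by (intro divide_left_mono) auto
      then show ?thesis using le s1 by (simp add: abs_divide)
    qed simp
  qed
qed auto

lemma continuous_on_dilog: "continuous_on {0..1} dilog"
  unfolding dilog_def[abs_def]
  by (intro continuous_on_minus indefinite_integral_continuous_1 dilog_integrand_integrable)

lemma dilog_0: "dilog 0 = 0"
  by (simp add: dilog_def)

lemma dilog_deriv:
  assumes "0 < \<rho>" "\<rho> < 1"
  shows "(dilog has_real_derivative - (ln (1 - \<rho>) / \<rho>)) (at \<rho>)"
proof -
  have "continuous (at \<rho> within {0..1}) (\<lambda>s. ln (1 - s) / s)"
  proof (rule continuous_at_imp_continuous_at_within)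
    have "((\<lambda>s. ln (1 - s)) has_real_derivative inverse (1 - \<rho>) * (0 - 1)) (at \<rho>)"
      using assms by (intro DERIV_chain2[OF DERIV_ln] DERIV_diff DERIV_const DERIV_ident) auto
    then have "isCont (\<lambda>s. ln (1 - s)) \<rho>" by (rule DERIV_isCont)
    then show "isCont (\<lambda>s. ln (1 - s) / s) \<rho>"
      by (rule isCont_divide[OF _ continuous_ident]) (use assms in simp)
  qed
  then have "((\<lambda>u. integral {0..u} (\<lambda>s. ln (1 - s) / s)) has_vector_derivative ln (1 - \<rho>) / \<rho>) (at \<rho> within {0..1})"
    using assms integral_has_vector_derivative_continuous_at[where S = "{}", OF dilog_integrand_integrable, of \<rho>]
    unfolding Diff_empty by (meson atLeastAtMost_iff finite.emptyI less_imp_le)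
  then have "((\<lambda>u. integral {0..u} (\<lambda>s. ln (1 - s) / s)) has_real_derivative ln (1 - \<rho>) / \<rho>) (at \<rho>)"
    using assms by (simp add: at_within_Icc_at has_real_derivative_iff_has_vector_derivative)
  then show ?thesis unfolding dilog_def[abs_def] by (rule DERIV_minus)
qed

text \<open>Two functions with the same derivative inside the interval differ by a constant,
  provided that both are continuous up to the end points. Continuity transports the value at 0
  inward and, for the closed interval, the equality out to 1, where no derivative is
  prescribed.\<close>

lemma is_I2_infinity_iff_dilog:
  assumes lim: "\<And>\<rho>. 0 < \<rho> \<Longrightarrow> \<rho> < 1 \<Longrightarrow> ((\<lambda>t. deriv (I2 H t) \<rho>) \<longlongrightarrow> - (ln (1 - \<rho>) / \<rho>)) at_top"
    and S: "S \<in> {{0..<1}, {0..1}}"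
  shows "is_I2_infinity H S J \<longleftrightarrow> (\<forall>\<rho>\<in>S. J \<rho> = dilog \<rho>)"
proof -
  have L: "Lim at_top (\<lambda>t. deriv (I2 H t) \<rho>) = - (ln (1 - \<rho>) / \<rho>)" if "0 < \<rho>" "\<rho> < 1" for \<rho>
    using lim[OF that] by (intro tendsto_Lim) auto
  have S01: "S \<subseteq> {0..1}" "0 \<in> S" "{0<..<1} \<subseteq> S" using S by auto
  show ?thesis
  proof
    assume J: "is_I2_infinity H S J"
    then have Jc: "continuous_on S J" and J0: "J 0 = 0"
      and Jd: "\<And>\<rho>. 0 < \<rho> \<Longrightarrow> \<rho> < 1 \<Longrightarrow> (J has_real_derivative - (ln (1 - \<rho>) / \<rho>)) (at \<rho>)"
      using L by (auto simp: is_I2_infinity_def)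
    show "\<forall>\<rho>\<in>S. J \<rho> = dilog \<rho>"
    proof
      fix x assume x: "x \<in> S"
      show "J x = dilog x"
      proof (cases "x = 0")
        case False
        then have x0: "0 < x" using x S01 by auto
        have x1: "x \<le> 1" using x S01(1) by auto
        have sub: "{0..x} \<subseteq> S" using x S by auto
        have "J x - dilog x = J 0 - dilog 0"
        proof (rule DERIV_isconst_end[OF x0])
          show "continuous_on {0..x} (\<lambda>y. J y - dilog y)"
            using sub x1 by (intro continuous_on_diff continuous_on_subset[OF Jc] continuous_on_subset[OF continuous_on_dilog]) auto
          fix y assume y: "0 < y" "y < x"
          then have y1: "y < 1" using x1 by linarith
          from DERIV_diff[OF Jd[OF y(1) y1] dilog_deriv[OF y(1) y1]]
          show "((\<lambda>y. J y - dilog y) has_real_derivative 0) (at y)" by simp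
        qed
        then show ?thesis using J0 dilog_0 by simp
      qed (use J0 dilog_0 in simp)
    qed
  next
    assume eq: "\<forall>\<rho>\<in>S. J \<rho> = dilog \<rho>"
    show "is_I2_infinity H S J"
      unfolding is_I2_infinity_def
    proof (intro conjI ballI)
      have "continuous_on S dilog" using S01 by (intro continuous_on_subset[OF continuous_on_dilog]) auto
      then show "continuous_on S J" by (rule continuous_on_eq) (use eq in simp)
      show "J 0 = 0" using eq S01 dilog_0 by auto
      fix \<rho> :: real assume \<rho>: "\<rho> \<in> {0<..<1}"
      have "(J has_real_derivative - (ln (1 - \<rho>) / \<rho>)) (at \<rho>)"
        by (rule has_field_derivative_transform_within_open[OF dilog_deriv, where S = "{0<..<1}"]) (use \<rho> eq S01 in auto)
      then show "(J has_real_derivative Lim at_top (\<lambda>t. deriv (I2 H t) \<rho>)) (at \<rho>)"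
        using L \<rho> by simp
    qed
  qed
qed

text \<open>Base point freeness gives a section that does not vanish at \<open>x\<close>, possibly
  in another frame; the transition function moves it to frame \<open>p\<close>, where it is a
  combination of the basis. This keeps the denominators in \<open>two_point\<close> and
  \<open>berezin\<close> away from 0.\<close>

lemma basis_at_nonzero:
  assumes line_bundle: "holomorphic_line_bundle U \<phi> g" and bpf: "base_point_free U \<phi> g k"
    and basis: "orthonormal_basis U \<phi> g h k s" and x: "x \<in> U p"
  shows "basis_at s p x \<noteq> 0"
proof
  assume "basis_at s p x = 0"
  then have s0: "s a p x = 0" for a by (simp add: basis_at_def vec_eq_iff)
  obtain \<sigma> i where \<sigma>: "\<sigma> \<in> sections U \<phi> g k" "x \<in> U i" "\<sigma> i x \<noteq> 0"
    using bpf unfolding base_point_free_def by blast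
  have "\<forall>i j. \<forall>x\<in>U i \<inter> U j. \<sigma> i x = g i j x ^ k * \<sigma> j x"
    using \<sigma>(1) unfolding sections_def mem_Collect_eq by (elim conjE)
  then have "\<sigma> i x = g i p x ^ k * \<sigma> p x" using \<sigma>(2) x by blast
  moreover have "\<exists>!c. \<sigma> = (\<lambda>i x. \<Sum>a\<in>UNIV. c $ a * s a i x)"
    using basis[unfolded orthonormal_basis_def, THEN conjunct2, THEN conjunct1] \<sigma>(1) by (rule bspec)
  then obtain c where "\<sigma> = (\<lambda>i x. \<Sum>a\<in>UNIV. c $ a * s a i x)" by (rule ex1E)
  then have "\<sigma> p x = (\<Sum>a\<in>UNIV. c $ a * s a p x)" by simp
  ultimately show False using \<sigma>(3) s0 by simp
qed

lemma berezin_eq_cinner: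
  "berezin s p q x y = (cmod (cinner (basis_at s p x) (basis_at s q y)))\<^sup>2 / ((norm (basis_at s p x))\<^sup>2 * (norm (basis_at s q y))\<^sup>2)"
proof -
  have "cinner (basis_at s p x) (basis_at s q y) = cnj (\<Sum>a\<in>UNIV. s a p x * cnj (s a q y))"
    by (simp add: cinner_def basis_at_def)
  then have eq: "cmod (cinner (basis_at s p x) (basis_at s q y)) = cmod (\<Sum>a\<in>UNIV. s a p x * cnj (s a q y))"
    by (simp only: complex_mod_cnj)
  show ?thesis unfolding berezin_def norm_vec_square eq by (simp add: basis_at_def)
qed

theorem mainTheorem2:
  fixes U :: "'i \<Rightarrow> 'm::t2_space set"
    and \<phi> :: "'i \<Rightarrow> 'm \<Rightarrow> complex^'d"
    and g :: "'i \<Rightarrow> 'i \<Rightarrow> 'm \<Rightarrow> complex"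
    and h :: "'i \<Rightarrow> 'm \<Rightarrow> real"
    and k :: nat
    and s :: "'n::{finite,linorder} \<Rightarrow> 'i \<Rightarrow> 'm \<Rightarrow> complex"
    and H :: "('n cmat) measure"
  assumes "compact (UNIV :: 'm set)"
    and "holomorphic_atlas U \<phi>"
    and "holomorphic_line_bundle U \<phi> g"
    and "ample U \<phi> g"
    and "hermitian_metric U \<phi> g h"
    and "kaehler_curvature U \<phi> h"
    and "0 < k"
    and "base_point_free U \<phi> g k"
    and "orthonormal_basis U \<phi> g h k s"
    and "2 \<le> CARD('n)"
    and "unitary_haar H"
  shows
    "(\<forall>t>0. \<forall>p q z1 z2. z1 \<in> U p \<longrightarrow> z2 \<in> U q \<longrightarrow>
        two_point H t (basis_at s p z1) (basis_at s q z2) = I2 H t (berezin s p q z1 z2))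
     \<and> (\<forall>t>0. \<forall>u v. norm u = 1 \<longrightarrow> norm v = 1 \<longrightarrow>
        two_point H t u v = I2 H t ((cmod (cinner u v))\<^sup>2))
     \<and> (\<forall>t>0. \<forall>\<rho>\<in>{0<..<1}. I2 H t differentiable (at \<rho>))
     \<and> (\<forall>\<rho>\<in>{0<..<1}.
        ((\<lambda>t. deriv (I2 H t) \<rho>) \<longlongrightarrow> - (ln (1 - \<rho>) / \<rho>)) at_top)
     \<and> (\<forall>S\<in>{{0..<1}, {0..1}}. \<forall>J.
        is_I2_infinity H S J \<longleftrightarrow> (\<forall>\<rho>\<in>S. J \<rho> = dilog \<rho>))"
proof -
  interpret heat_setting H
    by (intro heat_setting.intro haar_measure.intro) fact
  have "\<exists>a b :: 'n. a \<noteq> b"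
  proof (rule ccontr)
    assume "\<not> (\<exists>a b :: 'n. a \<noteq> b)"
    then have "CARD('n) \<le> 1" by (auto simp: card_le_Suc0_iff_eq)
    then show False using \<open>2 \<le> CARD('n)\<close> by simp
  qed
  \<comment> \<open>Any two basis vectors span a suitable plane; their existence is where
    \<open>2 \<le> CARD('n)\<close> enters.\<close>
  then obtain a b :: 'n where ab: "a \<noteq> b" by blast
  have "two_point H t (basis_at s p z1) (basis_at s q z2) = I2 H t (berezin s p q z1 z2)"
    if "0 < t" "z1 \<in> U p" "z2 \<in> U q" for t p q z1 z2
    unfolding berezin_eq_cinner
    by (intro two_point_general that basis_at_nonzero[where h = h]) fact+
  moreover have "I2 H t differentiable (at \<rho>)" if "0 < t" "\<rho> \<in> {0<..<1}" for t \<rho>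
    using I2_deriv[OF that(1) ab, of \<rho>] that(2) by (auto simp: real_differentiable_def)
  moreover have lim: "((\<lambda>t. deriv (I2 H t) \<rho>) \<longlongrightarrow> - (ln (1 - \<rho>) / \<rho>)) at_top" if "0 < \<rho>" "\<rho> < 1" for \<rho>
    by (rule I2_deriv_limit[OF ab that])
  ultimately show ?thesis
    using two_point_unit is_I2_infinity_iff_dilog[OF lim] by (intro conjI allI impI ballI) auto
qed

end
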